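(* Let $f\in H_\kappa$ or $f\in S_\mu$, with normalized Fourier coefficients $\lambda_f(n)$, and let $\chi$ be a primitive Dirichlet character of modulus $p$, where $p$ is a prime. Then for any integer $\ell\ge 3$ and any $\varepsilon>0$, we have $$\sum_{n\le X}\lambda_f(n)\,r_\ell(n)\,\chi(n)\ll_{f,\ell,\varepsilon} p^{\frac{\ell-2}{2\ell+1}}\,X^{\frac{\ell}{2}-\frac{\ell-2}{2\ell+1}+\varepsilon}$$ for $p<X$.
   Context: The sum runs over integers $n$ with $1\le n\le X$. $H_\kappa$ is the set of normalized primitive holomorphic cusp forms (Hecke eigenforms with $\lambda_f(1)=1$) of even integral weight $\kappa$ for $\mathrm{SL}_2(\mathbb{Z})$; $f\in H_\kappa$ has the Fourier expansion $f(z)=\sum_{n\ge 1}\lambda_f(n)n^{(\kappa-1)/2}e(nz)$ for $\operatorname{Im} z>0$. $S_\mu$ is the set of normalized primitive (Hecke) Maass cusp forms for $\mathrm{SL}_2(\mathbb{Z})$ of Laplace eigenvalue $1/4+\mu^2$, $\mu>0$; $f\in S_\mu$ has the Fourier expansion $f(z)=\sqrt{y}\sum_{n\ne 0}\lambda_f(n)K_{i\mu}(2\pi|n|y)e(nx)$, $z=x+iy$, with $\lambda_f(1)=1$. Here $e(x)=\exp(2\pi i x)$ and $K_{i\mu}$ is the modified Bessel function of the second kind. For integers $\ell\ge1$ and $n$, $r_\ell(n)=\#\{(n_1,\dots,n_\ell)\in\mathbb{Z}^\ell : n_1^2+\cdots+n_\ell^2=n\}$. $A\ll_{a,b,c}B$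 means $|A|\le C\,B$ with a constant $C$ depending at most on $a,b,c$. *)

theory Defs
  imports "HOL-Complex_Analysis.Complex_Analysis" "HOL-Number_Theory.Number_Theory"
begin

definition upper_half_plane :: "complex set" ("\<H>") where
  "\<H> = {z. Im z > 0}"

definition ee :: "complex \<Rightarrow> complex" where
  "ee z = exp (2 * of_real pi * \<i> * z)"

definition mobius :: "int \<Rightarrow> int \<Rightarrow> int \<Rightarrow> int \<Rightarrow> complex \<Rightarrow> complex" where
  "mobius a b c d z = (of_int a * z + of_int b) / (of_int c * z + of_int d)"

text \<open>
  The \<open>n\<close>-th Hecke operator in weight \<open>k\<close>,
  \<open>n^((k-1)/2) * (\<Sum>ad = n. d^(-k) * (\<Sum>b mod d. f ((a z + b) / d)))\<close>.
  The scaling is the one for which the eigenvalue on a normalized eigenform is the normalized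
  Fourier coefficient \<open>\<lambda>\<^sub>f(n)\<close>, both for holomorphic forms of weight \<open>k\<close> and, with \<open>k = 0\<close>, for
  Maass forms.
\<close>
definition hecke_op :: "nat \<Rightarrow> nat \<Rightarrow> (complex \<Rightarrow> complex) \<Rightarrow> complex \<Rightarrow> complex" where
  "hecke_op k n f z =
     of_real (real n powr ((real k - 1) / 2)) *
     (\<Sum>d | d dvd n. (\<Sum>b<d. f ((of_nat (n div d) * z + of_nat b) / of_nat d)) / of_nat d ^ k)"

definition hecke_eigenfunction :: "nat \<Rightarrow> (complex \<Rightarrow> complex) \<Rightarrow> bool" where
  "hecke_eigenfunction k f \<longleftrightarrow>
     (\<forall>n\<ge>1. \<exists>c. \<forall>z\<in>\<H>. hecke_op k n f z = c * f z)"

text \<open>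
  Given the other two conditions, convergence to 0 as \<open>Im z\<close> tends to infinity (uniformly in
  \<open>Re z\<close>) says that \<open>f\<close> is holomorphic at the cusp and vanishes there.
\<close>
definition holomorphic_cusp_form :: "nat \<Rightarrow> (complex \<Rightarrow> complex) \<Rightarrow> bool" where
  "holomorphic_cusp_form k f \<longleftrightarrow>
     f holomorphic_on \<H> \<and>
     (\<forall>a b c d. a * d - b * c = 1 \<longrightarrow>
        (\<forall>z\<in>\<H>. f (mobius a b c d z) = (of_int c * z + of_int d) ^ k * f z)) \<and>
     (f \<longlongrightarrow> 0) (filtercomap Im at_top)"

text \<open>
  Only the values of \<open>lam\<close> at positive integers matter; the index type is \<open>int\<close> so that the same
  kind of coefficient function serves for Maass forms.
\<close>
definition holomorphic_fourier_coeffs ::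
    "nat \<Rightarrow> (complex \<Rightarrow> complex) \<Rightarrow> (int \<Rightarrow> complex) \<Rightarrow> bool" where
  "holomorphic_fourier_coeffs k f lam \<longleftrightarrow>
     (\<forall>z\<in>\<H>. ((\<lambda>n. lam n * of_real (of_int n powr ((real k - 1) / 2)) * ee (of_int n * z))
               has_sum f z) {1..})"

definition primitive_holomorphic_forms :: "nat \<Rightarrow> (complex \<Rightarrow> complex) set" where
  "primitive_holomorphic_forms k =
     {f. holomorphic_cusp_form k f \<and> hecke_eigenfunction k f \<and>
         (\<exists>lam. holomorphic_fourier_coeffs k f lam \<and> lam 1 = 1)}"

definition partial_x :: "(complex \<Rightarrow> complex) \<Rightarrow> complex \<Rightarrow> complex" where
  "partial_x f z = vector_derivative (\<lambda>t::real. f (z + of_real t)) (at 0)"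

definition partial_y :: "(complex \<Rightarrow> complex) \<Rightarrow> complex \<Rightarrow> complex" where
  "partial_y f z = vector_derivative (\<lambda>t::real. f (z + \<i> * of_real t)) (at 0)"

text \<open>\<open>C\<^sup>m\<close> in the real sense: all partial derivatives of order at most \<open>m\<close> exist and are continuous.\<close>
fun Ck_on_H :: "nat \<Rightarrow> (complex \<Rightarrow> complex) \<Rightarrow> bool" where
  "Ck_on_H 0 f \<longleftrightarrow> continuous_on \<H> f"
| "Ck_on_H (Suc m) f \<longleftrightarrow>
     continuous_on \<H> f \<and>
     (\<forall>z\<in>\<H>. (\<lambda>t::real. f (z + of_real t)) differentiable (at 0) \<and>
             (\<lambda>t::real. f (z + \<i> * of_real t)) differentiable (at 0)) \<and>
     Ck_on_H m (partial_x f) \<and> Ck_on_H m (partial_y f)"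

definition smooth_on_H :: "(complex \<Rightarrow> complex) \<Rightarrow> bool" where
  "smooth_on_H f \<longleftrightarrow> (\<forall>m. Ck_on_H m f)"

definition hyperbolic_laplacian :: "(complex \<Rightarrow> complex) \<Rightarrow> complex \<Rightarrow> complex" where
  "hyperbolic_laplacian f z =
     - of_real ((Im z)\<^sup>2) * (partial_x (partial_x f) z + partial_y (partial_y f) z)"

text \<open>
  The modified Bessel function of the second kind for \<open>x > 0\<close>, by its integral representation
  \<open>K\<^sub>\<nu>(x) = \<integral>\<^sub>0\<^sup>\<infinity> exp (- x cosh t) cosh (\<nu> t) dt\<close>, valid for all complex \<open>\<nu>\<close>.
\<close>
definition bessel_K :: "complex \<Rightarrow> real \<Rightarrow> complex" where
  "bessel_K \<nu> x =
     (LBINT t:{0..}. of_real (exp (- x * cosh t)) * cosh (\<nu> * of_real t))"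

text \<open>
  The last two conditions are moderate growth at the cusp and vanishing of the constant term
  of the Fourier expansion.
\<close>
definition maass_cusp_form :: "real \<Rightarrow> (complex \<Rightarrow> complex) \<Rightarrow> bool" where
  "maass_cusp_form \<mu> f \<longleftrightarrow>
     smooth_on_H f \<and>
     (\<forall>a b c d. a * d - b * c = 1 \<longrightarrow> (\<forall>z\<in>\<H>. f (mobius a b c d z) = f z)) \<and>
     (\<forall>z\<in>\<H>. hyperbolic_laplacian f z = of_real (1 / 4 + \<mu>\<^sup>2) * f z) \<and>
     (\<exists>C N. \<forall>z. Im z \<ge> 1 \<longrightarrow> norm (f z) \<le> C * Im z ^ N) \<and>
     (\<forall>y>0. ((\<lambda>x. f (Complex x y)) has_integral 0) {0..1})"

definition maass_fourier_coeffs ::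
    "real \<Rightarrow> (complex \<Rightarrow> complex) \<Rightarrow> (int \<Rightarrow> complex) \<Rightarrow> bool" where
  "maass_fourier_coeffs \<mu> f lam \<longleftrightarrow>
     (\<forall>x y. y > 0 \<longrightarrow>
        ((\<lambda>n. of_real (sqrt y) * lam n * bessel_K (\<i> * of_real \<mu>) (2 * pi * \<bar>of_int n\<bar> * y) *
               ee (of_int n * of_real x))
         has_sum f (Complex x y)) (- {0}))"

definition primitive_maass_forms :: "real \<Rightarrow> (complex \<Rightarrow> complex) set" where
  "primitive_maass_forms \<mu> =
     {f. maass_cusp_form \<mu> f \<and> hecke_eigenfunction 0 f \<and>
         (\<exists>lam. maass_fourier_coeffs \<mu> f lam \<and> lam 1 = 1)}"

definition dirichlet_character :: "nat \<Rightarrow> (int \<Rightarrow> complex) \<Rightarrow> bool" where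
  "dirichlet_character q chi \<longleftrightarrow>
     q > 0 \<and>
     (\<forall>n. chi (n + int q) = chi n) \<and>
     (\<forall>m n. chi (m * n) = chi m * chi n) \<and>
     (\<forall>n. chi n \<noteq> 0 \<longleftrightarrow> coprime n (int q))"

text \<open>Primitive: not induced by a character modulo a proper divisor \<open>d\<close> of the modulus.\<close>
definition primitive_dirichlet_character :: "nat \<Rightarrow> (int \<Rightarrow> complex) \<Rightarrow> bool" where
  "primitive_dirichlet_character q chi \<longleftrightarrow>
     dirichlet_character q chi \<and>
     (\<forall>d. d dvd q \<and> d < q \<longrightarrow>
        \<not> (\<exists>\<psi>. dirichlet_character d \<psi> \<and> (\<forall>n. coprime n (int q) \<longrightarrow> chi n = \<psi> n)))"

definition num_sum_squares :: "nat \<Rightarrow> int \<Rightarrow> nat" where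
  "num_sum_squares l n = card {v :: int list. length v = l \<and> (\<Sum>x\<leftarrow>v. x\<^sup>2) = n}"

end

theory Submission imports Defs begin

text \<open>
  The sum is evaluated by the circle method. With \<open>\<theta>(\<alpha>) = \<Sum>\<^sub>|\<^sub>m\<^sub>|\<^sub>\<le>\<^sub>H e(m\<^sup>2 \<alpha>)\<close>, \<open>H = \<lfloor>\<surd>X\<rfloor>\<close>, and
  \<open>S(\<alpha>) = \<Sum>\<^sub>n\<^sub>\<le>\<^sub>X \<lambda>(n) \<chi>(n) e(-n \<alpha>)\<close>, the sum is the mean value of \<open>\<theta>\<^sup>l S\<close> over \<open>\<alpha>\<close>.
  All mean values are taken over the points \<open>j/Q\<close> with \<open>j < Q\<close> and \<open>Q\<close> larger than every
  frequency that occurs, so that orthogonality is the summation of a finite geometric series.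
  Three estimates go into it.

  \<^item> Wilton's bound \<open>S(\<alpha>) \<lless> p\<^sup>1\<^sup>/\<^sup>2 X\<^sup>1\<^sup>/\<^sup>2\<^sup>+\<^sup>\<delta>\<close>, uniformly in \<open>\<alpha>\<close> (\<open>wilton_bound\<close>, \<open>twisted_sum_bound\<close>).
    Without the character it comes from the boundedness of \<open>y\<^sup>k\<^sup>/\<^sup>2 |f(z)|\<close> (weight \<open>k\<close>), respectively \<open>|f(z)|\<close>
    (Maass), on the upper half-plane (\<open>invariant_expansion_bounded\<close>): a block of coefficients with \<open>n\<close> between \<open>N\<close> and \<open>2N\<close> is read off
    at height \<open>y \<asymp> 1/N\<close> with a Dirichlet kernel, whose mean absolute value is only logarithmic. The
    character is expanded into additive characters modulo \<open>p\<close>; by Parseval and the Cauchy-Schwarz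
    inequality its Fourier coefficients cost at most \<open>\<surd>p\<close>.
  \<^item> The second moment \<open>\<Sum>\<^sub>n\<^sub>\<le>\<^sub>X |\<lambda>(n)|\<^sup>2 \<lless> X\<close>, by Bessel's inequality at the same height
    (\<open>second_moment_bound\<close>).
  \<^item> The fourth moment of \<open>\<theta>\<close>, which counts the solutions of \<open>a\<^sup>2 + b\<^sup>2 = c\<^sup>2 + d\<^sup>2\<close> and is
    \<open>\<lless> X\<^sup>1\<^sup>+\<^sup>\<delta>\<close> (\<open>square_energy_bound\<close>).

  For \<open>l \<ge> 4\<close>, bounding \<open>S\<close> and \<open>\<theta>\<^sup>l\<^sup>-\<^sup>4\<close> by their suprema gives \<open>p\<^sup>1\<^sup>/\<^sup>2 X\<^sup>l\<^sup>/\<^sup>2\<^sup>-\<^sup>1\<^sup>/\<^sup>2\<^sup>+\<^sup>\<epsilon>\<close>. For \<open>l = 3\<close>, splitting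
  \<open>|\<theta>|\<^sup>3 |S| = (|\<theta>|\<^sup>2 |S|\<^sup>1\<^sup>/\<^sup>2) (|\<theta>| |S|\<^sup>1\<^sup>/\<^sup>2)\<close> and applying the Cauchy-Schwarz inequality twice gives
  \<open>p\<^sup>1\<^sup>/\<^sup>4 X\<^sup>3\<^sup>/\<^sup>2\<^sup>-\<^sup>1\<^sup>/\<^sup>4\<^sup>+\<^sup>\<epsilon>\<close> (\<open>circle_method_bounds\<close>). Thus the saving over \<open>X\<^sup>l\<^sup>/\<^sup>2\<close> is \<open>(X/p)\<^sup>s\<close> with \<open>s = 1/2\<close>,
  respectively \<open>s = 1/4\<close>; both exponents are at least \<open>(l - 2) / (2l + 1)\<close>, and \<open>X/p > 1\<close>.
\<close>

section \<open>Exponential sums over the points j/Q\<close>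

definition unit_exp :: "real \<Rightarrow> complex" where
  "unit_exp x = cis (2 * pi * x)"

lemma unit_exp_add: "unit_exp (x + y) = unit_exp x * unit_exp y"
  by (simp add: unit_exp_def cis_mult distrib_left)

lemma norm_unit_exp [simp]: "norm (unit_exp x) = 1"
  by (simp add: unit_exp_def)

lemma unit_exp_0 [simp]: "unit_exp 0 = 1"
  by (simp add: unit_exp_def)

lemma cnj_unit_exp: "cnj (unit_exp x) = unit_exp (- x)"
  by (simp add: unit_exp_def cis_cnj)

lemma unit_exp_power: "unit_exp x ^ n = unit_exp (real n * x)"
  by (simp add: unit_exp_def Complex.DeMoivre mult.left_commute)

lemma unit_exp_of_int [simp]: "unit_exp (of_int n) = 1"
  by (simp add: unit_exp_def cis.ctr complex_eq_iff)

lemma unit_exp_eq_1_iff: "unit_exp x = 1 \<longleftrightarrow> x \<in> \<int>"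
proof
  assume "unit_exp x = 1"
  hence "exp (\<i> * of_real (2 * pi * x)) = 1"
    by (simp add: unit_exp_def cis_conv_exp)
  then obtain n :: int where "Im (\<i> * of_real (2 * pi * x)) = of_int (2 * n) * pi"
    unfolding exp_eq_1 by blast
  thus "x \<in> \<int>" by simp
qed (auto elim!: Ints_cases)

lemma ee_of_real: "ee (of_real x) = unit_exp x"
  by (simp add: ee_def unit_exp_def cis_conv_exp mult_ac)

lemma sum_unit_exp_residues:
  assumes "Q > 0"
  shows "(\<Sum>j<Q. unit_exp (of_int k * real j / real Q)) = (if int Q dvd k then of_nat Q else 0)"
proof -
  define z where "z = unit_exp (of_int k / real Q)"
  have pw: "unit_exp (of_int k * real j / real Q) = z ^ j" for j
    by (simp add: z_def unit_exp_power mult_ac)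
  have zQ: "z ^ Q = 1"
    using assms by (simp add: z_def unit_exp_power)
  have "z = 1 \<longleftrightarrow> int Q dvd k"
  proof -
    have "of_int k / real Q \<in> \<int> \<longleftrightarrow> int Q dvd k"
    proof
      assume "of_int k / real Q \<in> \<int>"
      then obtain m where "of_int k / real Q = of_int m" by (auto elim: Ints_cases)
      hence "real_of_int k = of_int (m * int Q)" using assms by (simp add: field_simps)
      hence "k = m * int Q" by linarith
      thus "int Q dvd k" by simp
    next
      assume "int Q dvd k"
      then obtain m where "k = int Q * m" by blast
      thus "of_int k / real Q \<in> \<int>" using assms by simp
    qed
    thus ?thesis by (simp add: z_def unit_exp_eq_1_iff)
  qed
  thus ?thesis
    using zQ geometric_sum[of z Q] by (auto simp: pw)
qed

text \<open>
  All finite Fourier analysis below is an instance of this identity: the phases \<open>s\<close> and \<open>t\<close> are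
  integers, residues, sums of two squares or sums of \<open>l\<close> squares, depending on the index sets.
\<close>

lemma exp_sum_orthogonality:
  fixes a :: "'a \<Rightarrow> complex" and b :: "'b \<Rightarrow> complex"
  assumes "Q > 0"
  shows "(\<Sum>j<Q. (\<Sum>x\<in>A. a x * unit_exp (of_int (s x) * real j / real Q)) *
                   (\<Sum>y\<in>B. b y * unit_exp (- of_int (t y) * real j / real Q)))
         = of_nat Q * (\<Sum>x\<in>A. \<Sum>y\<in>B. if int Q dvd s x - t y then a x * b y else 0)"
proof -
  have "(\<Sum>j<Q. (\<Sum>x\<in>A. a x * unit_exp (of_int (s x) * real j / real Q)) *
                   (\<Sum>y\<in>B. b y * unit_exp (- of_int (t y) * real j / real Q)))
     = (\<Sum>j<Q. \<Sum>x\<in>A. \<Sum>y\<in>B. a x * b y * unit_exp (of_int (s x - t y) * real j / real Q))"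
    unfolding sum_product
    by (intro sum.cong refl)
       (simp add: unit_exp_add[symmetric] algebra_simps diff_divide_distrib add_divide_distrib)
  also have "\<dots> = (\<Sum>x\<in>A. \<Sum>y\<in>B. \<Sum>j<Q. a x * b y * unit_exp (of_int (s x - t y) * real j / real Q))"
    by (subst sum.swap, rule sum.cong[OF refl], rule sum.swap)
  also have "\<dots> = (\<Sum>x\<in>A. \<Sum>y\<in>B. a x * b y * (if int Q dvd s x - t y then of_nat Q else 0))"
    by (simp only: sum_distrib_left[symmetric] sum_unit_exp_residues[OF assms])
  also have "\<dots> = of_nat Q * (\<Sum>x\<in>A. \<Sum>y\<in>B. if int Q dvd s x - t y then a x * b y else 0)"
    by (simp add: sum_distrib_left if_distrib mult_ac cong: if_cong)
  finally show ?thesis .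
qed

lemma zdvd_small_diff: 
  fixes s t :: int
  assumes "\<bar>s - t\<bar> < int Q"
  shows "int Q dvd s - t \<longleftrightarrow> s = t"
  using assms by (metis abs_of_nat dvd_0_right eq_iff_diff_eq_0 zdvd_imp_le zero_less_abs_iff abs_dvd_iff dvd_abs_iff not_less)

lemma exp_sum_orthogonality_exact:
  fixes a :: "'a \<Rightarrow> complex" and b :: "'b \<Rightarrow> complex"
  assumes "\<And>x y. x \<in> A \<Longrightarrow> y \<in> B \<Longrightarrow> \<bar>s x - t y\<bar> < int Q" and "Q > 0"
  shows "(\<Sum>j<Q. (\<Sum>x\<in>A. a x * unit_exp (of_int (s x) * real j / real Q)) *
                   (\<Sum>y\<in>B. b y * unit_exp (- of_int (t y) * real j / real Q)))
         = of_nat Q * (\<Sum>x\<in>A. \<Sum>y\<in>B. if s x = t y then a x * b y else 0)"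
  unfolding exp_sum_orthogonality[OF assms(2)]
  using assms(1) by (intro arg_cong2[where f="(*)"] sum.cong refl) (simp add: zdvd_small_diff)

lemma exp_sum_parseval:
  fixes d :: "int \<Rightarrow> complex"
  assumes fin: "finite I" and small: "\<And>m n. m \<in> I \<Longrightarrow> n \<in> I \<Longrightarrow> \<bar>m - n\<bar> < int Q" and Q: "Q > 0"
  shows "(\<Sum>j<Q. (norm (\<Sum>n\<in>I. d n * unit_exp (- of_int n * real j / real Q)))\<^sup>2)
         = real Q * (\<Sum>n\<in>I. (norm (d n))\<^sup>2)"
proof -
  have "complex_of_real (\<Sum>j<Q. (norm (\<Sum>n\<in>I. d n * unit_exp (- of_int n * real j / real Q)))\<^sup>2)
      = (\<Sum>j<Q. (\<Sum>n\<in>I. cnj (d n) * unit_exp (of_int n * real j / real Q)) *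
                   (\<Sum>n\<in>I. d n * unit_exp (- of_int n * real j / real Q)))"
    unfolding of_real_sum complex_norm_square
    by (simp add: cnj_unit_exp mult_ac)
  also have "\<dots> = of_nat Q * (\<Sum>m\<in>I. \<Sum>n\<in>I. if m = n then cnj (d m) * d n else 0)"
    by (rule exp_sum_orthogonality_exact[OF small Q])
  also have "\<dots> = complex_of_real (real Q * (\<Sum>n\<in>I. (norm (d n))\<^sup>2))"
    using fin by (simp add: of_real_sum complex_norm_square mult_ac sum.delta del: of_real_power)
  finally show ?thesis
    unfolding of_real_eq_iff .
qed

lemma sum_norm_le_sqrt:
  fixes u :: "nat \<Rightarrow> complex"
  shows "(\<Sum>j<Q. norm (u j)) \<le> sqrt (real Q * (\<Sum>j<Q. (norm (u j))\<^sup>2))"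
proof -
  have "(\<Sum>j<Q. 1 * norm (u j))\<^sup>2 \<le> (\<Sum>j<Q. 1\<^sup>2) * (\<Sum>j<Q. (norm (u j))\<^sup>2)"
    by (rule Cauchy_Schwarz_ineq_sum)
  thus ?thesis by (intro real_le_rsqrt) simp
qed

text \<open>
  Pairing with a finite exponential sum picks out finitely many coefficients of a bounded series. The
  absolutely summable tail is cut off so that it contributes at most \<open>1\<close>, whence \<open>B + 1\<close>; what remains is
  a trigonometric polynomial, for which the average over the points \<open>j/Q\<close> is exact as soon as \<open>Q\<close>
  exceeds all differences of frequencies.
\<close>

lemma bounded_trig_series_dual:
  fixes c :: "int \<Rightarrow> complex"
  assumes summ: "(\<lambda>n. norm (c n)) summable_on A"
    and G: "\<And>x. ((\<lambda>n. c n * unit_exp (of_int n * x)) has_sum G x) A"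
    and B: "\<And>x. norm (G x) \<le> B"
    and I: "finite I" "I \<subseteq> A"
  obtains Q0 where "Q0 > 0" "\<And>Q d. Q \<ge> Q0 \<Longrightarrow> real Q * norm (\<Sum>n\<in>I. c n * d n)
       \<le> (B + 1) * (\<Sum>j<Q. norm (\<Sum>n\<in>I. d n * unit_exp (- of_int n * real j / real Q)))"
proof -
  have "((\<lambda>n. norm (c n)) has_sum infsum (\<lambda>n. norm (c n)) A) A"
    using summ by (rule has_sum_infsum)
  hence "\<forall>\<^sub>F F in finite_subsets_at_top A. dist (\<Sum>n\<in>F. norm (c n)) (infsum (\<lambda>n. norm (c n)) A) < 1"
    unfolding has_sum_def using tendstoD zero_less_one by blast
  then obtain F0 where F0: "finite F0" "F0 \<subseteq> A"
      "\<forall>F. finite F \<and> F0 \<subseteq> F \<and> F \<subseteq> A \<longrightarrow>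
         dist (\<Sum>n\<in>F. norm (c n)) (infsum (\<lambda>n. norm (c n)) A) < 1"
    unfolding eventually_finite_subsets_at_top by (elim exE conjE) (rule that)
  define F where "F = F0 \<union> I"
  have F: "finite F" "F \<subseteq> A" "I \<subseteq> F" using F0 I by (auto simp: F_def)
  have sF: "(\<lambda>n. norm (c n)) summable_on F" using F by simp
  have tail_summ: "(\<lambda>n. norm (c n)) summable_on (A - F)"
    using summ by (rule summable_on_subset_banach) auto
  have "infsum (\<lambda>n. norm (c n)) A = infsum (\<lambda>n. norm (c n)) (F \<union> (A - F))"
    using F by (simp add: Un_absorb1)
  also have "\<dots> = (\<Sum>n\<in>F. norm (c n)) + infsum (\<lambda>n. norm (c n)) (A - F)"
    using sF tail_summ F by (subst infsum_Un_disjoint) auto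
  finally have tail: "infsum (\<lambda>n. norm (c n)) (A - F) \<le> 1"
    using F0(3)[rule_format, of F] F by (simp add: F_def dist_real_def)
  have approx: "norm (\<Sum>n\<in>F. c n * unit_exp (of_int n * x)) \<le> B + 1" for x
  proof -
    have s1: "(\<lambda>n. norm (c n * unit_exp (of_int n * x))) summable_on (A - F)"
      using tail_summ by (simp add: norm_mult)
    have s2: "(\<lambda>n. c n * unit_exp (of_int n * x)) summable_on (A - F)"
      using s1 by (rule abs_summable_summable)
    have "G x = infsum (\<lambda>n. c n * unit_exp (of_int n * x)) (F \<union> (A - F))"
      using G[of x] F by (simp add: Un_absorb1 infsumI)
    also have "\<dots> = (\<Sum>n\<in>F. c n * unit_exp (of_int n * x))
        + infsum (\<lambda>n. c n * unit_exp (of_int n * x)) (A - F)"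
      using s2 F by (subst infsum_Un_disjoint) auto
    finally have "(\<Sum>n\<in>F. c n * unit_exp (of_int n * x))
        = G x - infsum (\<lambda>n. c n * unit_exp (of_int n * x)) (A - F)" by simp
    also have "norm \<dots> \<le> norm (G x) + norm (infsum (\<lambda>n. c n * unit_exp (of_int n * x)) (A - F))"
      by (rule norm_triangle_ineq4)
    also have "norm (infsum (\<lambda>n. c n * unit_exp (of_int n * x)) (A - F))
        \<le> infsum (\<lambda>n. norm (c n * unit_exp (of_int n * x))) (A - F)"
      by (rule norm_infsum_bound[OF s1])
    also have "\<dots> \<le> 1" using tail by (simp add: norm_mult)
    finally show ?thesis using B[of x] by simp
  qed
  obtain K :: int where K: "\<And>n. n \<in> F \<Longrightarrow> \<bar>n\<bar> \<le> K"
    by (metis F(1) Max_ge finite_imageI image_eqI)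
  define Q0 where "Q0 = nat (2 * \<bar>K\<bar> + 1)"
  show thesis
  proof (rule that)
    show "Q0 > 0" by (simp add: Q0_def)
  next
    fix Q :: nat and d :: "int \<Rightarrow> complex"
    assume Q: "Q \<ge> Q0"
    hence Qp: "Q > 0" by (simp add: Q0_def)
    have small: "\<bar>m - n\<bar> < int Q" if "m \<in> F" "n \<in> I" for m n
      using K[OF that(1)] K[of n] that(2) F Q by (auto simp: Q0_def)
    have "(\<Sum>m\<in>F. \<Sum>n\<in>I. if m = n then c m * d n else 0) = (\<Sum>n\<in>I. c n * d n)"
      using F I by (subst sum.swap) (simp add: sum.delta subset_iff)
    hence "of_nat Q * (\<Sum>n\<in>I. c n * d n) =
       (\<Sum>j<Q. (\<Sum>n\<in>F. c n * unit_exp (of_int n * real j / real Q)) *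
                   (\<Sum>n\<in>I. d n * unit_exp (- of_int n * real j / real Q)))"
      using exp_sum_orthogonality_exact[of F I "\<lambda>x. x" "\<lambda>x. x" Q c d, OF small Qp] by simp
    hence "real Q * norm (\<Sum>n\<in>I. c n * d n) =
       norm (\<Sum>j<Q. (\<Sum>n\<in>F. c n * unit_exp (of_int n * real j / real Q)) *
                   (\<Sum>n\<in>I. d n * unit_exp (- of_int n * real j / real Q)))"
      by (metis norm_mult norm_of_nat)
    also have "\<dots> \<le> (\<Sum>j<Q. (B + 1) * norm (\<Sum>n\<in>I. d n * unit_exp (- of_int n * real j / real Q)))"
      using approx[of "real _ / real Q"]
      by (intro sum_norm_le) (simp add: norm_mult mult_right_mono)
    finally show "real Q * norm (\<Sum>n\<in>I. c n * d n)
       \<le> (B + 1) * (\<Sum>j<Q. norm (\<Sum>n\<in>I. d n * unit_exp (- of_int n * real j / real Q)))"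
      by (simp add: sum_distrib_left)
  qed
qed

text \<open>
  Duality with \<open>d = cnj c\<close>: by the Cauchy-Schwarz inequality and Parseval, \<open>S \<le> (B + 1) \<surd>S\<close> for the sum \<open>S\<close> of squares.
\<close>

lemma bounded_trig_series_bessel:
  fixes c :: "int \<Rightarrow> complex"
  assumes summ: "(\<lambda>n. norm (c n)) summable_on A"
    and G: "\<And>x. ((\<lambda>n. c n * unit_exp (of_int n * x)) has_sum G x) A"
    and B: "\<And>x. norm (G x) \<le> B"
    and I: "finite I" "I \<subseteq> A"
  shows "(\<Sum>n\<in>I. (norm (c n))\<^sup>2) \<le> (B + 1)\<^sup>2"
proof -
  obtain Q0 where Q0: "Q0 > 0" "\<And>Q d. Q \<ge> Q0 \<Longrightarrow> real Q * norm (\<Sum>n\<in>I. c n * d n)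
       \<le> (B + 1) * (\<Sum>j<Q. norm (\<Sum>n\<in>I. d n * unit_exp (- of_int n * real j / real Q)))"
    by (rule bounded_trig_series_dual[OF assms]) (rule that)
  obtain K :: int where K: "\<And>n. n \<in> I \<Longrightarrow> \<bar>n\<bar> \<le> K"
    by (metis I(1) Max_ge finite_imageI image_eqI)
  define Q where "Q = Q0 + nat (2 * \<bar>K\<bar> + 1)"
  have Q: "Q \<ge> Q0" "Q > 0" by (auto simp: Q_def)
  have small: "\<bar>m - n\<bar> < int Q" if "m \<in> I" "n \<in> I" for m n
    using K[OF that(1)] K[OF that(2)] by (auto simp: Q_def)
  define S where "S = (\<Sum>n\<in>I. (norm (c n))\<^sup>2)"
  have S0: "S \<ge> 0" by (simp add: S_def sum_nonneg)
  have B0: "B \<ge> 0" using B[of 0] norm_ge_zero order_trans by blast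
  have "(\<Sum>n\<in>I. c n * cnj (c n)) = of_real S"
    by (simp add: S_def of_real_sum complex_norm_square del: of_real_power)
  hence "real Q * S \<le> (B + 1) * (\<Sum>j<Q. norm (\<Sum>n\<in>I. cnj (c n) * unit_exp (- of_int n * real j / real Q)))"
    using Q0(2)[OF Q(1), of "\<lambda>n. cnj (c n)"] S0 by simp
  also have "\<dots> \<le> (B + 1) * sqrt (real Q * (real Q * S))"
    using sum_norm_le_sqrt[of "\<lambda>j. \<Sum>n\<in>I. cnj (c n) * unit_exp (- of_int n * real j / real Q)" Q]
      exp_sum_parseval[OF I(1) small Q(2), of "\<lambda>n. cnj (c n)"] B0
    by (intro mult_left_mono) (auto simp: S_def)
  also have "\<dots> = real Q * ((B + 1) * sqrt S)"
    by (simp add: real_sqrt_mult flip: mult.assoc)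
  finally have "S \<le> (B + 1) * sqrt S" using Q by simp
  hence "sqrt S * sqrt S \<le> (B + 1) * sqrt S" using S0 by simp
  hence "sqrt S \<le> B + 1" using S0 B0
    by (cases "S = 0") (auto intro: mult_right_le_imp_le[of _ "sqrt S"])
  hence "(sqrt S)\<^sup>2 \<le> (B + 1)\<^sup>2" using S0 by (intro power_mono) auto
  thus ?thesis using S0 by (simp add: S_def)
qed

section \<open>The mean absolute value of the Dirichlet kernel\<close>

text \<open>
  The symmetric form \<open>2 x (1 - x)\<close> is chosen because its reciprocal is the sum of the reciprocals of \<open>x\<close>
  and \<open>1 - x\<close>, up to a constant.
\<close>

lemma sin_pi_lower:
  assumes "0 \<le> x" "x \<le> 1"
  shows "2 * x * (1 - x) \<le> sin (pi * x)"
proof -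
  have conc: "concave_on {0..pi} sin"
    by (rule f''_le0_imp_concave[where f' = cos and f'' = "\<lambda>x. - sin x"])
       (auto intro!: derivative_eq_intros sin_ge_zero)
  have half: "2 * t \<le> sin (pi * t)" if "0 \<le> t" "t \<le> 1/2" for t
  proof -
    have "(1 - 2 * t) * sin 0 + (2 * t) * sin (pi/2) \<le> sin ((1 - 2 * t) *\<^sub>R 0 + (2 * t) *\<^sub>R (pi/2))"
      by (rule concave_onD[OF conc]) (use that in auto)
    thus ?thesis by (simp add: mult_ac)
  qed
  show ?thesis
  proof (cases "x \<le> 1/2")
    case True
    have "2 * x * (1 - x) \<le> 2 * x * 1" using assms by (intro mult_left_mono) auto
    thus ?thesis using half[of x] True assms by simp
  next
    case False
    have "sin (pi * (1 - x)) = sin (pi * x)"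
      by (simp add: right_diff_distrib sin_diff)
    moreover have "2 * x * (1 - x) \<le> 2 * 1 * (1 - x)" using assms by (intro mult_right_mono) auto
    ultimately show ?thesis using half[of "1 - x"] False assms by simp
  qed
qed

lemma norm_one_minus_unit_exp: "norm (1 - unit_exp x) = 2 * \<bar>sin (pi * x)\<bar>"
proof -
  have "(norm (1 - unit_exp x))\<^sup>2 = (1 - cos (2 * (pi * x)))\<^sup>2 + (sin (2 * (pi * x)))\<^sup>2"
    by (simp add: unit_exp_def cmod_power2 mult_ac)
  also have "\<dots> = 1 - 2 * cos (2 * (pi * x)) + ((sin (2 * (pi * x)))\<^sup>2 + (cos (2 * (pi * x)))\<^sup>2)"
    by (simp add: power2_eq_square algebra_simps)
  also have "\<dots> = (2 * \<bar>sin (pi * x)\<bar>)\<^sup>2"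
    unfolding sin_cos_squared_add by (simp add: cos_double_sin power_mult_distrib)
  finally show ?thesis by (rule power2_eq_imp_eq) auto
qed

lemma interval_shift_sum:
  fixes N :: int and g :: "int \<Rightarrow> 'a :: comm_monoid_add"
  shows "(\<Sum>n\<in>{N<..N + int K}. g n) = (\<Sum>k<K. g (N + 1 + int k))"
  by (rule sum.reindex_bij_witness[of _ "\<lambda>k. N + 1 + int k" "\<lambda>n. nat (n - N - 1)"]) auto

lemma dirichlet_kernel_bound:
  assumes "0 < x" "x < 1"
  shows "norm (\<Sum>n\<in>{N<..N + int K}. unit_exp (- of_int n * x))
           \<le> min (real K) ((1 / x + 1 / (1 - x)) / 2)"
proof -
  define z where "z = unit_exp (- x)"
  have s: "sin (pi * x) \<ge> 2 * x * (1 - x)" using sin_pi_lower assms by simp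
  have pos: "2 * x * (1 - x) > 0" using assms by simp
  have "(\<Sum>n\<in>{N<..N + int K}. unit_exp (- of_int n * x))
      = (\<Sum>k<K. unit_exp (- of_int (N + 1) * x) * z ^ k)"
    unfolding interval_shift_sum z_def unit_exp_power unit_exp_add[symmetric]
    by (intro sum.cong refl arg_cong[where f = unit_exp]) (simp add: algebra_simps)
  also have "norm \<dots> = norm (\<Sum>k<K. z ^ k)"
    by (simp add: sum_distrib_left[symmetric] norm_mult)
  finally have eq: "norm (\<Sum>n\<in>{N<..N + int K}. unit_exp (- of_int n * x)) = norm (\<Sum>k<K. z ^ k)" .
  have nz: "norm (1 - z) = 2 * sin (pi * x)"
    using s pos by (simp add: z_def norm_one_minus_unit_exp)
  hence "z \<noteq> 1" using s pos by auto
  hence "norm (\<Sum>k<K. z ^ k) = norm (1 - z ^ K) / (2 * sin (pi * x))"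
    using nz by (simp add: geometric_sum norm_divide norm_minus_commute)
  also have "\<dots> \<le> 2 / (2 * (2 * x * (1 - x)))"
    using s pos norm_triangle_ineq4[of 1 "z ^ K"]
    by (intro frac_le) (auto simp: z_def norm_power)
  also have "\<dots> = (1 / x + 1 / (1 - x)) / 2" using assms by (simp add: field_simps)
  finally have "norm (\<Sum>k<K. z ^ k) \<le> (1 / x + 1 / (1 - x)) / 2" .
  moreover have "norm (\<Sum>k<K. z ^ k) \<le> (\<Sum>k<K. 1)"
    by (rule sum_norm_le) (simp add: z_def norm_power)
  ultimately show ?thesis unfolding eq by simp
qed

lemma harmonic_segment_le_ln:
  assumes "0 < J" "J \<le> Q"
  shows "(\<Sum>j\<in>{J<..Q}. 1 / real j) \<le> ln (real Q) - ln (real J)"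
  using assms(2)
proof (induction Q rule: dec_induct)
  case (step n)
  have n: "n > 0" using step assms by simp
  have "{J<..Suc n} = insert (Suc n) {J<..n}" using step by auto
  hence "(\<Sum>j\<in>{J<..Suc n}. 1 / real j) = 1 / real (Suc n) + (\<Sum>j\<in>{J<..n}. 1 / real j)" by simp
  moreover have "ln (real n / real (Suc n)) \<le> real n / real (Suc n) - 1"
    using n by (intro ln_le_minus_one) simp
  hence "1 / real (Suc n) \<le> ln (real (Suc n)) - ln (real n)"
    using n by (simp add: ln_div field_simps)
  ultimately show ?case using step by simp
qed simp

text \<open>
  Taking \<open>Q = K J\<close> a multiple of \<open>K\<close> makes the transition between the two regimes of the minimum occur
  exactly at \<open>j = J\<close>; after division by \<open>Q\<close> the bound depends on \<open>K\<close> only.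
\<close>

lemma sum_min_harmonic:
  assumes "0 < K" "0 < J"
  shows "(\<Sum>j\<in>{1..<K * J}. min (real K) (real (K * J) / real j)) \<le> real (K * J) * (1 + ln (real K))"
proof -
  have JQ: "J \<le> K * J" using assms by simp
  have "(\<Sum>j\<in>{1..<K * J}. min (real K) (real (K * J) / real j))
     \<le> (\<Sum>j\<in>{1..J} \<union> {J<..K * J}. min (real K) (real (K * J) / real j))"
    by (intro sum_mono2) auto
  also have "\<dots> = (\<Sum>j\<in>{1..J}. min (real K) (real (K * J) / real j))
      + (\<Sum>j\<in>{J<..K * J}. min (real K) (real (K * J) / real j))"
    by (intro sum.union_disjoint) auto
  also have "\<dots> \<le> (\<Sum>j\<in>{1..J}. real K) + (\<Sum>j\<in>{J<..K * J}. real (K * J) * (1 / real j))"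
    by (intro add_mono sum_mono) auto
  also have "\<dots> = real (K * J) + real (K * J) * (\<Sum>j\<in>{J<..K * J}. 1 / real j)"
    by (simp add: sum_distrib_left mult.commute)
  also have "\<dots> \<le> real (K * J) + real (K * J) * (ln (real (K * J)) - ln (real J))"
    by (intro add_left_mono mult_left_mono harmonic_segment_le_ln assms JQ) simp
  also have "\<dots> = real (K * J) * (1 + ln (real K))"
    using assms by (simp add: ln_mult algebra_simps)
  finally show ?thesis .
qed

text \<open>
  The two terms of the pointwise bound are exchanged by \<open>j \<mapsto> Q - j\<close>, so one harmonic sum handles both.
\<close>

lemma dirichlet_kernel_mean:
  assumes "0 < K" "0 < J"
  shows "(\<Sum>j<K * J. norm (\<Sum>n\<in>{N<..N + int K}. unit_exp (- of_int n * real j / real (K * J))))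
           \<le> 3 * real (K * J) * (1 + ln (real K))"
proof -
  let ?Q = "K * J"
  have Q: "?Q > 0" using assms by simp
  define D where "D = (\<lambda>j. norm (\<Sum>n\<in>{N<..N + int K}. unit_exp (- of_int n * real j / real ?Q)))"
  define M where "M = (\<lambda>j. min (real K) (real ?Q / real j))"
  have D0: "D 0 \<le> real K"
    unfolding D_def by (rule order_trans[OF sum_norm_le[where g = "\<lambda>_. 1"]]) auto
  have Dj: "D j \<le> M j + M (?Q - j)" if "j \<in> {1..<?Q}" for j
  proof -
    have j: "0 < j" "j < ?Q" using that by auto
    have "D j \<le> min (real K) ((1 / (real j / real ?Q) + 1 / (1 - real j / real ?Q)) / 2)"
    proof -
      have "0 < real j / real ?Q" "real j / real ?Q < 1"
        using j Q by (simp_all only: of_nat_0_less_iff zero_less_divide_iff divide_less_eq_1 of_nat_less_iff) auto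
      from dirichlet_kernel_bound[OF this, of N K] show ?thesis
        by (simp add: D_def del: of_nat_mult)
    qed
    also have "1 - real j / real ?Q = real (?Q - j) / real ?Q"
      using j Q by (simp add: of_nat_diff diff_divide_distrib del: of_nat_mult)
    finally have a: "D j \<le> real K" and b: "D j \<le> (real ?Q / real j + real ?Q / real (?Q - j)) / 2"
      by (simp_all del: of_nat_mult)
    have "d \<le> min k p + min k q" if "d \<le> k" "d \<le> (p + q) / 2" "0 \<le> p" "0 \<le> q" "0 \<le> k" for d k p q :: real
      using that by (auto simp: min_def)
    from this[OF a b] show ?thesis unfolding M_def by simp
  qed
  have "(\<Sum>j<?Q. D j) = D 0 + (\<Sum>j\<in>{1..<?Q}. D j)"
  proof -
    have "{..<?Q} = insert 0 {1..<?Q}" using Q by auto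
    thus ?thesis by simp
  qed
  also have "\<dots> \<le> real K + ((\<Sum>j\<in>{1..<?Q}. M j) + (\<Sum>j\<in>{1..<?Q}. M (?Q - j)))"
    using D0 sum_mono[of "{1..<?Q}" D "\<lambda>j. M j + M (?Q - j)", OF Dj]
    by (simp add: sum.distrib)
  also have "(\<Sum>j\<in>{1..<?Q}. M (?Q - j)) = (\<Sum>j\<in>{1..<?Q}. M j)"
    by (rule sum.reindex_bij_witness[of _ "\<lambda>j. ?Q - j" "\<lambda>j. ?Q - j"]) auto
  also have "real K + ((\<Sum>j\<in>{1..<?Q}. M j) + (\<Sum>j\<in>{1..<?Q}. M j))
      \<le> real ?Q * (1 + ln (real K)) + (real ?Q * (1 + ln (real K)) + real ?Q * (1 + ln (real K)))"
  proof (intro add_mono)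
    have "real K * 1 \<le> real ?Q * (1 + ln (real K))"
      using assms by (intro mult_mono) (auto simp: Suc_le_eq)
    thus "real K \<le> real ?Q * (1 + ln (real K))" by simp
  qed (use sum_min_harmonic[OF assms] in \<open>simp_all add: M_def\<close>)
  also have "\<dots> = 3 * real ?Q * (1 + ln (real K))" by (simp add: algebra_simps)
  finally show ?thesis unfolding D_def .
qed

text \<open>
  Sharp partial sums of a bounded series are at most logarithmic, since they are the duality above with
  \<open>d = 1\<close> on an interval, where the finite exponential sum is a Dirichlet kernel.
\<close>

lemma bounded_trig_series_partial_sum:
  fixes c :: "int \<Rightarrow> complex"
  assumes summ: "(\<lambda>n. norm (c n)) summable_on A"
    and G: "\<And>x. ((\<lambda>n. c n * unit_exp (of_int n * x)) has_sum G x) A"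
    and B: "\<And>x. norm (G x) \<le> B"
    and I: "{N<..N + int K} \<subseteq> A" and K: "K > 0"
  shows "norm (\<Sum>n\<in>{N<..N + int K}. c n * unit_exp (of_int n * \<alpha>)) \<le> 3 * (B + 1) * (1 + ln (real K))"
proof -
  have summ': "(\<lambda>n. norm (c n * unit_exp (of_int n * \<alpha>))) summable_on A"
    using summ by (simp add: norm_mult)
  have G': "((\<lambda>n. c n * unit_exp (of_int n * \<alpha>) * unit_exp (of_int n * x)) has_sum G (\<alpha> + x)) A" for x
    using G[of "\<alpha> + x"] by (simp add: distrib_left unit_exp_add mult.assoc)
  obtain Q0 where Q0: "Q0 > 0" "\<And>Q d. Q \<ge> Q0 \<Longrightarrow>
      real Q * norm (\<Sum>n\<in>{N<..N + int K}. c n * unit_exp (of_int n * \<alpha>) * d n)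
       \<le> (B + 1) * (\<Sum>j<Q. norm (\<Sum>n\<in>{N<..N + int K}. d n * unit_exp (- of_int n * real j / real Q)))"
    by (rule bounded_trig_series_dual[OF summ' G' B _ I]) (auto intro: that)
  \<comment> \<open>a multiple of \<open>K\<close>, as the kernel bound requires\<close>
  define Q where "Q = K * Q0"
  have Q: "Q \<ge> Q0" "Q > 0" using K Q0 by (auto simp: Q_def)
  have B0: "B \<ge> 0" using B[of 0] norm_ge_zero order_trans by blast
  have "real Q * norm (\<Sum>n\<in>{N<..N + int K}. c n * unit_exp (of_int n * \<alpha>))
       \<le> (B + 1) * (\<Sum>j<Q. norm (\<Sum>n\<in>{N<..N + int K}. unit_exp (- of_int n * real j / real Q)))"
    using Q0(2)[OF Q(1), of "\<lambda>_. 1"] by simp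
  also have "\<dots> \<le> (B + 1) * (3 * real Q * (1 + ln (real K)))"
    unfolding Q_def using B0 by (intro mult_left_mono dirichlet_kernel_mean K Q0) auto
  also have "\<dots> = real Q * (3 * (B + 1) * (1 + ln (real K)))" by (simp add: algebra_simps)
  finally have "real Q * norm (\<Sum>n\<in>{N<..N + int K}. c n * unit_exp (of_int n * \<alpha>))
       \<le> real Q * (3 * (B + 1) * (1 + ln (real K)))" .
  thus ?thesis using Q by (simp add: mult_le_cancel_left)
qed

section \<open>Coefficient bounds from a bounded Fourier series\<close>

lemma abel_summation:
  fixes u :: "nat \<Rightarrow> real" and a :: "nat \<Rightarrow> complex"
  shows "(\<Sum>i<Suc k. of_real (u i) * a i) = of_real (u k) * (\<Sum>i<Suc k. a i)
           + (\<Sum>i<k. of_real (u i - u (Suc i)) * (\<Sum>j<Suc i. a j))"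
proof (induction k)
  case (Suc k)
  have "(\<Sum>i<Suc (Suc k). of_real (u i) * a i) =
     of_real (u k) * (\<Sum>i<Suc k. a i) + (\<Sum>i<k. of_real (u i - u (Suc i)) * (\<Sum>j<Suc i. a j))
       + of_real (u (Suc k)) * a (Suc k)"
    by (subst sum.lessThan_Suc, subst Suc) simp
  also have "\<dots> = of_real (u (Suc k)) * ((\<Sum>i<Suc k. a i) + a (Suc k))
     + ((\<Sum>i<k. of_real (u i - u (Suc i)) * (\<Sum>j<Suc i. a j)) + of_real (u k - u (Suc k)) * (\<Sum>i<Suc k. a i))"
    unfolding of_real_diff left_diff_distrib distrib_left by (simp add: algebra_simps del: sum.lessThan_Suc)
  finally show ?case by (simp only: sum.lessThan_Suc)
qed simp

text \<open>
  Used to strip the weight \<open>W(n y)\<close> from the coefficients on a dyadic block; there \<open>1 / W\<close> is bounded by \<open>U\<close>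
  and moves by at most \<open>V\<close> in each step.
\<close>

lemma abel_summation_bound:
  fixes u :: "nat \<Rightarrow> real" and a :: "nat \<Rightarrow> complex"
  assumes T: "\<And>k. k \<le> K \<Longrightarrow> norm (\<Sum>i<k. a i) \<le> T"
    and U: "\<And>k. k < K \<Longrightarrow> \<bar>u k\<bar> \<le> U"
    and V: "\<And>k. Suc k < K \<Longrightarrow> \<bar>u k - u (Suc k)\<bar> \<le> V"
    and K: "K > 0" and V0: "V \<ge> 0"
  shows "norm (\<Sum>i<K. of_real (u i) * a i) \<le> (U + real K * V) * T"
proof -
  obtain k where k: "K = Suc k" using K by (cases K) auto
  have T0: "T \<ge> 0" using T[of 0] by simp
  have "norm (\<Sum>i<K. of_real (u i) * a i) \<le> norm (of_real (u k) * (\<Sum>i<Suc k. a i))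
     + norm (\<Sum>i<k. of_real (u i - u (Suc i)) * (\<Sum>j<Suc i. a j))"
    unfolding k abel_summation by (rule norm_triangle_ineq)
  also have "\<dots> \<le> U * T + (\<Sum>i<k. V * T)"
  proof (intro add_mono sum_norm_le)
    have "U \<ge> 0" using U[of k] k by (meson abs_ge_zero lessI order_trans)
    thus "norm (of_real (u k) * (\<Sum>i<Suc k. a i)) \<le> U * T"
      using U[of k] T[of "Suc k"] k unfolding norm_mult norm_of_real by (intro mult_mono) auto
  next
    fix i assume "i \<in> {..<k}"
    thus "norm (of_real (u i - u (Suc i)) * (\<Sum>j<Suc i. a j)) \<le> V * T"
      using V[of i] T[of "Suc i"] k V0 unfolding norm_mult norm_of_real by (intro mult_mono) auto
  qed
  also have "\<dots> = (U + real k * V) * T" by (simp add: algebra_simps)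
  also have "\<dots> \<le> (U + real K * V) * T"
    using V0 T0 by (intro mult_right_mono add_left_mono) (auto simp: k)
  finally show ?thesis .
qed

text \<open>
  The interval is the one over which \<open>n y\<close> runs when \<open>y = a / N\<close> and \<open>n\<close> runs through the block from \<open>N\<close> to \<open>2 N\<close>.
\<close>

definition regular_weight :: "(real \<Rightarrow> real) \<Rightarrow> real \<Rightarrow> real \<Rightarrow> real \<Rightarrow> bool" where
  "regular_weight W a m L \<longleftrightarrow> a > 0 \<and> m > 0 \<and> L \<ge> 0 \<and> (\<forall>t\<in>{a..2*a}. W t \<ge> m) \<and>
     (\<forall>s\<in>{a..2*a}. \<forall>t\<in>{a..2*a}. \<bar>W s - W t\<bar> \<le> L * \<bar>s - t\<bar>)"

text \<open>
  The common form of both kinds of cusp forms: holomorphic forms have \<open>W t = t\<^sup>(\<^sup>k\<^sup>-\<^sup>1\<^sup>)\<^sup>/\<^sup>2 exp (-2 \<pi> t)\<close> and Maass forms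
  have \<open>W t = K\<^sub>i\<^sub>\<mu> (2 \<pi> t)\<close>. The bound \<open>B\<close> is uniform in the height \<open>y\<close>.
\<close>

definition bounded_fourier_family ::
    "(int \<Rightarrow> complex) \<Rightarrow> (real \<Rightarrow> real) \<Rightarrow> real \<Rightarrow> bool" where
  "bounded_fourier_family lam W B \<longleftrightarrow>
     (\<forall>y>0. \<exists>G. (\<forall>x. ((\<lambda>n. of_real (sqrt y) * lam n * of_real (W (\<bar>of_int n\<bar> * y)) * unit_exp (of_int n * x))
                 has_sum G x) (-{0})) \<and> (\<forall>x. norm (G x) \<le> B))"

lemma bounded_fourier_familyE:
  assumes "bounded_fourier_family lam W B" "y > 0"
  obtains G where "(\<lambda>n. norm (of_real (sqrt y) * lam n * of_real (W (\<bar>of_int n\<bar> * y)))) summable_on -{0}"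
    "\<And>x. ((\<lambda>n. of_real (sqrt y) * lam n * of_real (W (\<bar>of_int n\<bar> * y)) * unit_exp (of_int n * x))
                 has_sum G x) (-{0})" "\<And>x. norm (G x) \<le> B"
proof -
  obtain G where G: "\<And>x. ((\<lambda>n. of_real (sqrt y) * lam n * of_real (W (\<bar>of_int n\<bar> * y)) * unit_exp (of_int n * x))
                 has_sum G x) (-{0})" "\<And>x. norm (G x) \<le> B"
    using assms unfolding bounded_fourier_family_def by blast
  have "(\<lambda>n. of_real (sqrt y) * lam n * of_real (W (\<bar>of_int n\<bar> * y))) summable_on -{0}"
    using has_sum_imp_summable[OF G(1)[of 0]] by simp
  hence "(\<lambda>n. norm (of_real (sqrt y) * lam n * of_real (W (\<bar>of_int n\<bar> * y)))) summable_on -{0}"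
    by (simp add: summable_on_iff_abs_summable_on_complex)
  from that[OF this G] show thesis by blast
qed

lemma block_in_range:
  assumes "regular_weight W a m L" "N > 0" "n \<in> {int N<..int N + int K}" "K \<le> N"
  shows "of_int n * (a / real N) \<in> {a..2 * a}" "n > 0" "\<bar>of_int n :: real\<bar> = of_int n"
proof -
  have a: "a > 0" using assms by (simp add: regular_weight_def)
  have "real N \<le> of_int n" "of_int n \<le> 2 * real N" using assms by auto
  hence "real N * a \<le> of_int n * a" "of_int n * a \<le> 2 * real N * a" using a by (auto intro: mult_right_mono)
  thus "of_int n * (a / real N) \<in> {a..2 * a}" using assms(2) by (simp add: field_simps)
qed (use assms in auto)

text \<open>
  At height \<open>y = a / N\<close> the arguments \<open>n y\<close> with \<open>N < n \<le> 2 N\<close> fill the interval from \<open>a\<close> to \<open>2 a\<close>, where \<open>W\<close> is at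
  least \<open>m\<close>; Bessel's inequality for \<open>G\<close> at this height therefore controls the coefficients themselves.
\<close>

lemma block_second_moment:
  assumes fam: "bounded_fourier_family lam W B" and W: "regular_weight W a m L" and N: "N > 0"
  shows "(\<Sum>n\<in>{int N<..int N + int N}. (norm (lam n))\<^sup>2) \<le> (B + 1)\<^sup>2 / (a * m\<^sup>2) * real N"
proof -
  have am: "a > 0" "m > 0" using W by (auto simp: regular_weight_def)
  define y where "y = a / real N"
  have y: "y > 0" using am N by (simp add: y_def)
  define c where "c = (\<lambda>n. of_real (sqrt y) * lam n * of_real (W (\<bar>of_int n\<bar> * y)))"
  obtain G where G: "(\<lambda>n. norm (c n)) summable_on -{0}"
    "\<And>x. ((\<lambda>n. c n * unit_exp (of_int n * x)) has_sum G x) (-{0})" "\<And>x. norm (G x) \<le> B"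
    using bounded_fourier_familyE[OF fam y] unfolding c_def by blast
  have "(\<Sum>n\<in>{int N<..int N + int N}. y * m\<^sup>2 * (norm (lam n))\<^sup>2) \<le> (\<Sum>n\<in>{int N<..int N + int N}. (norm (c n))\<^sup>2)"
  proof (rule sum_mono)
    fix n assume n: "n \<in> {int N<..int N + int N}"
    have r: "W (\<bar>of_int n\<bar> * y) \<ge> m"
      using block_in_range[OF W N n] W unfolding regular_weight_def y_def by auto
    have "(norm (c n))\<^sup>2 = y * (W (\<bar>of_int n\<bar> * y))\<^sup>2 * (norm (lam n))\<^sup>2"
      using y by (simp add: c_def norm_mult power_mult_distrib)
    moreover have "m\<^sup>2 \<le> (W (\<bar>of_int n\<bar> * y))\<^sup>2" using r am by (intro power_mono) auto
    ultimately show "y * m\<^sup>2 * (norm (lam n))\<^sup>2 \<le> (norm (c n))\<^sup>2"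
      using y by (auto intro!: mult_right_mono mult_left_mono)
  qed
  also have "\<dots> \<le> (B + 1)\<^sup>2"
    by (rule bounded_trig_series_bessel[OF G]) (use N in auto)
  finally have "y * m\<^sup>2 * (\<Sum>n\<in>{int N<..int N + int N}. (norm (lam n))\<^sup>2) \<le> (B + 1)\<^sup>2"
    by (simp add: sum_distrib_left)
  thus ?thesis using am N by (simp add: y_def field_simps)
qed

text \<open>
  The same choice of height. The weight is divided out by partial summation; the total variation of
  \<open>1 / W\<close> over the block stays bounded because its \<open>N\<close> steps have length \<open>a / N\<close>.
\<close>

lemma block_wilton:
  assumes fam: "bounded_fourier_family lam W B" and W: "regular_weight W a m L"
    and N: "N > 0" and K: "K \<le> N"
  shows "norm (\<Sum>n\<in>{int N<..int N + int K}. lam n * unit_exp (of_int n * \<alpha>))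
     \<le> (1 / m + L * a / m\<^sup>2) * (3 * (B + 1)) / sqrt a * (sqrt (real N) * (1 + ln (real N)))"
proof (cases "K = 0")
  case True
  have am: "a > 0" "m > 0" "L \<ge> 0" using W by (auto simp: regular_weight_def)
  obtain G where "\<And>x :: real. norm (G x :: complex) \<le> B"
    by (rule bounded_fourier_familyE[OF fam zero_less_one]) (rule that)
  from order_trans[OF norm_ge_zero this] have "B \<ge> 0" .
  thus ?thesis using True am N by simp
next
  case False
  have am: "a > 0" "m > 0" "L \<ge> 0" using W by (auto simp: regular_weight_def)
  define y where "y = a / real N"
  have y: "y > 0" using am N by (simp add: y_def)
  define c where "c = (\<lambda>n. of_real (sqrt y) * lam n * of_real (W (\<bar>of_int n\<bar> * y)))"
  obtain G where G: "(\<lambda>n. norm (c n)) summable_on -{0}"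
    "\<And>x. ((\<lambda>n. c n * unit_exp (of_int n * x)) has_sum G x) (-{0})" "\<And>x. norm (G x) \<le> B"
    using bounded_fourier_familyE[OF fam y] unfolding c_def by blast
  have B0: "B \<ge> 0" using G(3)[of 0] norm_ge_zero order_trans by blast
  define u where "u = (\<lambda>k. 1 / W (of_int (int N + 1 + int k) * y))"
  define b where "b = (\<lambda>k. c (int N + 1 + int k) * unit_exp (of_int (int N + 1 + int k) * \<alpha>))"
  define T where "T = 3 * (B + 1) * (1 + ln (real N))"
  have lnN: "ln (real N) \<ge> 0" using N by simp
  have T0: "T \<ge> 0" using lnN B0 by (simp add: T_def)
  have rng: "of_int (int N + 1 + int k) * y \<in> {a..2 * a}" if "k < K" for k
    unfolding y_def by (rule block_in_range(1)[OF W N _ K]) (use that in auto)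
  have Wm: "W (of_int (int N + 1 + int k) * y) \<ge> m" if "k < K" for k
    using rng[OF that] W unfolding regular_weight_def by blast
  have "norm (\<Sum>k<K. of_real (u k) * b k) \<le> (1 / m + real K * (L * y / m\<^sup>2)) * T"
  proof (rule abel_summation_bound)
    fix k assume k: "k \<le> K"
    show "norm (\<Sum>i<k. b i) \<le> T"
    proof (cases "k = 0")
      case False
      have "norm (\<Sum>i<k. b i) \<le> 3 * (B + 1) * (1 + ln (real k))"
        using bounded_trig_series_partial_sum[OF G, of "int N" k \<alpha>] False N
        by (simp add: interval_shift_sum b_def)
      also have "\<dots> \<le> T" unfolding T_def using B0 False k K by (intro mult_left_mono) auto
      finally show ?thesis .
    qed (use T0 in simp)
  next
    fix k assume "k < K"
    thus "\<bar>u k\<bar> \<le> 1 / m" using Wm[of k] am by (simp add: u_def divide_simps)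
  next
    fix k assume k: "Suc k < K"
    define s where "s = of_int (int N + 1 + int k) * y"
    define t where "t = of_int (int N + 1 + int (Suc k)) * y"
    have st: "\<bar>t - s\<bar> = y" using y by (simp add: s_def t_def algebra_simps)
    have Ws: "W s \<ge> m" "W t \<ge> m" using Wm[of k] Wm[of "Suc k"] k unfolding s_def t_def by auto
    have lip: "\<bar>W t - W s\<bar> \<le> L * y"
    proof -
      have "s \<in> {a..2 * a}" "t \<in> {a..2 * a}"
        unfolding s_def t_def by (rule rng, use k in simp)+
      thus ?thesis using W unfolding regular_weight_def st[symmetric] by blast
    qed
    have "\<bar>u k - u (Suc k)\<bar> = \<bar>W t - W s\<bar> / (W s * W t)"
      using Ws am unfolding u_def s_def[symmetric] t_def[symmetric]
      by (simp add: field_simps abs_mult abs_divide)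
    also have "\<dots> \<le> L * y / (m * m)" using Ws am lip y by (intro frac_le mult_mono) auto
    finally show "\<bar>u k - u (Suc k)\<bar> \<le> L * y / m\<^sup>2" by (simp add: power2_eq_square)
  qed (use False am y in auto)
  also have "\<dots> \<le> (1 / m + real N * (L * y / m\<^sup>2)) * T"
    using K am y T0 by (intro mult_right_mono add_left_mono) auto
  also have "real N * (L * y / m\<^sup>2) = L * a / m\<^sup>2" using N by (simp add: y_def)
  finally have main: "norm (\<Sum>k<K. of_real (u k) * b k) \<le> (1 / m + L * a / m\<^sup>2) * T" .
  have "(\<Sum>k<K. of_real (u k) * b k) = of_real (sqrt y) * (\<Sum>n\<in>{int N<..int N + int K}. lam n * unit_exp (of_int n * \<alpha>))"
    unfolding interval_shift_sum sum_distrib_left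
  proof (intro sum.cong refl)
    fix k assume "k \<in> {..<K}"
    hence "W (of_int (int N + 1 + int k) * y) \<noteq> 0" using Wm[of k] am by auto
    moreover have "\<bar>real_of_int (int N + 1 + int k)\<bar> = real_of_int (int N + 1 + int k)" by simp
    ultimately show "of_real (u k) * b k = of_real (sqrt y) * (lam (int N + 1 + int k) * unit_exp (of_int (int N + 1 + int k) * \<alpha>))"
      unfolding u_def b_def c_def by (simp del: of_int_add)
  qed
  hence "sqrt y * norm (\<Sum>n\<in>{int N<..int N + int K}. lam n * unit_exp (of_int n * \<alpha>)) \<le> (1 / m + L * a / m\<^sup>2) * T"
    using main y by (simp add: norm_mult)
  hence "norm (\<Sum>n\<in>{int N<..int N + int K}. lam n * unit_exp (of_int n * \<alpha>)) \<le> (1 / m + L * a / m\<^sup>2) * T / sqrt y"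
    using y by (simp add: field_simps)
  also have "\<dots> = (1 / m + L * a / m\<^sup>2) * (3 * (B + 1)) / sqrt a * (sqrt (real N) * (1 + ln (real N)))"
    using N am by (simp add: y_def T_def real_sqrt_divide)
  finally show ?thesis .
qed

lemma block_split:
  fixes g :: "int \<Rightarrow> 'a :: comm_monoid_add"
  assumes "N \<le> M"
  shows "(\<Sum>n\<in>{1..int M}. g n) = (\<Sum>n\<in>{1..int N}. g n) + (\<Sum>n\<in>{int N<..int N + int (M - N)}. g n)"
proof -
  have "{1..int M} = {1..int N} \<union> {int N<..int N + int (M - N)}" using assms by auto
  thus ?thesis by (simp add: sum.union_disjoint[symmetric] ivl_disj_int)
qed

lemma second_moment_dyadic:
  assumes fam: "bounded_fourier_family lam W B" and W: "regular_weight W a m L"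
  shows "(\<Sum>n\<in>{1..int (2 ^ k)}. (norm (lam n))\<^sup>2) \<le> ((norm (lam 1))\<^sup>2 + (B + 1)\<^sup>2 / (a * m\<^sup>2)) * 2 ^ k"
proof (induction k)
  case 0
  have "a > 0" using W by (auto simp: regular_weight_def)
  thus ?case by simp
next
  case (Suc k)
  have "(\<Sum>n\<in>{1..int (2 ^ Suc k)}. (norm (lam n))\<^sup>2)
     = (\<Sum>n\<in>{1..int (2 ^ k)}. (norm (lam n))\<^sup>2) + (\<Sum>n\<in>{int (2^k)<..int (2^k) + int (2^k)}. (norm (lam n))\<^sup>2)"
    by (subst block_split[of "2^k" "2 ^ Suc k"]) (simp_all del: of_nat_power)
  also have "\<dots> \<le> ((norm (lam 1))\<^sup>2 + (B + 1)\<^sup>2 / (a * m\<^sup>2)) * 2 ^ k + (B + 1)\<^sup>2 / (a * m\<^sup>2) * real (2 ^ k)"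
    by (intro add_mono Suc block_second_moment[OF fam W]) simp
  also have "\<dots> \<le> ((norm (lam 1))\<^sup>2 + (B + 1)\<^sup>2 / (a * m\<^sup>2)) * 2 ^ Suc k"
    by (simp add: algebra_simps)
  finally show ?case .
qed

text \<open>
  Summing the blocks: the block bounds grow geometrically, so the last one dominates. The induction needs a
  constant \<open>D\<close> with \<open>D + C \<le> D \<surd>2\<close>, and \<open>D \<ge> 4 C\<close> suffices because \<open>\<surd>2 \<ge> 5/4\<close>.
\<close>

lemma wilton_dyadic:
  assumes fam: "bounded_fourier_family lam W B" and W: "regular_weight W a m L"
  shows "\<exists>D\<ge>0. \<forall>k M \<alpha>. M \<le> 2 ^ k \<longrightarrow>
     norm (\<Sum>n\<in>{1..int M}. lam n * unit_exp (of_int n * \<alpha>)) \<le> D * (sqrt (2 ^ k) * (1 + real k))"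
proof -
  define C where "C = \<bar>(1 / m + L * a / m\<^sup>2) * (3 * (B + 1)) / sqrt a\<bar>"
  define D where "D = norm (lam 1) + 4 * C"
  have C0: "C \<ge> 0" by (simp add: C_def)
  have D0: "D \<ge> 0" "D \<ge> 4 * C" using C0 by (auto simp: D_def)
  have main: "norm (\<Sum>n\<in>{1..int M}. lam n * unit_exp (of_int n * \<alpha>)) \<le> D * (sqrt (2 ^ k) * (1 + real k))"
    if "M \<le> 2 ^ k" for k M \<alpha>
    using that
  proof (induction k arbitrary: M)
    case 0
    hence "M = 0 \<or> M = 1" by auto
    thus ?case using D0 C0 by (auto simp: norm_mult D_def)
  next
    case (Suc k)
    show ?case
    proof (cases "M \<le> 2 ^ k")
      case True
      have "D * (sqrt (2 ^ k) * (1 + real k)) \<le> D * (sqrt (2 ^ Suc k) * (1 + real (Suc k)))"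
        using D0 by (intro mult_left_mono mult_mono) auto
      thus ?thesis using Suc.IH[OF True] by linarith
    next
      case False
      let ?g = "\<lambda>n. lam n * unit_exp (of_int n * \<alpha>)"
      let ?N = "2 ^ k :: nat"
      have "ln (real ?N) \<le> real k"
        using ln_2_less_1 by (simp add: ln_realpow mult_left_le)
      hence l: "sqrt (real ?N) * (1 + ln (real ?N)) \<le> sqrt (2 ^ k) * (1 + real k)"
        by (intro mult_mono) auto
      have lp: "0 \<le> sqrt (real ?N) * (1 + ln (real ?N))" by simp
      have "norm (\<Sum>n\<in>{int ?N<..int ?N + int (M - ?N)}. ?g n)
          \<le> (1 / m + L * a / m\<^sup>2) * (3 * (B + 1)) / sqrt a * (sqrt (real ?N) * (1 + ln (real ?N)))"
        by (rule block_wilton[OF fam W]) (use Suc.prems in auto)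
      also have "\<dots> \<le> C * (sqrt (real ?N) * (1 + ln (real ?N)))"
        unfolding C_def using lp by (intro mult_right_mono abs_ge_self)
      also have "\<dots> \<le> C * (sqrt (2 ^ k) * (1 + real k))" using l C0 by (intro mult_left_mono)
      finally have blk: "norm (\<Sum>n\<in>{int ?N<..int ?N + int (M - ?N)}. ?g n) \<le> C * (sqrt (2 ^ k) * (1 + real k))" .
      have "norm (\<Sum>n\<in>{1..int M}. ?g n) \<le> norm (\<Sum>n\<in>{1..int ?N}. ?g n) + norm (\<Sum>n\<in>{int ?N<..int ?N + int (M - ?N)}. ?g n)"
        unfolding block_split[OF less_imp_le[OF False[unfolded not_le]], of ?g] by (rule norm_triangle_ineq)
      also have "\<dots> \<le> D * (sqrt (2 ^ k) * (1 + real k)) + C * (sqrt (2 ^ k) * (1 + real k))"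
        by (intro add_mono Suc.IH blk) simp
      also have "\<dots> = (D + C) * (sqrt (2 ^ k) * (1 + real k))" by (simp add: algebra_simps)
      also have "\<dots> \<le> (D * sqrt 2) * (sqrt (2 ^ k) * (1 + real (Suc k)))"
      proof (intro mult_mono)
        have "sqrt 2 \<ge> 5/4" by (intro real_le_rsqrt) (simp add: power2_eq_square)
        hence "D * (5/4) \<le> D * sqrt 2" using D0 by (intro mult_left_mono)
        thus "D + C \<le> D * sqrt 2" using D0 by simp
      qed (use D0 in auto)
      also have "\<dots> = D * (sqrt (2 ^ Suc k) * (1 + real (Suc k)))" by (simp add: real_sqrt_mult)
      finally show ?thesis .
    qed
  qed
  show ?thesis by (intro exI[of _ D] conjI allI impI D0(1) main)
qed

lemma dyadic_cover:
  fixes X :: real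
  assumes "X \<ge> 1"
  obtains k where "X \<le> 2 ^ k" "2 ^ k \<le> 2 * X"
proof -
  define k where "k = (LEAST k. X \<le> 2 ^ k)"
  have "\<exists>k. X \<le> 2 ^ k" using real_arch_pow[of 2 X] by (auto intro: less_imp_le)
  hence k: "X \<le> 2 ^ k" unfolding k_def by (rule LeastI_ex)
  have "2 ^ k \<le> 2 * X"
  proof (cases k)
    case (Suc j)
    hence "\<not> X \<le> 2 ^ j" using not_less_Least[of j "\<lambda>k. X \<le> 2 ^ k"] k_def by simp
    thus ?thesis using Suc by simp
  qed (use assms in simp)
  thus thesis using k that by blast
qed

lemma second_moment_bound:
  assumes fam: "bounded_fourier_family lam W B" and W: "regular_weight W a m L"
  shows "\<exists>C\<ge>0. \<forall>X\<ge>1. (\<Sum>n\<in>{1..\<lfloor>X\<rfloor>}. (norm (lam n))\<^sup>2) \<le> C * X"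
proof -
  define C where "C = (norm (lam 1))\<^sup>2 + (B + 1)\<^sup>2 / (a * m\<^sup>2)"
  have C0: "C \<ge> 0" using W by (auto simp: C_def regular_weight_def)
  have "(\<Sum>n\<in>{1..\<lfloor>X\<rfloor>}. (norm (lam n))\<^sup>2) \<le> 2 * C * X" if X: "X \<ge> 1" for X
  proof -
    obtain k where k: "X \<le> 2 ^ k" "2 ^ k \<le> 2 * X" using dyadic_cover[OF X] by blast
    have "\<lfloor>X\<rfloor> \<le> int (2 ^ k)" using k(1) by (simp add: floor_le_iff)
    hence "(\<Sum>n\<in>{1..\<lfloor>X\<rfloor>}. (norm (lam n))\<^sup>2) \<le> (\<Sum>n\<in>{1..int (2 ^ k)}. (norm (lam n))\<^sup>2)"
      by (intro sum_mono2) auto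
    also have "\<dots> \<le> C * 2 ^ k" using second_moment_dyadic[OF fam W] by (simp add: C_def)
    also have "\<dots> \<le> C * (2 * X)" using k C0 by (intro mult_left_mono)
    finally show ?thesis by simp
  qed
  thus ?thesis using C0 by (intro exI[of _ "2 * C"]) auto
qed

lemma one_plus_le_two_powr:
  assumes "\<delta> > 0"
  shows "1 + real k \<le> (1 + 1 / (\<delta> * ln 2)) * (2 ^ k) powr \<delta>"
proof -
  have p: "\<delta> * ln 2 > 0" using assms by simp
  have "1 + real k * (\<delta> * ln 2) \<le> exp (real k * (\<delta> * ln 2))" by (rule exp_ge_add_one_self)
  also have "\<dots> = (2 ^ k) powr \<delta>" by (simp add: powr_def ln_realpow mult_ac)
  finally have e: "1 + real k * (\<delta> * ln 2) \<le> (2 ^ k) powr \<delta>" .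
  hence "real k \<le> (2 ^ k) powr \<delta> / (\<delta> * ln 2)" using p by (subst pos_le_divide_eq) auto
  moreover have "1 \<le> (2 ^ k) powr \<delta>"
    using e p by (smt (verit) mult_nonneg_nonneg of_nat_0_le_iff)
  ultimately show ?thesis by (simp add: distrib_right)
qed

lemma wilton_bound:
  assumes fam: "bounded_fourier_family lam W B" and W: "regular_weight W a m L" and \<delta>: "\<delta> > 0"
  shows "\<exists>C\<ge>0. \<forall>X\<ge>1. \<forall>\<alpha>. norm (\<Sum>n\<in>{1..\<lfloor>X\<rfloor>}. lam n * unit_exp (of_int n * \<alpha>)) \<le> C * X powr (1/2 + \<delta>)"
proof -
  obtain D where D: "D \<ge> 0" "\<And>k M \<alpha>. M \<le> 2 ^ k \<Longrightarrow>
     norm (\<Sum>n\<in>{1..int M}. lam n * unit_exp (of_int n * \<alpha>)) \<le> D * (sqrt (2 ^ k) * (1 + real k))"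
    using wilton_dyadic[OF fam W] by blast
  define E where "E = 1 + 1 / (\<delta> * ln 2)"
  have E0: "E \<ge> 0" using \<delta> by (simp add: E_def)
  have "norm (\<Sum>n\<in>{1..\<lfloor>X\<rfloor>}. lam n * unit_exp (of_int n * \<alpha>)) \<le> D * E * 2 powr (1/2 + \<delta>) * X powr (1/2 + \<delta>)"
    if X: "X \<ge> 1" for X \<alpha>
  proof -
    obtain k where k: "X \<le> 2 ^ k" "2 ^ k \<le> 2 * X" using dyadic_cover[OF X] by blast
    have f: "int (nat \<lfloor>X\<rfloor>) = \<lfloor>X\<rfloor>" using X by simp
    have "\<lfloor>X\<rfloor> \<le> int (2 ^ k)" using k(1) by (simp add: floor_le_iff)
    hence "nat \<lfloor>X\<rfloor> \<le> 2 ^ k" by linarith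
    hence "norm (\<Sum>n\<in>{1..\<lfloor>X\<rfloor>}. lam n * unit_exp (of_int n * \<alpha>)) \<le> D * (sqrt (2 ^ k) * (1 + real k))"
      using D(2)[of "nat \<lfloor>X\<rfloor>" k \<alpha>] f by simp
    also have "\<dots> \<le> D * (sqrt (2 ^ k) * (E * (2 ^ k) powr \<delta>))"
      unfolding E_def using D(1) one_plus_le_two_powr[OF \<delta>] by (intro mult_left_mono) auto
    also have "\<dots> = D * E * (2 ^ k) powr (1/2 + \<delta>)"
      by (simp add: powr_add powr_half_sqrt)
    also have "\<dots> \<le> D * E * (2 * X) powr (1/2 + \<delta>)"
      using D(1) E0 k \<delta> by (intro mult_left_mono powr_mono2) auto
    also have "\<dots> = D * E * 2 powr (1/2 + \<delta>) * X powr (1/2 + \<delta>)"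
      using X by (simp add: powr_mult)
    finally show ?thesis .
  qed
  moreover have "D * E * 2 powr (1/2 + \<delta>) \<ge> 0" using D(1) E0 by simp
  ultimately show ?thesis by (intro exI[of _ "D * E * 2 powr (1/2 + \<delta>)"] conjI allI impI)
qed

section \<open>Boundedness of invariant functions on the upper half-plane\<close>

lemma Im_mobius:
  assumes "a * d - b * c = 1" "z \<in> \<H>"
  shows "Im (mobius a b c d z) = Im z / (norm (of_int c * z + of_int d))\<^sup>2"
proof -
  have "(of_int a * of_int d - of_int b * of_int c :: real) = of_int (a * d - b * c)" by simp
  hence det: "of_int a * of_int d - of_int b * of_int c = (1 :: real)" using assms by simp
  have "Im (mobius a b c d z) = (Im z * (of_int a * of_int d - of_int b * of_int c))
      / (norm (of_int c * z + of_int d))\<^sup>2"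
    by (simp add: mobius_def Im_divide cmod_power2 algebra_simps)
  thus ?thesis using det by simp
qed

lemma denominator_nonzero:
  assumes "a * d - b * c = 1" "z \<in> \<H>"
  shows "of_int c * z + of_int d \<noteq> 0"
proof
  assume 0: "of_int c * z + of_int d = 0"
  hence "Im (of_int c * z + of_int d) = 0" "Re (of_int c * z + of_int d) = 0" by auto
  hence "c = 0" "d = 0" using assms(2) by (auto simp: upper_half_plane_def)
  thus False using assms(1) by simp
qed

text \<open>
  Instead of a fundamental domain, Dirichlet's approximation theorem: if \<open>y = Im z\<close> is small, there are coprime
  \<open>h\<close>, \<open>k\<close> with \<open>k \<le> y\<^sup>-\<^sup>1\<^sup>/\<^sup>2\<close> and \<open>|k Re z - h| \<le> 2 y\<^sup>1\<^sup>/\<^sup>2\<close>. Then \<open>|k z - h|\<^sup>2 \<le> 5 y\<close>, and a matrix with bottom row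
  \<open>(k, -h)\<close> moves \<open>z\<close> up to height at least \<open>1/5\<close>.
\<close>

lemma reduce_to_high_point:
  assumes z: "z \<in> \<H>"
  obtains a b c d where "a * d - b * c = 1" "Im (mobius a b c d z) \<ge> 1/5"
proof (cases "Im z \<ge> 1/5")
  case True
  thus thesis using that[of 1 1 0 0] by (simp add: mobius_def)
next
  case False
  define y where "y = Im z"
  have y: "0 < y" "y < 1/5" using z False by (auto simp: y_def upper_half_plane_def)
  define r where "r = 1 / sqrt y"
  have "sqrt y \<le> 1/2" using y by (intro real_le_lsqrt) (auto simp: power2_eq_square)
  hence r: "r \<ge> 2" using y by (simp add: r_def field_simps)
  have r2: "r\<^sup>2 = 1 / y" using y by (simp add: r_def power_divide)
  define N where "N = nat \<lfloor>r\<rfloor>"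
  have Nr: "real N \<le> r" "real N \<ge> r / 2"
    using r unfolding N_def by linarith+
  have N0: "N > 0" using Nr r by (cases "N = 0") auto
  obtain h k where hk: "coprime h k" "0 < k" "k \<le> int N" "\<bar>of_int k * Re z - of_int h\<bar> < 1 / real N"
    using Dirichlet_approx_coprime[OF N0] by blast
  have "\<exists>u v. u * k + v * (- h) = gcd k (- h)" by (rule bezout_int)
  moreover have "gcd k (- h) = 1" using hk(1) by (simp add: gcd.commute)
  ultimately obtain u v where uv: "v * (- h) - (- u) * k = 1" by auto
  have "(norm (of_int k * z + of_int (- h)))\<^sup>2 = (of_int k * Re z - of_int h)\<^sup>2 + (of_int k * y)\<^sup>2"
    by (simp add: cmod_power2 y_def)
  also have "\<dots> \<le> (2 / r)\<^sup>2 + (r * y)\<^sup>2"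
  proof (intro add_mono)
    have "1 / real N \<le> 1 / (r / 2)" using Nr r by (intro divide_left_mono) auto
    hence "\<bar>of_int k * Re z - of_int h\<bar> \<le> 2 / r" using hk(4) by simp
    thus "(of_int k * Re z - of_int h)\<^sup>2 \<le> (2 / r)\<^sup>2" using power_mono[OF _ abs_ge_zero, of _ _ 2] by fastforce
    have "of_int k \<le> r" using hk(3) Nr(1) by linarith
    thus "(of_int k * y)\<^sup>2 \<le> (r * y)\<^sup>2" using hk(2) y by (intro power_mono mult_right_mono) auto
  qed
  also have "(2 / r)\<^sup>2 = 4 * y" using y r2 by (simp add: power_divide)
  also have "(r * y)\<^sup>2 = y"
    unfolding power_mult_distrib r2 using y by (simp add: power2_eq_square)
  finally have le: "(norm (of_int k * z + of_int (- h)))\<^sup>2 \<le> 5 * y" by simp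
  have "(norm (of_int k * z + of_int (- h)))\<^sup>2 > 0"
    using denominator_nonzero[OF uv z] by simp
  hence "Im (mobius v (- u) k (- h) z) \<ge> y / (5 * y)"
    unfolding Im_mobius[OF uv z] y_def[symmetric] using le y by (intro divide_left_mono) auto
  thus thesis using that[OF uv] y by simp
qed

text \<open>
  The upper bound starts at \<open>1/5\<close>, the height to which every point of the upper half-plane can be moved. The
  lower bound is needed only from some \<open>a\<close> on, because the Bessel function may vanish at small arguments.
\<close>

definition cusp_weight :: "(real \<Rightarrow> real) \<Rightarrow> bool" where
  "cusp_weight W \<longleftrightarrow>
     (\<exists>C. \<forall>t\<ge>1/5. \<bar>W t\<bar> * sqrt t \<le> C * exp (- t)) \<and>
     (\<exists>a m \<beta> L. a > 0 \<and> m > 0 \<and> \<beta> > 0 \<and> L \<ge> 0 \<and> (\<forall>t\<ge>a. W t \<ge> m * exp (- \<beta> * t)) \<and>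
        (\<forall>s\<in>{a..2*a}. \<forall>t\<in>{a..2*a}. \<bar>W s - W t\<bar> \<le> L * \<bar>s - t\<bar>))"

lemma cusp_weight_regular:
  assumes "cusp_weight W"
  obtains a m L where "regular_weight W a m L"
proof -
  obtain a m \<beta> L where *: "a > 0" "m > 0" "\<beta> > 0" "L \<ge> 0" "\<And>t. t \<ge> a \<Longrightarrow> W t \<ge> m * exp (- \<beta> * t)"
        "\<forall>s\<in>{a..2*a}. \<forall>t\<in>{a..2*a}. \<bar>W s - W t\<bar> \<le> L * \<bar>s - t\<bar>"
    using assms unfolding cusp_weight_def by blast
  have "W t \<ge> m * exp (- \<beta> * (2 * a))" if "t \<in> {a..2*a}" for t
  proof -
    have "m * exp (- \<beta> * (2 * a)) \<le> m * exp (- \<beta> * t)" using * that by simp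
    also have "\<dots> \<le> W t" using *(5) that by simp
    finally show ?thesis .
  qed
  thus thesis using * by (intro that[of a "m * exp (- \<beta> * (2 * a))" L]) (simp add: regular_weight_def)
qed

text \<open>
  By invariance it is enough to bound \<open>G\<close> for \<open>Im z \<ge> 1/5\<close>. There the upper bound for \<open>W\<close> reduces the claim to
  the convergence of \<open>\<Sum> |\<lambda>(n)| exp (-|n|/5)\<close>, which follows from the absolute convergence of the expansion
  at the single height \<open>y0 = 1 / (5 \<beta>)\<close> and the lower bound for \<open>W\<close>. That lower bound is available for all but
  finitely many \<open>n\<close>.
\<close>

lemma invariant_expansion_bounded:
  fixes G :: "complex \<Rightarrow> complex"
  assumes inv: "\<And>a b c d z. a * d - b * c = 1 \<Longrightarrow> z \<in> \<H> \<Longrightarrow> norm (G (mobius a b c d z)) = norm (G z)"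
    and expn: "\<And>x y. y > 0 \<Longrightarrow> ((\<lambda>n. of_real (sqrt y) * lam n * of_real (W (\<bar>of_int n\<bar> * y)) * unit_exp (of_int n * x))
                 has_sum G (Complex x y)) (-{0})"
    and W: "cusp_weight W"
  shows "\<exists>B. bounded_fourier_family lam W B"
proof -
  obtain C where C: "\<And>t. t \<ge> 1/5 \<Longrightarrow> \<bar>W t\<bar> * sqrt t \<le> C * exp (- t)"
    using W unfolding cusp_weight_def by blast
  obtain a m \<beta> where lo: "a > 0" "m > 0" "\<beta> > 0" "\<And>t. t \<ge> a \<Longrightarrow> W t \<ge> m * exp (- \<beta> * t)"
    using W unfolding cusp_weight_def by blast
  have C0: "C \<ge> 0"
  proof -
    have "0 \<le> \<bar>W 1\<bar> * sqrt 1" by simp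
    also have "\<dots> \<le> C * exp (- 1)" by (rule C) simp
    finally show ?thesis by (simp add: zero_le_mult_iff)
  qed
  define y0 where "y0 = 1 / (5 * \<beta>)"
  have y0: "y0 > 0" using lo by (simp add: y0_def)
  define w where "w = (\<lambda>n :: int. norm (lam n) * exp (- \<bar>of_int n\<bar> / 5))"
  \<comment> \<open>the finitely many indices for which the lower bound for \<open>W\<close> is not available at height \<open>y0\<close>\<close>
  define F where "F = {n :: int. n \<noteq> 0 \<and> \<bar>of_int n\<bar> < a / y0}"
  have "F \<subseteq> {-\<lceil>a / y0\<rceil>..\<lceil>a / y0\<rceil>}" unfolding F_def by (auto simp: le_ceiling_iff) linarith+
  hence finF: "finite F" by (rule finite_subset) simp
  have "(\<lambda>n. of_real (sqrt y0) * lam n * of_real (W (\<bar>of_int n\<bar> * y0))) summable_on -{0}"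
    using has_sum_imp_summable[OF expn[OF y0, of 0]] by simp
  hence "(\<lambda>n. norm (of_real (sqrt y0) * lam n * of_real (W (\<bar>of_int n\<bar> * y0)))) summable_on -{0}"
    by (simp add: summable_on_iff_abs_summable_on_complex)
  hence "(\<lambda>n. norm (of_real (sqrt y0) * lam n * of_real (W (\<bar>of_int n\<bar> * y0)))) summable_on (-{0} - F)"
    by (rule summable_on_subset_banach) auto
  hence "(\<lambda>n. 1 / (sqrt y0 * m) * norm (of_real (sqrt y0) * lam n * of_real (W (\<bar>of_int n\<bar> * y0)))) summable_on (-{0} - F)"
    by (rule summable_on_cmult_right)
  hence "w summable_on (-{0} - F)"
  proof (rule summable_on_comparison_test)
    fix n :: int assume n: "n \<in> - {0} - F"
    hence "\<bar>of_int n\<bar> * y0 \<ge> a" using y0 by (auto simp: F_def field_simps)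
    from lo(4)[OF this] have "m * exp (- \<bar>of_int n\<bar> / 5) \<le> W (\<bar>of_int n\<bar> * y0)"
      using lo(3) by (simp add: y0_def)
    hence "exp (- \<bar>of_int n\<bar> / 5) \<le> \<bar>W (\<bar>of_int n\<bar> * y0)\<bar> / m"
      using lo by (simp add: field_simps)
    hence "w n \<le> norm (lam n) * (\<bar>W (\<bar>of_int n\<bar> * y0)\<bar> / m)"
      unfolding w_def by (intro mult_left_mono) auto
    also have "\<dots> = 1 / (sqrt y0 * m) * norm (of_real (sqrt y0) * lam n * of_real (W (\<bar>of_int n\<bar> * y0)))"
      using y0 lo by (simp add: norm_mult)
    finally show "w n \<le> 1 / (sqrt y0 * m) * norm (of_real (sqrt y0) * lam n * of_real (W (\<bar>of_int n\<bar> * y0)))" .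
  qed (simp add: w_def)
  hence "w summable_on ((-{0} - F) \<union> F)"
    using finF by (intro summable_on_union) auto
  moreover have "(-{0} - F) \<union> F = -{0}" by (auto simp: F_def)
  ultimately have wsum: "w summable_on -{0}" by simp
  define B where "B = infsum (\<lambda>n. C * w n) (-{0})"
  have high: "norm (G (Complex x y)) \<le> B" if y: "y \<ge> 1/5" for x y
  proof -
    let ?t = "\<lambda>n. of_real (sqrt y) * lam n * of_real (W (\<bar>of_int n\<bar> * y)) * unit_exp (of_int n * x)"
    have hs: "(?t has_sum G (Complex x y)) (-{0})" using expn y by simp
    have abs: "(\<lambda>n. norm (?t n)) summable_on -{0}"
      using has_sum_imp_summable[OF hs] by (simp only: summable_on_iff_abs_summable_on_complex)
    have "norm (G (Complex x y)) = norm (infsum ?t (-{0}))" using hs by (simp add: infsumI)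
    also have "\<dots> \<le> infsum (\<lambda>n. norm (?t n)) (-{0})" by (rule norm_infsum_bound[OF abs])
    also have "\<dots> \<le> B" unfolding B_def
    proof (rule infsum_mono[OF abs summable_on_cmult_right[OF wsum]])
      fix n :: int assume n: "n \<in> -{0}"
      let ?s = "\<bar>of_int n\<bar> * y"
      have n1: "\<bar>real_of_int n\<bar> \<ge> 1" using n by auto
      have ys: "y \<le> ?s" using n1 y by (simp add: mult_le_cancel_right1)
      hence s5: "?s \<ge> 1/5" using y by linarith
      have ns: "\<bar>of_int n\<bar> / 5 \<le> ?s" using mult_left_mono[OF y, of "\<bar>of_int n\<bar>"] by simp
      have "norm (?t n) = norm (lam n) * (\<bar>W ?s\<bar> * sqrt y)"
        using y by (simp add: norm_mult)
      also have "\<dots> \<le> norm (lam n) * (\<bar>W ?s\<bar> * sqrt ?s)"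
        using ys by (intro mult_left_mono) auto
      also have "\<dots> \<le> norm (lam n) * (C * exp (- ?s))"
        by (intro mult_left_mono C s5) auto
      also have "\<dots> \<le> norm (lam n) * (C * exp (- \<bar>of_int n\<bar> / 5))"
        using C0 ns by (intro mult_left_mono) auto
      finally show "norm (?t n) \<le> C * w n" by (simp add: w_def mult.left_commute)
    qed
    finally show ?thesis .
  qed
  have all: "norm (G z) \<le> B" if z: "z \<in> \<H>" for z
  proof -
    obtain a b c d where g: "a * d - b * c = 1" "Im (mobius a b c d z) \<ge> 1/5"
      using reduce_to_high_point[OF z] by blast
    have "norm (G (Complex (Re (mobius a b c d z)) (Im (mobius a b c d z)))) \<le> B" by (rule high[OF g(2)])
    thus ?thesis using inv[OF g(1) z] by (simp add: complex_surj)
  qed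
  have "bounded_fourier_family lam W B" unfolding bounded_fourier_family_def
  proof (intro allI impI)
    fix y :: real assume y: "y > 0"
    show "\<exists>G. (\<forall>x. ((\<lambda>n. of_real (sqrt y) * lam n * of_real (W (\<bar>of_int n\<bar> * y)) * unit_exp (of_int n * x))
                 has_sum G x) (-{0})) \<and> (\<forall>x. norm (G x) \<le> B)"
      using expn[OF y] all y by (intro exI[of _ "\<lambda>x. G (Complex x y)"]) (auto simp: upper_half_plane_def)
  qed
  thus ?thesis by blast
qed

section \<open>Holomorphic cusp forms\<close>

definition holomorphic_weight :: "nat \<Rightarrow> real \<Rightarrow> real" where
  "holomorphic_weight k t = t powr ((real k - 1) / 2) * exp (- 2 * pi * t)"

text \<open>
  Lets the factor \<open>exp (-2 \<pi> t)\<close> of the weight absorb the power of \<open>t\<close> and still leave \<open>exp (- t)\<close>.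
\<close>

lemma powr_le_fact_exp:
  assumes "t > 0"
  shows "t powr (real k / 2) \<le> (1 + fact k) * exp (t :: real)"
proof -
  have tk: "t ^ k \<le> fact k * exp t"
  proof -
    have "(\<Sum>n\<in>{k}. t ^ n /\<^sub>R fact n) \<le> exp t"
      unfolding exp_def using assms by (intro sum_le_suminf summable_exp_generic) auto
    hence "t ^ k / fact k \<le> exp t" by (simp add: field_simps)
    thus ?thesis by (simp add: field_simps)
  qed
  have "t powr (real k / 2) \<le> 1 + t ^ k"
  proof (cases "t \<le> 1")
    case True
    have "t powr (real k / 2) \<le> 1 powr (real k / 2)" using True assms by (intro powr_mono2) auto
    thus ?thesis using assms by (simp add: add_increasing2)
  next
    case False
    have "t powr (real k / 2) \<le> t powr real k" using False by (intro powr_mono) auto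
    thus ?thesis using assms by (simp add: powr_realpow)
  qed
  also have "\<dots> \<le> exp t + fact k * exp t" using tk assms by (intro add_mono) auto
  finally show ?thesis by (simp add: distrib_right)
qed

lemma lipschitz_of_continuous_derivative:
  fixes f f' :: "real \<Rightarrow> real"
  assumes der: "\<And>t. t \<in> {a..b} \<Longrightarrow> (f has_real_derivative f' t) (at t)"
    and cont: "continuous_on {a..b} f'"
  shows "\<exists>L\<ge>0. \<forall>s\<in>{a..b}. \<forall>t\<in>{a..b}. \<bar>f s - f t\<bar> \<le> L * \<bar>s - t\<bar>"
proof -
  have "bounded (f' ` {a..b})"
    using cont by (intro compact_imp_bounded compact_continuous_image) auto
  hence "\<exists>L>0. \<forall>x\<in>f' ` {a..b}. norm x \<le> L"
    by (simp only: bounded_pos)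
  then obtain L where L: "L > 0" "\<forall>x\<in>f' ` {a..b}. norm x \<le> L"
    by (elim exE conjE) (rule that)
  have "norm (f s - f t) \<le> L * norm (s - t)" if st: "s \<in> {a..b}" "t \<in> {a..b}" for s t
  proof (rule field_differentiable_bound[OF _ _ _ st])
    fix z assume z: "z \<in> {a..b}"
    show "(f has_field_derivative f' z) (at z within {a..b})"
      by (rule has_field_derivative_at_within[OF der[OF z]])
    show "norm (f' z) \<le> L" by (rule bspec[OF L(2) imageI[OF z]])
  qed simp
  thus ?thesis using L(1) by (intro exI[of _ L] conjI ballI) simp_all
qed

lemma cusp_weight_holomorphic: "cusp_weight (holomorphic_weight k)"
  unfolding cusp_weight_def
proof (intro conjI)
  have "\<bar>holomorphic_weight k t\<bar> * sqrt t \<le> (1 + fact k) * exp (- t)" if t: "t \<ge> 1/5" for t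
  proof -
    have "\<bar>holomorphic_weight k t\<bar> * sqrt t = t powr ((real k - 1) / 2) * t powr (1/2) * exp (- 2 * pi * t)"
    proof -
      have "sqrt t = t powr (1/2)" using t by (simp add: powr_half_sqrt)
      moreover have "\<bar>holomorphic_weight k t\<bar> = holomorphic_weight k t"
        by (intro abs_of_nonneg) (simp add: holomorphic_weight_def)
      ultimately show ?thesis unfolding holomorphic_weight_def by (simp only: mult_ac)
    qed
    also have "\<dots> = t powr (real k / 2) * exp (- 2 * pi * t)"
      unfolding powr_add[symmetric] by (intro arg_cong2[where f = "(*)"] arg_cong2[where f = "(powr)"]) (simp_all add: field_simps)
    also have "\<dots> \<le> ((1 + fact k) * exp t) * exp (- 2 * t)"
    proof (intro mult_mono powr_le_fact_exp)
      have "1 * t \<le> pi * t" using t pi_ge_two by (intro mult_right_mono) auto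
      thus "exp (- 2 * pi * t) \<le> exp (- 2 * t)" by simp
    qed (use t in auto)
    also have "\<dots> = (1 + fact k) * exp (- t)" unfolding mult.assoc exp_add[symmetric] by simp
    finally show ?thesis .
  qed
  thus "\<exists>C. \<forall>t\<ge>1/5. \<bar>holomorphic_weight k t\<bar> * sqrt t \<le> C * exp (- t)" by blast
next
  define r where "r = (real k - 1) / 2"
  define W' where "W' = (\<lambda>t :: real. r * t powr (r - 1) * exp (- 2 * pi * t)
      + exp (- 2 * pi * t) * (- 2 * pi) * t powr r)"
  have der: "(holomorphic_weight k has_real_derivative W' t) (at t)" if "t > 0" for t
  proof -
    have "((\<lambda>t. t powr r) has_real_derivative r * t powr (r - 1)) (at t)"
      by (rule has_real_derivative_powr[OF that])
    moreover have "((\<lambda>t. exp (- 2 * pi * t)) has_real_derivative exp (- 2 * pi * t) * (- 2 * pi)) (at t)"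
      by (auto intro!: derivative_eq_intros)
    ultimately show ?thesis
      unfolding holomorphic_weight_def[abs_def] W'_def r_def by (rule DERIV_mult)
  qed
  have "continuous_on {1..2} W'" unfolding W'_def by (intro continuous_intros) auto
  hence "\<exists>L\<ge>0. \<forall>s\<in>{1..2}. \<forall>t\<in>{1..2}. \<bar>holomorphic_weight k s - holomorphic_weight k t\<bar> \<le> L * \<bar>s - t\<bar>"
    by (intro lipschitz_of_continuous_derivative[where f' = W'] der) auto
  then obtain L where L0: "L \<ge> 0" and
      lip: "\<forall>s\<in>{1..2}. \<forall>t\<in>{1..2}. \<bar>holomorphic_weight k s - holomorphic_weight k t\<bar> \<le> L * \<bar>s - t\<bar>"
    by blast
  have lo: "holomorphic_weight k t \<ge> 1 * exp (- (2 * pi + 1) * t)" if t: "t \<ge> 1" for t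
  proof -
    have "exp (- t) \<le> t powr ((real k - 1) / 2)"
    proof -
      have "ln t \<le> t - 1" using t by (intro ln_le_minus_one) auto
      hence "- (1/2) * ln t \<ge> - t" using t by simp
      moreover have "(real k - 1) / 2 * ln t \<ge> - (1/2) * ln t"
        using t by (intro mult_right_mono) auto
      ultimately have "(real k - 1) / 2 * ln t \<ge> - t" by linarith
      thus ?thesis using t by (simp add: powr_def)
    qed
    hence "exp (- t) * exp (- 2 * pi * t) \<le> holomorphic_weight k t"
      unfolding holomorphic_weight_def by (intro mult_right_mono) auto
    thus ?thesis unfolding exp_add[symmetric] by (simp add: algebra_simps)
  qed
  show "\<exists>a m \<beta> L. a > 0 \<and> m > 0 \<and> \<beta> > 0 \<and> L \<ge> 0 \<and> (\<forall>t\<ge>a. holomorphic_weight k t \<ge> m * exp (- \<beta> * t)) \<and>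
        (\<forall>s\<in>{a..2*a}. \<forall>t\<in>{a..2*a}. \<bar>holomorphic_weight k s - holomorphic_weight k t\<bar> \<le> L * \<bar>s - t\<bar>)"
  proof (rule exI[of _ 1], rule exI[of _ 1], rule exI[of _ "2 * pi + 1"], rule exI[of _ L], intro conjI)
    show "\<forall>t\<ge>1. 1 * exp (- (2 * pi + 1) * t) \<le> holomorphic_weight k t"
      by (intro allI impI lo)
    show "\<forall>s\<in>{1..2 * 1}. \<forall>t\<in>{1..2 * 1}. \<bar>holomorphic_weight k s - holomorphic_weight k t\<bar> \<le> L * \<bar>s - t\<bar>"
      using lip by simp
    have "pi > 0" by simp
    thus "2 * pi + 1 > 0" by linarith
  qed (use L0 in simp_all)
qed

text \<open>
  The invariant function is \<open>y\<^sup>k\<^sup>/\<^sup>2 |f(z)|\<close>. Its expansion acquires the shape common to both kinds of forms by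
  writing \<open>n\<^sup>(\<^sup>k\<^sup>-\<^sup>1\<^sup>)\<^sup>/\<^sup>2 y\<^sup>k\<^sup>/\<^sup>2 = \<surd>y (n y)\<^sup>(\<^sup>k\<^sup>-\<^sup>1\<^sup>)\<^sup>/\<^sup>2\<close> and setting the coefficients of negative index to \<open>0\<close>.
\<close>

lemma holomorphic_form_family:
  assumes cusp: "holomorphic_cusp_form k f" and coeffs: "holomorphic_fourier_coeffs k f lam"
  shows "\<exists>B. bounded_fourier_family (\<lambda>n. if n \<ge> 1 then lam n else 0) (holomorphic_weight k) B"
proof (rule invariant_expansion_bounded)
  let ?G = "\<lambda>z. of_real (Im z powr (real k / 2)) * f z"
  show "cusp_weight (holomorphic_weight k)" by (rule cusp_weight_holomorphic)
  show "norm (?G (mobius a b c d z)) = norm (?G z)" if g: "a * d - b * c = 1" and z: "z \<in> \<H>" for a b c d z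
  proof -
    let ?n = "norm (of_int c * z + of_int d)"
    have n: "?n > 0" using denominator_nonzero[OF g z] by simp
    have y: "Im z > 0" using z by (simp add: upper_half_plane_def)
    have "f (mobius a b c d z) = (of_int c * z + of_int d) ^ k * f z"
      using cusp g z unfolding holomorphic_cusp_form_def by blast
    hence "norm (?G (mobius a b c d z)) = (Im z / ?n\<^sup>2) powr (real k / 2) * (?n ^ k * norm (f z))"
      by (simp add: Im_mobius[OF g z] norm_mult norm_power)
    also have "(?n\<^sup>2) powr (real k / 2) = ?n ^ k"
    proof -
      have "?n\<^sup>2 = ?n powr 2" using n by simp
      thus ?thesis using n by (simp only: powr_powr) (simp add: powr_realpow)
    qed
    hence "(Im z / ?n\<^sup>2) powr (real k / 2) = Im z powr (real k / 2) / ?n ^ k"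
      using y n by (subst powr_divide) auto
    also have "Im z powr (real k / 2) / ?n ^ k * (?n ^ k * norm (f z)) = norm (?G z)"
      using n by (simp add: norm_mult)
    finally show ?thesis .
  qed
  show "((\<lambda>n. of_real (sqrt y) * (if n \<ge> 1 then lam n else 0) * of_real (holomorphic_weight k (\<bar>of_int n\<bar> * y)) * unit_exp (of_int n * x))
                 has_sum ?G (Complex x y)) (-{0})" if y: "y > 0" for x y
  proof -
    have zH: "Complex x y \<in> \<H>" using y by (simp add: upper_half_plane_def)
    have "((\<lambda>n. of_real (y powr (real k / 2)) * (lam n * of_real (of_int n powr ((real k - 1) / 2)) * ee (of_int n * Complex x y)))
               has_sum ?G (Complex x y)) {1..}"
      using coeffs zH unfolding holomorphic_fourier_coeffs_def by (auto intro: has_sum_cmult_right)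
    also have "?this \<longleftrightarrow> ?thesis"
    proof (rule has_sum_cong_neutral)
      fix n :: int assume "n \<in> {1..} \<inter> - {0}"
      hence n: "n \<ge> 1" by auto
      have "ee (of_int n * Complex x y) = unit_exp (of_int n * x) * of_real (exp (- 2 * pi * (of_int n * y)))"
      proof -
        have "2 * of_real pi * \<i> * (of_int n * Complex x y)
            = \<i> * of_real (2 * pi * (of_int n * x)) + of_real (- 2 * pi * (of_int n * y))"
          by (simp add: complex_eq_iff)
        thus ?thesis unfolding ee_def unit_exp_def cis_conv_exp
          by (simp only: exp_add exp_of_real)
      qed
      moreover have "y powr (real k / 2) = sqrt y * y powr ((real k - 1) / 2)"
        using y by (simp add: powr_half_sqrt[symmetric] powr_add[symmetric] diff_divide_distrib)
      moreover have "(of_int n * y) powr ((real k - 1) / 2) = of_int n powr ((real k - 1) / 2) * y powr ((real k - 1) / 2)"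
        using n y by (simp add: powr_mult)
      ultimately show "of_real (y powr (real k / 2)) * (lam n * of_real (of_int n powr ((real k - 1) / 2)) * ee (of_int n * Complex x y))
        = of_real (sqrt y) * (if n \<ge> 1 then lam n else 0) * of_real (holomorphic_weight k (\<bar>of_int n\<bar> * y)) * unit_exp (of_int n * x)"
        using n by (simp add: holomorphic_weight_def)
    qed auto
    finally show ?thesis .
  qed
qed

section \<open>The Bessel function and Maass forms\<close>

lemma exp_decay_integral:
  fixes a :: real
  assumes a: "a > 0"
  shows "set_integrable lborel {0..} (\<lambda>t. exp (- a * t))"
    and "(LBINT t:{0..}. exp (- a * t)) = 1 / a"
proof -
  have "(\<lambda>t. exp (- a * t)) absolutely_integrable_on {0..}"
    by (intro nonnegative_absolutely_integrable_1 integrable_on_exp_minus_to_infinity a) auto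
  thus i: "set_integrable lborel {0..} (\<lambda>t. exp (- a * t))"
    unfolding set_integrable_def by (subst (asm) integrable_completion) auto
  show "(LBINT t:{0..}. exp (- a * t)) = 1 / a"
    using set_borel_integral_eq_integral(2)[OF i] has_integral_exp_minus_to_infinity[OF a, of 0]
    by (simp add: integral_unique)
qed

lemma cosh_ge_linear:
  fixes t :: real
  shows "cosh t \<ge> 1/2 + t/2"
proof -
  have "cosh t \<ge> exp t / 2" by (simp add: cosh_def)
  thus ?thesis using exp_ge_add_one_self[of t] by linarith
qed

text \<open>
  Bounding \<open>cosh\<close> by a linear function replaces the Bessel integrals by elementary ones.
\<close>

lemma exp_cosh_le:
  fixes x t :: real
  assumes "x > 0"
  shows "exp (- x * cosh t) \<le> exp (- x / 2) * exp (- (x / 2) * t)"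
proof -
  have "x * cosh t \<ge> x * (1/2 + t/2)" using assms cosh_ge_linear by (intro mult_left_mono) auto
  thus ?thesis by (simp add: distrib_left flip: exp_add)
qed

lemma exp_cosh_integrable:
  fixes x :: real
  assumes "x > 0"
  shows "set_integrable lborel {0..} (\<lambda>t. exp (- x * cosh t))"
proof (rule set_integrable_bound)
  show "set_integrable lborel {0..} (\<lambda>t. exp (- x / 2) * exp (- (x / 2) * t))"
    using exp_decay_integral(1)[of "x / 2"] assms by (intro set_integrable_mult_right) auto
  show "set_borel_measurable lborel {0..} (\<lambda>t. exp (- x * cosh t))"
    unfolding set_borel_measurable_def cosh_def by measurable
  show "AE t in lborel. t \<in> {0..} \<longrightarrow> norm (exp (- x * cosh t)) \<le> norm (exp (- x / 2) * exp (- (x / 2) * t))"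
    using exp_cosh_le[OF assms] by (simp add: abs_mult)
qed

text \<open>
  \<open>K\<^sub>i\<^sub>\<mu> (x)\<close> as a real number: \<open>cosh (i \<mu> t) = cos (\<mu> t)\<close>.
\<close>

definition bessel_K_imag :: "real \<Rightarrow> real \<Rightarrow> real" where
  "bessel_K_imag \<mu> x = (LBINT t:{0..}. exp (- x * cosh t) * cos (\<mu> * t))"

lemma bessel_K_imag_integrable:
  fixes x \<mu> :: real
  assumes "x > 0"
  shows "set_integrable lborel {0..} (\<lambda>t. exp (- x * cosh t) * cos (\<mu> * t))"
proof (rule set_integrable_bound[OF exp_cosh_integrable[OF assms]])
  show "set_borel_measurable lborel {0..} (\<lambda>t. exp (- x * cosh t) * cos (\<mu> * t))"
    unfolding set_borel_measurable_def cosh_def by measurable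
  show "AE t in lborel. t \<in> {0..} \<longrightarrow> norm (exp (- x * cosh t) * cos (\<mu> * t)) \<le> norm (exp (- x * cosh t))"
    by (simp add: abs_mult mult_left_le)
qed

lemma bessel_K_eq_bessel_K_imag: "bessel_K (\<i> * of_real \<mu>) x = of_real (bessel_K_imag \<mu> x)"
proof -
  have "cosh (\<i> * of_real \<mu> * of_real t) = of_real (cos (\<mu> * t))" for t :: real
    by (simp add: cosh_conv_cos mult.assoc[symmetric] flip: cos_of_real)
  hence "bessel_K (\<i> * of_real \<mu>) x = (LBINT t:{0..}. complex_of_real (exp (- x * cosh t) * cos (\<mu> * t)))"
    unfolding bessel_K_def by simp
  thus ?thesis unfolding bessel_K_imag_def by (simp only: set_integral_complex_of_real)
qed

lemma bessel_K_imag_upper: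
  assumes x: "x > 0"
  shows "\<bar>bessel_K_imag \<mu> x\<bar> \<le> exp (- x / 2) * (2 / x)"
proof -
  have "norm (bessel_K_imag \<mu> x) \<le> (LBINT t:{0..}. norm (exp (- x * cosh t) * cos (\<mu> * t)))"
    unfolding bessel_K_imag_def by (intro set_integral_norm_bound bessel_K_imag_integrable x)
  also have "\<dots> \<le> (LBINT t:{0..}. exp (- x / 2) * exp (- (x / 2) * t))"
  proof (rule set_integral_mono)
    show "set_integrable lborel {0..} (\<lambda>t. norm (exp (- x * cosh t) * cos (\<mu> * t)))"
      using bessel_K_imag_integrable[OF x, of \<mu>] by (rule set_integrable_norm)
    show "set_integrable lborel {0..} (\<lambda>t. exp (- x / 2) * exp (- (x / 2) * t))"
      using exp_decay_integral(1)[of "x / 2"] x by (intro set_integrable_mult_right) auto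
    fix t :: real
    have "norm (exp (- x * cosh t) * cos (\<mu> * t)) \<le> exp (- x * cosh t)"
      by (simp add: abs_mult mult_left_le)
    thus "norm (exp (- x * cosh t) * cos (\<mu> * t)) \<le> exp (- x / 2) * exp (- (x / 2) * t)"
      using exp_cosh_le[OF x, of t] by linarith
  qed
  also have "\<dots> = exp (- x / 2) * (2 / x)"
    using exp_decay_integral(2)[of "x / 2"] x by simp
  finally show ?thesis by simp
qed

text \<open>
  The difference quotients of \<open>exp (- x c)\<close> for \<open>x \<ge> a\<close> are at most \<open>c exp (- a c) \<le> (2/a) exp (- (a/2) c)\<close>, which is
  integrable in \<open>t\<close> for \<open>c = cosh t\<close>.
\<close>

lemma bessel_K_imag_lipschitz:
  assumes a: "a > 0"
  shows "\<exists>L\<ge>0. \<forall>s\<ge>a. \<forall>t\<ge>a. \<bar>bessel_K_imag \<mu> s - bessel_K_imag \<mu> t\<bar> \<le> L * \<bar>s - t\<bar>"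
proof -
  have pt: "\<bar>exp (- s * c) - exp (- t * c)\<bar> \<le> \<bar>s - t\<bar> * (2 / a * exp (- (a / 2) * c))"
    if "s \<ge> a" "t \<ge> s" "c \<ge> 0" for s t c :: real
  proof -
    have "1 + - ((t - s) * c) \<le> exp (- ((t - s) * c))" by (rule exp_ge_add_one_self)
    hence "1 - exp (- (t - s) * c) \<le> (t - s) * c"
      unfolding minus_mult_left by linarith
    moreover have "(t - s) * c \<ge> 0" using that by simp
    hence "exp (- (t - s) * c) \<le> 1" by (simp only: minus_mult_left[symmetric] neg_le_0_iff_le exp_le_one_iff)
    moreover have "exp (- s * c) \<le> exp (- a * c)" using that by (auto intro: mult_right_mono)
    ultimately have "exp (- s * c) * (1 - exp (- (t - s) * c)) \<le> exp (- a * c) * ((t - s) * c)"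
      by (intro mult_mono) simp_all
    moreover have "exp (- s * c) * (1 - exp (- (t - s) * c)) = exp (- s * c) - exp (- t * c)"
      by (simp add: right_diff_distrib algebra_simps flip: exp_add)
    moreover have "exp (- t * c) \<le> exp (- s * c)" using that by (auto intro: mult_right_mono)
    moreover have "exp (- a * c) * c \<le> 2 / a * exp (- (a / 2) * c)"
    proof -
      have "a / 2 * c \<le> exp (a / 2 * c)" using exp_ge_add_one_self[of "a / 2 * c"] by linarith
      hence "c \<le> 2 / a * exp (a / 2 * c)" using a by (simp add: field_simps)
      hence "exp (- a * c) * c \<le> exp (- a * c) * (2 / a * exp (a / 2 * c))" by (intro mult_left_mono) auto
      also have "\<dots> = 2 / a * (exp (- a * c) * exp (a / 2 * c))" by simp
      also have "exp (- a * c) * exp (a / 2 * c) = exp (- (a / 2) * c)"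
        unfolding exp_add[symmetric] by (simp add: algebra_simps)
      finally show ?thesis .
    qed
    hence "(t - s) * (exp (- a * c) * c) \<le> (t - s) * (2 / a * exp (- (a / 2) * c))"
      using that by (intro mult_left_mono) auto
    ultimately show ?thesis using that by (simp add: mult_ac)
  qed
  define L where "L = (LBINT t:{0..}. 2 / a * exp (- (a / 2) * cosh t))"
  have Li: "set_integrable lborel {0..} (\<lambda>t. 2 / a * exp (- (a / 2) * cosh t))"
    using exp_cosh_integrable[of "a / 2"] a by (intro set_integrable_mult_right) auto
  have L0: "L \<ge> 0" unfolding L_def set_lebesgue_integral_def using a by (intro integral_nonneg_AE) (auto simp: indicator_def)
  have main: "\<bar>bessel_K_imag \<mu> s - bessel_K_imag \<mu> t\<bar> \<le> L * \<bar>s - t\<bar>" if st: "s \<ge> a" "t \<ge> s" for s t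
  proof -
    have i: "set_integrable lborel {0..} (\<lambda>u. exp (- s * cosh u) * cos (\<mu> * u))"
            "set_integrable lborel {0..} (\<lambda>u. exp (- t * cosh u) * cos (\<mu> * u))"
      by (rule bessel_K_imag_integrable, use st a in simp)+
    let ?d = "\<lambda>u. exp (- s * cosh u) * cos (\<mu> * u) - exp (- t * cosh u) * cos (\<mu> * u)"
    have "norm (bessel_K_imag \<mu> s - bessel_K_imag \<mu> t) = norm (LBINT u:{0..}. ?d u)"
      unfolding bessel_K_imag_def using set_integral_diff(2)[OF i] by simp
    also have "\<dots> \<le> (LBINT u:{0..}. norm (?d u))"
      by (intro set_integral_norm_bound set_integral_diff(1) i)
    also have "\<dots> \<le> (LBINT u:{0..}. \<bar>s - t\<bar> * (2 / a * exp (- (a / 2) * cosh u)))"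
    proof (rule set_integral_mono)
      show "set_integrable lborel {0..} (\<lambda>u. norm (?d u))"
        by (intro set_integrable_norm set_integral_diff(1) i)
      show "set_integrable lborel {0..} (\<lambda>u. \<bar>s - t\<bar> * (2 / a * exp (- (a / 2) * cosh u)))"
        by (intro set_integrable_mult_right Li)
      fix u :: real
      have "norm (?d u) = \<bar>exp (- s * cosh u) - exp (- t * cosh u)\<bar> * \<bar>cos (\<mu> * u)\<bar>"
        by (simp add: left_diff_distrib[symmetric] abs_mult)
      also have "\<dots> \<le> \<bar>exp (- s * cosh u) - exp (- t * cosh u)\<bar>" by (intro mult_left_le) auto
      also have "\<dots> \<le> \<bar>s - t\<bar> * (2 / a * exp (- (a / 2) * cosh u))" by (intro pt st) simp
      finally show "norm (?d u) \<le> \<bar>s - t\<bar> * (2 / a * exp (- (a / 2) * cosh u))" .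
    qed
    also have "\<dots> = L * \<bar>s - t\<bar>" unfolding L_def by simp
    finally show ?thesis by simp
  qed
  have "\<bar>bessel_K_imag \<mu> s - bessel_K_imag \<mu> t\<bar> \<le> L * \<bar>s - t\<bar>" if "s \<ge> a" "t \<ge> a" for s t
    using main[of s t] main[of t s] that by (cases "s \<le> t") (auto simp: abs_minus_commute)
  thus ?thesis using L0 by blast
qed

text \<open>
  \<open>K\<close> oscillates for small arguments, but for large \<open>x\<close> the part of the integral near \<open>t = 0\<close> dominates. With
  \<open>d = \<pi> / (3 \<mu>)\<close> the cosine is at least \<open>1/2\<close> on \<open>[0, d]\<close>; the range \<open>[0, d/2]\<close> contributes at least
  \<open>(d/4) exp (-x cosh (d/2))\<close>, and the range beyond \<open>d\<close> is \<open>O (exp (-x cosh d))\<close>.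
\<close>

lemma bessel_K_imag_lower:
  assumes \<mu>: "\<mu> > 0"
  shows "\<exists>x0 m \<beta>. x0 > 0 \<and> m > 0 \<and> \<beta> > 0 \<and> (\<forall>x\<ge>x0. bessel_K_imag \<mu> x \<ge> m * exp (- \<beta> * x))"
proof -
  define d where "d = pi / (3 * \<mu>)"
  have d: "d > 0" using \<mu> by (simp add: d_def)
  define c1 where "c1 = cosh (d / 2)"
  define c2 where "c2 = cosh d"
  have c: "c1 > 0" "c1 < c2" using d by (auto simp: c1_def c2_def cosh_real_nonneg_less_iff cosh_real_pos)
  define C where "C = (LBINT t:{0..}. exp (- 1 * cosh (t::real)))"
  have Ci: "set_integrable lborel {0..} (\<lambda>t::real. exp (- 1 * cosh t))"
    by (rule exp_cosh_integrable) simp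
  have C0: "C \<ge> 0" unfolding C_def set_lebesgue_integral_def by (intro integral_nonneg_AE) (auto simp: indicator_def)
  have cos_half: "cos (\<mu> * t) \<ge> 1/2" if "0 \<le> t" "t \<le> d" for t
  proof -
    have "\<mu> * t \<le> pi / 3" using that \<mu> by (simp add: d_def field_simps)
    hence "cos (pi / 3) \<le> cos (\<mu> * t)" using that \<mu> by (intro cos_monotone_0_pi_le) auto
    thus ?thesis by (simp add: cos_60)
  qed
  \<comment> \<open>a pointwise minorant of the integrand whose integral is explicit up to the constant \<open>C\<close>\<close>
  have pt: "1/2 * exp (- x * c1) * indicator {0..d/2} t - exp (- (x - 1) * c2) * exp (- 1 * cosh t)
       \<le> exp (- x * cosh t) * cos (\<mu> * t)" if x: "x \<ge> 1" and t: "t \<ge> 0" for x t :: real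
  proof -
    have e0: "exp (- (x - 1) * c2) * exp (- 1 * cosh t) \<ge> 0" by simp
    consider "t \<le> d/2" | "d/2 < t" "t \<le> d" | "t > d" by linarith
    thus ?thesis
    proof cases
      case 1
      have "cosh t \<le> c1" using 1 t d by (simp add: c1_def cosh_real_nonneg_le_iff)
      hence "x * cosh t \<le> x * c1" using x by (intro mult_left_mono) auto
      hence "exp (- x * c1) * (1/2) \<le> exp (- x * cosh t) * cos (\<mu> * t)"
        using 1 t d by (intro mult_mono cos_half) auto
      moreover have ind: "indicator {0..d/2} t = (1 :: real)" using 1 t by simp
      ultimately show ?thesis unfolding ind mult_1_right using e0 by linarith
    next
      case 2
      have "0 \<le> exp (- x * cosh t) * cos (\<mu> * t)"
        using cos_half[of t] 2 t by (intro mult_nonneg_nonneg) auto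
      moreover have ind: "indicator {0..d/2} t = (0 :: real)" using 2 by simp
      ultimately show ?thesis unfolding ind mult_zero_right using e0 by linarith
    next
      case 3
      have "c2 \<le> cosh t" using 3 d by (simp add: c2_def cosh_real_nonneg_le_iff)
      hence "(x - 1) * c2 \<le> (x - 1) * cosh t" using x by (intro mult_left_mono) auto
      hence "exp (- x * cosh t) \<le> exp (- (x - 1) * c2) * exp (- 1 * cosh t)"
        by (simp add: algebra_simps flip: exp_add)
      moreover have "exp (- x * cosh t) * (-1) \<le> exp (- x * cosh t) * cos (\<mu> * t)"
        by (intro mult_left_mono) auto
      moreover have ind: "indicator {0..d/2} t = (0 :: real)" using 3 d by simp
      ultimately show ?thesis unfolding ind mult_zero_right by linarith
    qed
  qed
  have lower: "d / 4 * exp (- x * c1) - exp (- (x - 1) * c2) * C \<le> bessel_K_imag \<mu> x" if x: "x \<ge> 1" for x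
  proof -
    have i1: "set_integrable lborel {0..} (\<lambda>t. 1/2 * exp (- x * c1) * indicator {0..d/2} t)"
    proof -
      have "set_integrable lborel {0..d/2} (\<lambda>t. 1/2 * exp (- x * c1))"
        by (intro borel_integrable_atLeastAtMost' continuous_intros)
      moreover have eq: "(\<lambda>t. indicator {0..d/2} t *\<^sub>R (1/2 * exp (- x * c1)))
          = (\<lambda>t. indicator {0..} t *\<^sub>R (1/2 * exp (- x * c1) * indicator {0..d/2} t))"
        by (rule ext) (simp add: indicator_def)
      ultimately show ?thesis unfolding set_integrable_def eq by (simp only:)
    qed
    have v1: "(LBINT t:{0..}. 1/2 * exp (- x * c1) * indicator {0..d/2} t) = d / 4 * exp (- x * c1)"
    proof -
      have "(LBINT t:{0..}. 1/2 * exp (- x * c1) * indicator {0..d/2} t) = (LBINT t:{0..d/2}. 1/2 * exp (- x * c1))"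
        unfolding set_lebesgue_integral_def by (intro Bochner_Integration.integral_cong) (auto simp: indicator_def)
      also have "\<dots> = d / 4 * exp (- x * c1)" using d by (simp add: set_lebesgue_integral_def)
      finally show ?thesis .
    qed
    have i2: "set_integrable lborel {0..} (\<lambda>t. exp (- (x - 1) * c2) * exp (- 1 * cosh t))"
      by (intro set_integrable_mult_right Ci)
    have "d / 4 * exp (- x * c1) - exp (- (x - 1) * c2) * C
       = (LBINT t:{0..}. 1/2 * exp (- x * c1) * indicator {0..d/2} t - exp (- (x - 1) * c2) * exp (- 1 * cosh t))"
      unfolding set_integral_diff(2)[OF i1 i2] v1 C_def by (simp only: set_integral_mult_right)
    also have "\<dots> \<le> bessel_K_imag \<mu> x" unfolding bessel_K_imag_def
      using x by (intro set_integral_mono set_integral_diff(1)[OF i1 i2] bessel_K_imag_integrable pt) auto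
    finally show ?thesis .
  qed
  define D where "D = 8 * C * exp c2 / d"
  have D0: "D \<ge> 0" using C0 d by (simp add: D_def)
  \<comment> \<open>chosen such that \<open>D \<le> exp (x (c2 - c1))\<close> for \<open>x \<ge> x0\<close>, by \<open>exp u \<ge> u\<close>\<close>
  define x0 where "x0 = max 1 (D / (c2 - c1))"
  have "bessel_K_imag \<mu> x \<ge> d / 8 * exp (- c1 * x)" if x: "x \<ge> x0" for x
  proof -
    have x1: "x \<ge> 1" "x \<ge> D / (c2 - c1)" using x by (auto simp: x0_def)
    have "D \<le> x * (c2 - c1)" using x1(2) c by (simp add: field_simps)
    also have "\<dots> \<le> exp (x * (c2 - c1))" using exp_ge_add_one_self[of "x * (c2 - c1)"] by linarith
    finally have "D * exp (- x * c2) \<le> exp (x * (c2 - c1)) * exp (- x * c2)" by (intro mult_right_mono) auto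
    also have "\<dots> = exp (- x * c1)" unfolding exp_add[symmetric] by (simp add: algebra_simps)
    finally have "d / 8 * (D * exp (- x * c2)) \<le> d / 8 * exp (- x * c1)" using d by (intro mult_left_mono) auto
    moreover have "d / 8 * (D * exp (- x * c2)) = exp (- (x - 1) * c2) * C"
    proof -
      have "exp (- (x - 1) * c2) = exp c2 * exp (- x * c2)"
        unfolding exp_add[symmetric] by (simp add: algebra_simps)
      thus ?thesis using d by (simp add: D_def)
    qed
    ultimately show ?thesis using lower[OF x1(1)] by (simp add: mult.commute)
  qed
  moreover have "x0 > 0" by (simp add: x0_def)
  ultimately show ?thesis using d c by (intro exI[of _ x0] exI[of _ "d / 8"] exI[of _ c1]) auto
qed

lemma cusp_weight_bessel:
  assumes \<mu>: "\<mu> > 0"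
  shows "cusp_weight (\<lambda>t. bessel_K_imag \<mu> (2 * pi * t))"
  unfolding cusp_weight_def
proof (intro conjI)
  have "\<bar>bessel_K_imag \<mu> (2 * pi * t)\<bar> * sqrt t \<le> 1 * exp (- t)" if t: "t \<ge> 1/5" for t
  proof -
    have pi2: "pi \<ge> 3" using pi_gt3 by simp
    have tp: "2 * pi * t > 0" using t by simp
    have sq: "1 / 3 \<le> sqrt t" using t by (intro real_le_rsqrt) (simp add: power2_eq_square)
    have "\<bar>bessel_K_imag \<mu> (2 * pi * t)\<bar> * sqrt t \<le> exp (- (2 * pi * t) / 2) * (2 / (2 * pi * t)) * sqrt t"
      using t by (intro mult_right_mono bessel_K_imag_upper[OF tp]) auto
    also have "\<dots> = exp (- pi * t) * (1 / (pi * sqrt t))"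
    proof -
      have "t = sqrt t * sqrt t" using t by simp
      hence eq: "2 / (2 * pi * t) * sqrt t = 1 / (pi * sqrt t)" using t by (simp add: field_simps)
      have "- (2 * pi * t) / 2 = - pi * t" by simp
      thus ?thesis by (simp only: mult.assoc[of "exp _"] eq)
    qed
    also have "\<dots> \<le> exp (- t) * 1"
    proof (intro mult_mono)
      have "1 * t \<le> pi * t" using t pi2 by (intro mult_right_mono) auto
      thus "exp (- pi * t) \<le> exp (- t)" by simp
      have "3 * (1/3) \<le> pi * sqrt t" using sq pi2 by (intro mult_mono) auto
      thus "1 / (pi * sqrt t) \<le> 1" using t by (simp add: divide_le_eq_1)
    qed (use t in auto)
    finally show ?thesis by simp
  qed
  thus "\<exists>C. \<forall>t\<ge>1/5. \<bar>bessel_K_imag \<mu> (2 * pi * t)\<bar> * sqrt t \<le> C * exp (- t)" by blast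
next
  obtain x0 m \<beta> where lo: "x0 > 0" "m > 0" "\<beta> > 0" "\<And>x. x \<ge> x0 \<Longrightarrow> bessel_K_imag \<mu> x \<ge> m * exp (- \<beta> * x)"
    using bessel_K_imag_lower[OF \<mu>] by blast
  obtain L where L: "L \<ge> 0" "\<And>s t. s \<ge> x0 \<Longrightarrow> t \<ge> x0 \<Longrightarrow> \<bar>bessel_K_imag \<mu> s - bessel_K_imag \<mu> t\<bar> \<le> L * \<bar>s - t\<bar>"
    using bessel_K_imag_lipschitz[OF lo(1)] by blast
  define a where "a = x0 / (2 * pi)"
  have a: "a > 0" using lo by (simp add: a_def)
  have ge: "2 * pi * t \<ge> x0" if "t \<ge> a" for t using that by (simp add: a_def field_simps)
  have lower: "bessel_K_imag \<mu> (2 * pi * t) \<ge> m * exp (- (\<beta> * (2 * pi)) * t)" if "t \<ge> a" for t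
    using lo(4)[OF ge[OF that]] by (simp add: mult_ac)
  have lip: "\<bar>bessel_K_imag \<mu> (2 * pi * s) - bessel_K_imag \<mu> (2 * pi * t)\<bar> \<le> (L * (2 * pi)) * \<bar>s - t\<bar>"
    if "s \<ge> a" "t \<ge> a" for s t
  proof -
    have "\<bar>2 * pi * s - 2 * pi * t\<bar> = 2 * pi * \<bar>s - t\<bar>"
      by (simp add: right_diff_distrib[symmetric] abs_mult)
    thus ?thesis using L(2)[OF ge[OF that(1)] ge[OF that(2)]] by (simp add: mult.assoc)
  qed
  show "\<exists>a m \<beta> L. a > 0 \<and> m > 0 \<and> \<beta> > 0 \<and> L \<ge> 0 \<and>
          (\<forall>t\<ge>a. bessel_K_imag \<mu> (2 * pi * t) \<ge> m * exp (- \<beta> * t)) \<and>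
          (\<forall>s\<in>{a..2*a}. \<forall>t\<in>{a..2*a}. \<bar>bessel_K_imag \<mu> (2 * pi * s) - bessel_K_imag \<mu> (2 * pi * t)\<bar> \<le> L * \<bar>s - t\<bar>)"
  proof (rule exI[of _ a], rule exI[of _ m], rule exI[of _ "\<beta> * (2 * pi)"], rule exI[of _ "L * (2 * pi)"], intro conjI)
    show "\<forall>t\<ge>a. m * exp (- (\<beta> * (2 * pi)) * t) \<le> bessel_K_imag \<mu> (2 * pi * t)"
      by (intro allI impI lower)
    show "\<forall>s\<in>{a..2*a}. \<forall>t\<in>{a..2*a}. \<bar>bessel_K_imag \<mu> (2 * pi * s) - bessel_K_imag \<mu> (2 * pi * t)\<bar> \<le> L * (2 * pi) * \<bar>s - t\<bar>"
      by (intro ballI lip) simp_all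
  qed (use a lo(2,3) L(1) in simp_all)
qed

text \<open>
  Here \<open>f\<close> itself is invariant, and its Fourier expansion already has the required shape.
\<close>

lemma maass_form_family:
  assumes \<mu>: "\<mu> > 0" and cusp: "maass_cusp_form \<mu> f" and coeffs: "maass_fourier_coeffs \<mu> f lam"
  shows "\<exists>B. bounded_fourier_family lam (\<lambda>t. bessel_K_imag \<mu> (2 * pi * t)) B"
proof (rule invariant_expansion_bounded)
  show "cusp_weight (\<lambda>t. bessel_K_imag \<mu> (2 * pi * t))" by (rule cusp_weight_bessel[OF \<mu>])
  show "norm (f (mobius a b c d z)) = norm (f z)" if "a * d - b * c = 1" "z \<in> \<H>" for a b c d z
    using cusp that unfolding maass_cusp_form_def by simp
  show "((\<lambda>n. of_real (sqrt y) * lam n * of_real (bessel_K_imag \<mu> (2 * pi * (\<bar>of_int n\<bar> * y))) * unit_exp (of_int n * x))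
                 has_sum f (Complex x y)) (-{0})" if y: "y > 0" for x y
    using coeffs y unfolding maass_fourier_coeffs_def bessel_K_eq_bessel_K_imag
    by (simp add: ee_of_real[symmetric] mult.assoc)
qed

section \<open>Twists by Dirichlet characters\<close>

lemma periodic_mod:
  fixes chi :: "int \<Rightarrow> 'a" and q :: int
  assumes per: "\<And>n. chi (n + q) = chi n"
  shows "chi (n mod q) = chi n"
proof -
  have shift: "chi (m + k * q) = chi m" for m k
  proof (induction k rule: int_induct[where k = 0])
    case (step1 i)
    have "chi (m + (i + 1) * q) = chi ((m + i * q) + q)" by (simp add: algebra_simps)
    thus ?case using step1 per by simp
  next
    case (step2 i)
    have "chi (m + (i - 1) * q) = chi ((m + (i - 1) * q) + q)" using per by simp
    also have "(m + (i - 1) * q) + q = m + i * q" by (simp add: algebra_simps)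
    finally show ?case using step2 by simp
  qed simp
  show ?thesis using shift[of "n mod q" "n div q"] by (simp add: mult.commute)
qed

text \<open>
  The powers \<open>chi n ^ k = chi (n ^ k)\<close> take finitely many values, so they are bounded.
\<close>

lemma dirichlet_character_norm_le_1:
  assumes "dirichlet_character q chi"
  shows "norm (chi n) \<le> 1"
proof (rule ccontr)
  assume "\<not> norm (chi n) \<le> 1"
  hence gt: "norm (chi n) > 1" by simp
  have q: "q > 0" and per: "\<And>n. chi (n + int q) = chi n" and mul: "\<And>m n. chi (m * n) = chi m * chi n"
    using assms unfolding dirichlet_character_def by auto
  define K where "K = (\<Sum>m\<in>{0..<int q}. norm (chi m))"
  have bd: "norm (chi m) \<le> K" for m
  proof -
    have "norm (chi (m mod int q)) \<le> K" unfolding K_def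
      using q by (intro member_le_sum) auto
    thus ?thesis by (simp add: periodic_mod[of chi, OF per])
  qed
  have pw: "chi (n ^ Suc k) = chi n ^ Suc k" for k
    by (induction k) (simp_all add: mul)
  obtain k where k: "K < norm (chi n) ^ k" using real_arch_pow[OF gt] by blast
  have "norm (chi n) ^ k \<le> norm (chi n) ^ Suc k"
    using gt by (intro power_increasing) auto
  hence "K < norm (chi n) ^ Suc k" using k by linarith
  also have "\<dots> = norm (chi (n ^ Suc k))" by (simp only: pw norm_power)
  finally show False using bd[of "n ^ Suc k"] by simp
qed

text \<open>
  The finite Fourier expansion \<open>chi n = (1/q) \<Sum>\<^sub>b h b e(b n / q)\<close> expresses the twisted sum through untwisted ones at
  shifted arguments. By Parseval and Cauchy-Schwarz \<open>\<Sum>\<^sub>b |h b| \<le> q \<surd>q\<close>; this takes the place of the evaluation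
  of Gauss sums.
\<close>

lemma twisted_sum_bound:
  fixes chi a :: "int \<Rightarrow> complex"
  assumes q: "q > 0" and per: "\<And>n. chi (n + int q) = chi n" and le1: "\<And>n. norm (chi n) \<le> 1"
    and T: "\<And>\<alpha>. norm (\<Sum>n\<in>I. a n * unit_exp (of_int n * \<alpha>)) \<le> T"
  shows "norm (\<Sum>n\<in>I. a n * chi n * unit_exp (of_int n * \<alpha>)) \<le> sqrt (real q) * T"
proof -
  define h where "h = (\<lambda>b. \<Sum>m\<in>{0..<int q}. chi m * unit_exp (- of_int m * real b / real q))"
  have inv: "(\<Sum>b<q. unit_exp (of_int n * real b / real q) * h b) = of_nat q * chi n" for n
  proof -
    have "(\<Sum>b<q. (\<Sum>x\<in>{()}. 1 * unit_exp (of_int n * real b / real q)) * h b)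
       = of_nat q * (\<Sum>x\<in>{()}. \<Sum>m\<in>{0..<int q}. if int q dvd n - m then 1 * chi m else 0)"
      unfolding h_def by (rule exp_sum_orthogonality[OF q])
    also have "(\<Sum>x\<in>{()}. \<Sum>m\<in>{0..<int q}. if int q dvd n - m then 1 * chi m else 0)
        = (\<Sum>m\<in>{0..<int q}. if m = n mod int q then chi m else 0)"
    proof -
      have "int q dvd n - m \<longleftrightarrow> m = n mod int q" if "m \<in> {0..<int q}" for m
        using that by (simp add: mod_eq_dvd_iff[symmetric]) (metis mod_pos_pos_trivial)
      thus ?thesis by simp
    qed
    also have "\<dots> = chi n" using q by (simp add: periodic_mod[of chi, OF per])
    finally show ?thesis by simp
  qed
  have T0: "T \<ge> 0" using T[of 0] norm_ge_zero order_trans by blast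
  have "of_nat q * (\<Sum>n\<in>I. a n * chi n * unit_exp (of_int n * \<alpha>))
      = (\<Sum>n\<in>I. a n * unit_exp (of_int n * \<alpha>) * (of_nat q * chi n))"
    unfolding sum_distrib_left by (intro sum.cong refl) (simp add: mult_ac)
  also have "\<dots> = (\<Sum>n\<in>I. \<Sum>b<q. a n * unit_exp (of_int n * \<alpha>) * (unit_exp (of_int n * real b / real q) * h b))"
    by (simp only: inv[symmetric] sum_distrib_left)
  also have "\<dots> = (\<Sum>b<q. \<Sum>n\<in>I. a n * unit_exp (of_int n * \<alpha>) * (unit_exp (of_int n * real b / real q) * h b))"
    by (rule sum.swap)
  also have "\<dots> = (\<Sum>b<q. h b * (\<Sum>n\<in>I. a n * unit_exp (of_int n * (\<alpha> + real b / real q))))"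
    unfolding sum_distrib_left distrib_left unit_exp_add times_divide_eq_right by (simp only: mult_ac)
  finally have eq: "of_nat q * (\<Sum>n\<in>I. a n * chi n * unit_exp (of_int n * \<alpha>))
      = (\<Sum>b<q. h b * (\<Sum>n\<in>I. a n * unit_exp (of_int n * (\<alpha> + real b / real q))))" .
  have "real q * norm (\<Sum>n\<in>I. a n * chi n * unit_exp (of_int n * \<alpha>))
      = norm (of_nat q * (\<Sum>n\<in>I. a n * chi n * unit_exp (of_int n * \<alpha>)))"
    by (simp only: norm_mult norm_of_nat)
  also have "\<dots> = norm (\<Sum>b<q. h b * (\<Sum>n\<in>I. a n * unit_exp (of_int n * (\<alpha> + real b / real q))))"
    by (simp only: eq)
  also have "\<dots> \<le> (\<Sum>b<q. norm (h b) * T)"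
    by (intro sum_norm_le) (simp only: norm_mult mult_left_mono T norm_ge_zero)
  also have "\<dots> = (\<Sum>b<q. norm (h b)) * T" by (simp add: sum_distrib_right)
  also have "\<dots> \<le> (real q * sqrt (real q)) * T"
  proof (intro mult_right_mono T0)
    have "(\<Sum>b<q. norm (h b)) \<le> sqrt (real q * (\<Sum>b<q. (norm (h b))\<^sup>2))" by (rule sum_norm_le_sqrt)
    also have "(\<Sum>b<q. (norm (h b))\<^sup>2) = real q * (\<Sum>m\<in>{0..<int q}. (norm (chi m))\<^sup>2)"
      unfolding h_def by (rule exp_sum_parseval) (use q in auto)
    also have "sqrt (real q * \<dots>) \<le> sqrt (real q * (real q * (\<Sum>m\<in>{0..<int q}. 1)))"
      using le1 by (intro real_sqrt_le_mono mult_left_mono sum_mono) (auto simp: power_le_one)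
    also have "\<dots> = real q * sqrt (real q)" by (simp add: real_sqrt_mult)
    finally show "(\<Sum>b<q. norm (h b)) \<le> real q * sqrt (real q)" .
  qed
  finally have "real q * norm (\<Sum>n\<in>I. a n * chi n * unit_exp (of_int n * \<alpha>)) \<le> real q * (sqrt (real q) * T)"
    by (simp only: mult.assoc)
  thus ?thesis using q by simp
qed

section \<open>The additive energy of the squares\<close>

definition hyperbola_points :: "nat \<Rightarrow> (int \<times> int) set" where
  "hyperbola_points M = (SIGMA a:{- int M..int M}. {g \<in> {- int M..int M}. \<bar>a * g\<bar> \<le> int M})"

lemma finite_hyperbola_points [simp]: "finite (hyperbola_points M)"
proof -
  have "finite {g \<in> {- int M..int M}. \<bar>a * g\<bar> \<le> int M}" for a
    by (rule finite_subset[of _ "{- int M..int M}"]) auto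
  thus ?thesis unfolding hyperbola_points_def by (intro finite_SigmaI) simp
qed

lemma card_hyperbola_fibre:
  assumes "a \<noteq> 0"
  shows "real (card {g \<in> {- int M..int M}. \<bar>a * g\<bar> \<le> int M}) \<le> 2 * real M / \<bar>of_int a\<bar> + 1"
proof -
  define k where "k = int M div \<bar>a\<bar>"
  have ap: "\<bar>a\<bar> > 0" using assms by simp
  have k0: "k \<ge> 0" unfolding k_def using ap by (simp add: pos_imp_zdiv_nonneg_iff)
  have "{g \<in> {- int M..int M}. \<bar>a * g\<bar> \<le> int M} \<subseteq> {- k..k}"
  proof
    fix g assume "g \<in> {g \<in> {- int M..int M}. \<bar>a * g\<bar> \<le> int M}"
    hence "\<bar>g\<bar> * \<bar>a\<bar> \<le> int M" by (simp add: abs_mult mult.commute)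
    hence "(\<bar>g\<bar> * \<bar>a\<bar>) div \<bar>a\<bar> \<le> k" unfolding k_def using ap by (rule zdiv_mono1)
    hence "\<bar>g\<bar> \<le> k" using assms by simp
    thus "g \<in> {- k..k}" by auto
  qed
  hence "card {g \<in> {- int M..int M}. \<bar>a * g\<bar> \<le> int M} \<le> card {- k..k}" by (intro card_mono) auto
  also have "real \<dots> = 2 * of_int k + 1" using k0 by simp
  also have "of_int k \<le> real M / \<bar>of_int a\<bar>"
  proof -
    have "k * \<bar>a\<bar> \<le> int M" 
      using mult_div_mod_eq[of "\<bar>a\<bar>" "int M"] pos_mod_sign[OF ap, of "int M"]
      unfolding k_def mult.commute[of _ "\<bar>a\<bar>"] by linarith
    hence "of_int (k * \<bar>a\<bar>) \<le> real M" by linarith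
    thus ?thesis using ap by (simp add: pos_le_divide_eq)
  qed
  finally show ?thesis by simp
qed

lemma sum_symmetric_interval:
  fixes g :: "int \<Rightarrow> real"
  shows "(\<Sum>a\<in>{- int M..int M}. g a) = g 0 + (\<Sum>a\<in>{1..int M}. g a + g (- a))"
proof -
  have split: "{- int M..int M} = insert 0 ({1..int M} \<union> {- int M..-1})" by auto
  have "(\<Sum>a\<in>{- int M..int M}. g a) = g 0 + (\<Sum>a\<in>{1..int M} \<union> {- int M..-1}. g a)"
    unfolding split by (subst sum.insert) simp_all
  also have "(\<Sum>a\<in>{1..int M} \<union> {- int M..-1}. g a) = (\<Sum>a\<in>{1..int M}. g a) + (\<Sum>a\<in>{- int M..-1}. g a)"
    by (intro sum.union_disjoint) auto
  also have "(\<Sum>a\<in>{- int M..-1}. g a) = (\<Sum>a\<in>{1..int M}. g (- a))"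
    by (rule sum.reindex_bij_witness[of _ uminus uminus]) auto
  finally show ?thesis by (simp add: sum.distrib)
qed

text \<open>
  The divisor sum \<open>\<Sum>\<^sub>a M / a\<close>, with signs and the two coordinate axes.
\<close>

lemma card_hyperbola_points:
  assumes "M > 0"
  shows "real (card (hyperbola_points M)) \<le> 9 * real M * (1 + ln (real M))"
proof -
  define f where "f = (\<lambda>a. real (card {g \<in> {- int M..int M}. \<bar>a * g\<bar> \<le> int M}))"
  define b where "b = (\<lambda>a :: int. 2 * real M / \<bar>of_int a\<bar> + 1)"
  have fb: "f a \<le> b a" if "a \<noteq> 0" for a
    unfolding f_def b_def by (rule card_hyperbola_fibre[OF that])
  have "{g \<in> {- int M..int M}. \<bar>0 * g\<bar> \<le> int M} = {- int M..int M}" by auto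
  hence f0: "f 0 \<le> 2 * real M + 1" unfolding f_def by simp
  have "real (card (hyperbola_points M)) = (\<Sum>a\<in>{- int M..int M}. f a)"
  proof -
    have "finite {g \<in> {- int M..int M}. \<bar>a * g\<bar> \<le> int M}" for a
      by (rule finite_subset[of _ "{- int M..int M}"]) auto
    thus ?thesis unfolding hyperbola_points_def f_def by (subst card_SigmaI) simp_all
  qed
  also have "\<dots> = f 0 + (\<Sum>a\<in>{1..int M}. f a + f (- a))" by (rule sum_symmetric_interval)
  also have "\<dots> \<le> (2 * real M + 1) + (\<Sum>a\<in>{1..int M}. b a + b (- a))"
    by (intro add_mono sum_mono fb f0) auto
  also have "(\<Sum>a\<in>{1..int M}. b a + b (- a)) = (\<Sum>a\<in>{1..int M}. b a) + (\<Sum>a\<in>{1..int M}. b a)"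
  proof -
    have "b a + b (- a) = b a + b a" for a by (simp add: b_def)
    thus ?thesis by (simp only: sum.distrib)
  qed
  also have "(\<Sum>a\<in>{1..int M}. b a) = (\<Sum>j\<in>{1..M}. 2 * real M * (1 / real j) + 1)"
    by (rule sum.reindex_bij_witness[of _ int nat]) (auto simp: b_def)
  also have "\<dots> = 2 * real M * (\<Sum>j\<in>{1..M}. 1 / real j) + real M"
    by (simp add: sum.distrib sum_distrib_left)
  also have "(\<Sum>j\<in>{1..M}. 1 / real j) = 1 + (\<Sum>j\<in>{1<..M}. 1 / real j)"
  proof -
    have "{1..M} = insert 1 {1<..M}" using assms by auto
    thus ?thesis by simp
  qed
  also have "(2 * real M + 1) + ((2 * real M * (1 + (\<Sum>j\<in>{1<..M}. 1 / real j)) + real M)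
      + (2 * real M * (1 + (\<Sum>j\<in>{1<..M}. 1 / real j)) + real M)) \<le> 9 * real M * (1 + ln (real M))"
  proof -
    have "(\<Sum>j\<in>{1<..M}. 1 / real j) \<le> ln (real M)"
      using harmonic_segment_le_ln[of 1 M] assms by simp
    hence "real M * (1 + (\<Sum>j\<in>{1<..M}. 1 / real j)) \<le> real M * (1 + ln (real M))"
      by (intro mult_left_mono) simp_all
    moreover have "real M * 1 \<le> real M * (1 + ln (real M))"
      using assms by (intro mult_left_mono) simp_all
    moreover have "real M \<ge> 1" using assms by simp
    ultimately show ?thesis by linarith
  qed
  finally show ?thesis by simp
qed

definition equal_products :: "nat \<Rightarrow> ((int \<times> int) \<times> (int \<times> int)) set" where
  "equal_products M = {((u, v), (w, z)). u \<in> {- int M..int M} \<and> v \<in> {- int M..int M} \<and>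
      w \<in> {- int M..int M} \<and> z \<in> {- int M..int M} \<and> u * v = w * z}"

text \<open>
  The four number theorem: if \<open>u v = w z\<close> and \<open>g = gcd u w\<close>, then \<open>u = a g\<close> and \<open>w = b g\<close> with coprime \<open>a\<close>, \<open>b\<close>, so \<open>b\<close>
  divides \<open>v = b h\<close> and \<open>z = a h\<close>. Products that vanish are covered by choosing some parameters \<open>0\<close> or \<open>1\<close>.
  The constraints decouple into \<open>|a g| \<le> M\<close> and \<open>|b h| \<le> M\<close>.
\<close>

lemma equal_products_parametrization:
  "equal_products M \<subseteq>
     (\<lambda>((a, g), (b, h)). ((a * g, b * h), (b * g, a * h))) ` (hyperbola_points M \<times> hyperbola_points M)"
proof (rule subsetI, clarify)
  fix u v w z assume "((u, v), (w, z)) \<in> equal_products M"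
  hence bd: "\<bar>u\<bar> \<le> int M" "\<bar>v\<bar> \<le> int M" "\<bar>w\<bar> \<le> int M" "\<bar>z\<bar> \<le> int M" and eq: "u * v = w * z"
    by (auto simp: equal_products_def)
  have "\<exists>a g b h. u = a * g \<and> v = b * h \<and> w = b * g \<and> z = a * h \<and>
      \<bar>a\<bar> \<le> int M \<and> \<bar>g\<bar> \<le> int M \<and> \<bar>b\<bar> \<le> int M \<and> \<bar>h\<bar> \<le> int M"
  proof (cases "M = 0")
    case True
    hence "u = 0 * 0 \<and> v = 0 * 0 \<and> w = 0 * 0 \<and> z = 0 * 0 \<and>
          \<bar>0\<bar> \<le> int M \<and> \<bar>0\<bar> \<le> int M \<and> \<bar>0\<bar> \<le> int M \<and> \<bar>0\<bar> \<le> int M"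
      using bd by simp
    thus ?thesis by (intro exI)
  next
    case M: False
    show ?thesis
    proof (cases "u = 0 \<and> w = 0")
      case True
      hence "u = z * 0 \<and> v = v * 1 \<and> w = v * 0 \<and> z = z * 1 \<and>
          \<bar>z\<bar> \<le> int M \<and> \<bar>0\<bar> \<le> int M \<and> \<bar>v\<bar> \<le> int M \<and> \<bar>1\<bar> \<le> int M"
        using bd M by simp
      thus ?thesis by (intro exI)
    next
      case False
      define g where "g = gcd u w"
      have g: "g > 0" using False by (auto simp: g_def)
      obtain a b where ab: "u = a * g" "w = b * g" "coprime a b"
        using gcd_coprime_exists[of u w] g unfolding g_def by auto
      have ag: "\<bar>a\<bar> \<le> \<bar>u\<bar>" "\<bar>b\<bar> \<le> \<bar>w\<bar>" 
      proof -
        have "\<bar>a\<bar> * 1 \<le> \<bar>a\<bar> * g" "\<bar>b\<bar> * 1 \<le> \<bar>b\<bar> * g" using g by (intro mult_left_mono; simp)+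
        thus "\<bar>a\<bar> \<le> \<bar>u\<bar>" "\<bar>b\<bar> \<le> \<bar>w\<bar>" using g unfolding ab abs_mult by simp_all
      qed
      have gM: "\<bar>g\<bar> \<le> int M"
      proof (cases "u = 0")
        case True
        thus ?thesis using bd by (simp add: g_def)
      next
        case u: False
        have "g \<le> \<bar>u\<bar>" unfolding g_def using u by (intro zdvd_imp_le) auto
        thus ?thesis using bd g by linarith
      qed
      have avbz: "a * v = b * z" using eq g unfolding ab by (simp add: mult_ac)
      show ?thesis
      proof (cases "b = 0")
        case True
        hence a1: "\<bar>a\<bar> = 1" using ab(3) by simp
        have "a \<noteq> 0" using a1 by auto
        hence v0: "v = 0" using avbz True by simp
        have "a * a = \<bar>a\<bar> * \<bar>a\<bar>" by simp
        hence "a * (a * z) = z" unfolding mult.assoc[symmetric] a1 by simp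
        moreover have "\<bar>a * z\<bar> \<le> int M" using a1 bd by (simp add: abs_mult)
        moreover have "\<bar>a\<bar> \<le> int M" using a1 M by simp
        ultimately have "u = a * g \<and> v = b * (a * z) \<and> w = b * g \<and> z = a * (a * z) \<and>
            \<bar>a\<bar> \<le> int M \<and> \<bar>g\<bar> \<le> int M \<and> \<bar>b\<bar> \<le> int M \<and> \<bar>a * z\<bar> \<le> int M"
          using True ab(1,2) v0 gM by simp
        thus ?thesis by (intro exI)
      next
        case b: False
        have "b dvd a * v" unfolding avbz by simp
        hence "b dvd v" using ab(3) by (simp add: coprime_commute coprime_dvd_mult_right_iff)
        then obtain h where h: "v = b * h" ..
        have "b * (a * h) = b * z" using avbz unfolding h by (simp add: mult.left_commute)
        hence z: "z = a * h" using b by simp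
        have "1 * \<bar>h\<bar> \<le> \<bar>b\<bar> * \<bar>h\<bar>" using b by (intro mult_right_mono) auto
        hence "\<bar>h\<bar> \<le> \<bar>v\<bar>" unfolding h abs_mult by simp
        hence "u = a * g \<and> v = b * h \<and> w = b * g \<and> z = a * h \<and>
            \<bar>a\<bar> \<le> int M \<and> \<bar>g\<bar> \<le> int M \<and> \<bar>b\<bar> \<le> int M \<and> \<bar>h\<bar> \<le> int M"
          using ab(1,2) h z gM bd ag by linarith
        thus ?thesis by (intro exI)
      qed
    qed
  qed
  then obtain a g b h where *: "u = a * g" "v = b * h" "w = b * g" "z = a * h"
      "\<bar>a\<bar> \<le> int M" "\<bar>g\<bar> \<le> int M" "\<bar>b\<bar> \<le> int M" "\<bar>h\<bar> \<le> int M"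
    by (elim exE conjE) (rule that)
  hence "(a, g) \<in> hyperbola_points M" "(b, h) \<in> hyperbola_points M"
    using bd by (auto simp: hyperbola_points_def)
  thus "((u, v), (w, z)) \<in> (\<lambda>((a, g), (b, h)). ((a * g, b * h), (b * g, a * h))) ` (hyperbola_points M \<times> hyperbola_points M)"
    unfolding * by (intro image_eqI[of _ _ "((a, g), (b, h))"]) auto
qed

lemma card_equal_products: "card (equal_products M) \<le> (card (hyperbola_points M))\<^sup>2"
proof -
  have "card (equal_products M) \<le> card ((\<lambda>((a, g), (b, h)). ((a * g, b * h), (b * g, a * h))) ` (hyperbola_points M \<times> hyperbola_points M))"
    by (intro card_mono equal_products_parametrization) auto
  also have "\<dots> \<le> card (hyperbola_points M \<times> hyperbola_points M)" by (intro card_image_le) auto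
  finally show ?thesis by (simp add: power2_eq_square card_cartesian_product)
qed

definition square_energy :: "nat \<Rightarrow> nat" where
  "square_energy H = card {((a, b), (c, d)) | a b c d. a \<in> {- int H..int H} \<and> b \<in> {- int H..int H} \<and>
      c \<in> {- int H..int H} \<and> d \<in> {- int H..int H} \<and> a\<^sup>2 + b\<^sup>2 = c\<^sup>2 + d\<^sup>2}"

text \<open>
  \<open>a\<^sup>2 + b\<^sup>2 = c\<^sup>2 + d\<^sup>2\<close> says \<open>(a - c) (a + c) = (d - b) (d + b)\<close>.
\<close>

lemma square_energy_le: "square_energy H \<le> card (equal_products (2 * H))"
  unfolding square_energy_def
proof (rule card_inj_on_le)
  let ?\<phi> = "\<lambda>((a, b), (c, d)). ((a - c, a + c), (d - b, d + b)) :: (int \<times> int) \<times> (int \<times> int)"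
  let ?S = "{((a, b), (c, d)) | a b c d. a \<in> {- int H..int H} \<and> b \<in> {- int H..int H} \<and>
      c \<in> {- int H..int H} \<and> d \<in> {- int H..int H} \<and> a\<^sup>2 + b\<^sup>2 = c\<^sup>2 + d\<^sup>2}"
  show "inj_on ?\<phi> ?S" by (auto simp: inj_on_def)
  show "?\<phi> ` ?S \<subseteq> equal_products (2 * H)"
    by (auto simp: equal_products_def power2_eq_square algebra_simps)
  show "finite (equal_products (2 * H))"
    by (rule finite_subset[OF equal_products_parametrization]) auto
qed

lemma square_energy_bound:
  assumes "H > 0"
  shows "real (square_energy H) \<le> (18 * real H * (1 + ln (2 * real H)))\<^sup>2"
proof -
  have "real (square_energy H) \<le> real ((card (hyperbola_points (2 * H)))\<^sup>2)"
    using square_energy_le[of H] card_equal_products[of "2 * H"] by linarith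
  also have "\<dots> = (real (card (hyperbola_points (2 * H))))\<^sup>2" by simp
  also have "\<dots> \<le> (9 * real (2 * H) * (1 + ln (real (2 * H))))\<^sup>2"
    using assms by (intro power_mono card_hyperbola_points) auto
  finally show ?thesis by simp
qed

section \<open>The discrete circle method\<close>

definition theta_sum :: "nat \<Rightarrow> nat \<Rightarrow> nat \<Rightarrow> complex" where
  "theta_sum H Q j = (\<Sum>m\<in>{- int H..int H}. unit_exp (of_int (m\<^sup>2) * real j / real Q))"

lemma theta_sum_trivial: "norm (theta_sum H Q j) \<le> 2 * real H + 1"
proof -
  have "norm (theta_sum H Q j) \<le> (\<Sum>m\<in>{- int H..int H}. 1)"
    unfolding theta_sum_def by (rule sum_norm_le) simp
  thus ?thesis by simp
qed

lemma square_in_range: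
  fixes m :: int
  assumes "m \<in> {- int H..int H}"
  shows "0 \<le> m\<^sup>2" "m\<^sup>2 \<le> int (H\<^sup>2)"
proof -
  have "\<bar>m\<bar>\<^sup>2 \<le> (int H)\<^sup>2" using assms by (intro power_mono) auto
  thus "m\<^sup>2 \<le> int (H\<^sup>2)" by simp
qed simp

text \<open>
  \<open>\<theta>\<^sup>2\<close> is an exponential sum over pairs with phase \<open>a\<^sup>2 + b\<^sup>2\<close>; since \<open>Q > 2 H\<^sup>2\<close>, orthogonality modulo \<open>Q\<close>
  detects equality of these phases and not only congruence.
\<close>

lemma theta_fourth_moment:
  assumes Q: "Q > 2 * H\<^sup>2"
  shows "(\<Sum>j<Q. norm (theta_sum H Q j) ^ 4) = real Q * real (square_energy H)"
proof -
  let ?I = "{- int H..int H}"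
  let ?s = "\<lambda>x :: int \<times> int. (fst x)\<^sup>2 + (snd x)\<^sup>2"
  have sq: "(theta_sum H Q j)\<^sup>2 = (\<Sum>x\<in>?I \<times> ?I. 1 * unit_exp (of_int (?s x) * real j / real Q))" for j
    unfolding theta_sum_def power2_eq_square[of "sum _ _"] sum_product sum.cartesian_product
    by (intro sum.cong refl) (auto simp: unit_exp_add[symmetric] add_divide_distrib distrib_right)
  have cnj_sq: "cnj ((theta_sum H Q j)\<^sup>2) = (\<Sum>x\<in>?I \<times> ?I. 1 * unit_exp (- of_int (?s x) * real j / real Q))" for j
    unfolding sq cnj_sum
    by (simp only: complex_cnj_mult complex_cnj_one cnj_unit_exp minus_divide_left minus_mult_left)
  have small: "\<bar>?s x - ?s y\<bar> < int Q" if "x \<in> ?I \<times> ?I" "y \<in> ?I \<times> ?I" for x y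
  proof -
    have "0 \<le> (fst x)\<^sup>2" "(fst x)\<^sup>2 \<le> int (H\<^sup>2)" "0 \<le> (snd x)\<^sup>2" "(snd x)\<^sup>2 \<le> int (H\<^sup>2)"
      "0 \<le> (fst y)\<^sup>2" "(fst y)\<^sup>2 \<le> int (H\<^sup>2)" "0 \<le> (snd y)\<^sup>2" "(snd y)\<^sup>2 \<le> int (H\<^sup>2)"
      using that by (auto intro!: square_in_range simp del: of_nat_power)
    thus ?thesis using Q by linarith
  qed
  have "complex_of_real (\<Sum>j<Q. norm (theta_sum H Q j) ^ 4)
      = (\<Sum>j<Q. (theta_sum H Q j)\<^sup>2 * cnj ((theta_sum H Q j)\<^sup>2))"
  proof -
    have "norm w ^ 4 = (norm (w\<^sup>2))\<^sup>2" for w :: complex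
      by (simp add: norm_power power_mult[symmetric])
    thus ?thesis unfolding of_real_sum by (simp only: complex_norm_square)
  qed
  also have "\<dots> = of_nat Q * (\<Sum>x\<in>?I \<times> ?I. \<Sum>y\<in>?I \<times> ?I. if ?s x = ?s y then 1 * 1 else 0)"
    unfolding cnj_sq unfolding sq by (rule exp_sum_orthogonality_exact[OF small]) (use Q in auto)
  also have "(\<Sum>x\<in>?I \<times> ?I. \<Sum>y\<in>?I \<times> ?I. if ?s x = ?s y then 1 * 1 else 0) = (of_nat (square_energy H) :: complex)"
  proof -
    have "(\<Sum>x\<in>?I \<times> ?I. \<Sum>y\<in>?I \<times> ?I. if ?s x = ?s y then 1 * 1 else (0::complex))
        = (\<Sum>p\<in>(?I \<times> ?I) \<times> (?I \<times> ?I). if ?s (fst p) = ?s (snd p) then 1 else 0)"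
      unfolding sum.cartesian_product by (intro sum.cong refl) auto
    also have "\<dots> = of_nat (card {p \<in> (?I \<times> ?I) \<times> (?I \<times> ?I). ?s (fst p) = ?s (snd p)})"
      by (subst sum.inter_filter[symmetric]) auto
    also have "{p \<in> (?I \<times> ?I) \<times> (?I \<times> ?I). ?s (fst p) = ?s (snd p)}
       = {((a, b), (c, d)) | a b c d. a \<in> ?I \<and> b \<in> ?I \<and> c \<in> ?I \<and> d \<in> ?I \<and> a\<^sup>2 + b\<^sup>2 = c\<^sup>2 + d\<^sup>2}"
      by auto
    finally show ?thesis by (simp only: square_energy_def)
  qed
  finally have "complex_of_real (\<Sum>j<Q. norm (theta_sum H Q j) ^ 4) = complex_of_real (real Q * real (square_energy H))"
    by simp
  thus ?thesis unfolding of_real_eq_iff .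
qed

definition box_lists :: "nat \<Rightarrow> nat \<Rightarrow> int list set" where
  "box_lists H l = {v. set v \<subseteq> {- int H..int H} \<and> length v = l}"

lemma finite_box_lists [simp]: "finite (box_lists H l)"
  unfolding box_lists_def by (rule finite_lists_length_eq) simp

text \<open>
  The \<open>l\<close>-th power generates lists of length \<open>l\<close> weighted by the sum of squares, the objects counted by
  \<open>num_sum_squares\<close>.
\<close>

lemma theta_sum_power:
  "theta_sum H Q j ^ l = (\<Sum>v\<in>box_lists H l. unit_exp (of_int (\<Sum>x\<leftarrow>v. x\<^sup>2) * real j / real Q))"
proof (induction l)
  case 0
  have "box_lists H 0 = {[]}" by (auto simp: box_lists_def)
  thus ?case by simp
next
  case (Suc l)
  have eq: "box_lists H (Suc l) = (\<lambda>(v, m). m # v) ` (box_lists H l \<times> {- int H..int H})"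
    unfolding box_lists_def by (rule lists_length_Suc_eq)
  have inj: "inj_on (\<lambda>(v, m). m # v) (box_lists H l \<times> {- int H..int H})"
    by (auto simp: inj_on_def)
  have "theta_sum H Q j ^ Suc l = theta_sum H Q j ^ l * theta_sum H Q j" by (simp add: mult.commute)
  also have "\<dots> = (\<Sum>(v, m)\<in>box_lists H l \<times> {- int H..int H}.
      unit_exp (of_int (\<Sum>x\<leftarrow>v. x\<^sup>2) * real j / real Q) * unit_exp (of_int (m\<^sup>2) * real j / real Q))"
    unfolding Suc unfolding theta_sum_def sum_product sum.cartesian_product ..
  also have "\<dots> = (\<Sum>(v, m)\<in>box_lists H l \<times> {- int H..int H}.
      unit_exp (of_int (\<Sum>x\<leftarrow>m # v. x\<^sup>2) * real j / real Q))"
    by (intro sum.cong refl) (auto simp: unit_exp_add[symmetric] add_divide_distrib distrib_right add.commute)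
  also have "\<dots> = (\<Sum>v\<in>box_lists H (Suc l). unit_exp (of_int (\<Sum>x\<leftarrow>v. x\<^sup>2) * real j / real Q))"
    unfolding eq by (subst sum.reindex[OF inj]) (simp add: case_prod_beta')
  finally show ?case .
qed

lemma sum_list_squares_range:
  assumes "v \<in> box_lists H l"
  shows "0 \<le> (\<Sum>x\<leftarrow>v. x\<^sup>2)" "(\<Sum>x\<leftarrow>v. x\<^sup>2) \<le> int (l * H\<^sup>2)"
proof -
  have "0 \<le> (\<Sum>x\<leftarrow>v. x\<^sup>2) \<and> (\<Sum>x\<leftarrow>v. x\<^sup>2) \<le> int (length v * H\<^sup>2)" if "set v \<subseteq> {- int H..int H}" for v
    using that
  proof (induction v)
    case (Cons m v)
    thus ?case using square_in_range[of m H] by (auto simp: algebra_simps)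
  qed simp
  thus "0 \<le> (\<Sum>x\<leftarrow>v. x\<^sup>2)" "(\<Sum>x\<leftarrow>v. x\<^sup>2) \<le> int (l * H\<^sup>2)"
    using assms by (auto simp: box_lists_def)
qed

lemma num_sum_squares_box:
  assumes "n < int ((H + 1)\<^sup>2)"
  shows "num_sum_squares l n = card {v \<in> box_lists H l. (\<Sum>x\<leftarrow>v. x\<^sup>2) = n}"
proof -
  have "set v \<subseteq> {- int H..int H}" if v: "(\<Sum>x\<leftarrow>v. x\<^sup>2) = n" for v :: "int list"
  proof
    fix m assume m: "m \<in> set v"
    have "m\<^sup>2 \<le> (\<Sum>x\<leftarrow>v. x\<^sup>2)" using m by (intro member_le_sum_list) auto
    hence "\<bar>m\<bar>\<^sup>2 < (int H + 1)\<^sup>2" using v assms by (simp add: algebra_simps)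
    hence "\<bar>m\<bar> < int H + 1" by (rule power2_less_imp_less) simp
    thus "m \<in> {- int H..int H}" by auto
  qed
  hence "{v :: int list. length v = l \<and> (\<Sum>x\<leftarrow>v. x\<^sup>2) = n} = {v \<in> box_lists H l. (\<Sum>x\<leftarrow>v. x\<^sup>2) = n}"
    by (auto simp: box_lists_def)
  thus ?thesis by (simp add: num_sum_squares_def)
qed

lemma circle_method_identity:
  fixes b :: "int \<Rightarrow> complex"
  assumes H: "N < int ((H + 1)\<^sup>2)" and Q: "Q > l * H\<^sup>2 + nat N"
  shows "of_nat Q * (\<Sum>n\<in>{1..N}. b n * of_nat (num_sum_squares l n))
     = (\<Sum>j<Q. theta_sum H Q j ^ l * (\<Sum>n\<in>{1..N}. b n * unit_exp (- of_int n * real j / real Q)))"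
proof -
  let ?s = "\<lambda>v :: int list. \<Sum>x\<leftarrow>v. x\<^sup>2"
  have small: "\<bar>?s v - n\<bar> < int Q" if "v \<in> box_lists H l" "n \<in> {1..N}" for v n
  proof -
    have "int (l * H\<^sup>2 + nat N) < int Q" using Q by (simp only: of_nat_less_iff)
    hence "int (l * H\<^sup>2) + N < int Q" using that(2) by (simp only: of_nat_add)
    thus ?thesis using sum_list_squares_range[OF that(1)] that(2) by auto
  qed
  have "(\<Sum>j<Q. theta_sum H Q j ^ l * (\<Sum>n\<in>{1..N}. b n * unit_exp (- of_int n * real j / real Q)))
     = (\<Sum>j<Q. (\<Sum>v\<in>box_lists H l. 1 * unit_exp (of_int (?s v) * real j / real Q)) *
          (\<Sum>n\<in>{1..N}. b n * unit_exp (- of_int n * real j / real Q)))"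
    unfolding theta_sum_power by simp
  also have "\<dots> = of_nat Q * (\<Sum>v\<in>box_lists H l. \<Sum>n\<in>{1..N}. if ?s v = n then 1 * b n else 0)"
    by (rule exp_sum_orthogonality_exact[OF small]) (use Q in auto)
  also have "(\<Sum>v\<in>box_lists H l. \<Sum>n\<in>{1..N}. if ?s v = n then 1 * b n else 0)
      = (\<Sum>n\<in>{1..N}. \<Sum>v\<in>box_lists H l. if ?s v = n then b n else 0)"
    by (subst sum.swap) (simp only: mult_1_left)
  also have "\<dots> = (\<Sum>n\<in>{1..N}. b n * of_nat (num_sum_squares l n))"
  proof (intro sum.cong refl)
    fix n assume n: "n \<in> {1..N}"
    have "(\<Sum>v\<in>box_lists H l. if ?s v = n then b n else 0) = (\<Sum>v\<in>{v \<in> box_lists H l. ?s v = n}. b n)"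
      by (rule sum.inter_filter[symmetric]) simp
    also have "\<dots> = b n * of_nat (num_sum_squares l n)"
      using num_sum_squares_box[of n H l] n H by simp
    finally show "(\<Sum>v\<in>box_lists H l. if ?s v = n then b n else 0) = b n * of_nat (num_sum_squares l n)" .
  qed
  finally show ?thesis by simp
qed

text \<open>
  For \<open>l = 3\<close> the supremum of \<open>S\<close> times the third moment of \<open>\<theta>\<close> would be of size \<open>p\<^sup>1\<^sup>/\<^sup>2 X\<^sup>5\<^sup>/\<^sup>4\<close>, too large when
  \<open>p\<close> is close to \<open>X\<close>. Cauchy-Schwarz interpolates instead between the means of \<open>|\<theta>|\<^sup>4 |S|\<close>, where the supremum
  of \<open>S\<close> is used, and of \<open>|\<theta>|\<^sup>2 |S|\<close>, where its second moment is used.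
\<close>

lemma circle_method_bounds:
  fixes b :: "int \<Rightarrow> complex" and N :: int and H :: nat and T :: real
  defines "E \<equiv> real (square_energy H)" and "V \<equiv> (\<Sum>n\<in>{1..N}. (norm (b n))\<^sup>2)"
  assumes H: "N < int ((H + 1)\<^sup>2)"
    and T: "\<And>\<alpha>. norm (\<Sum>n\<in>{1..N}. b n * unit_exp (of_int n * \<alpha>)) \<le> T"
  shows "l \<ge> 4 \<Longrightarrow> norm (\<Sum>n\<in>{1..N}. b n * of_nat (num_sum_squares l n)) \<le> T * (2 * real H + 1) ^ (l - 4) * E"
    and "norm (\<Sum>n\<in>{1..N}. b n * of_nat (num_sum_squares 3 n)) \<le> sqrt (T * E * sqrt (E * V))"
proof -
  \<comment> \<open>large enough for the identity with \<open>l\<close> squares and for the fourth moment of \<open>\<theta>\<close>\<close>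
  define Q where "Q = (\<lambda>l. l * H\<^sup>2 + nat N + 2 * H\<^sup>2 + 1)"
  define S where "S = (\<lambda>Q j. \<Sum>n\<in>{1..N}. b n * unit_exp (- of_int n * real j / real Q))"
  have T0: "T \<ge> 0" using order_trans[OF norm_ge_zero T[of 0]] .
  have E0: "E \<ge> 0" by (simp add: E_def)
  have V0: "V \<ge> 0" by (simp add: V_def sum_nonneg)
  have ST: "norm (S Q j) \<le> T" for Q j
    using T[of "- (real j / real Q)"] by (simp add: S_def)
  have Q: "Q l > 0" "Q l > 2 * H\<^sup>2" "Q l > l * H\<^sup>2 + nat N" for l
    by (simp_all add: Q_def)
  have main: "real (Q l) * norm (\<Sum>n\<in>{1..N}. b n * of_nat (num_sum_squares l n))
     \<le> (\<Sum>j<Q l. norm (theta_sum H (Q l) j) ^ l * norm (S (Q l) j))" for l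
  proof -
    have "real (Q l) * norm (\<Sum>n\<in>{1..N}. b n * of_nat (num_sum_squares l n))
        = norm (of_nat (Q l) * (\<Sum>n\<in>{1..N}. b n * of_nat (num_sum_squares l n)))"
      by (simp only: norm_mult norm_of_nat)
    also have "\<dots> = norm (\<Sum>j<Q l. theta_sum H (Q l) j ^ l * S (Q l) j)"
      unfolding S_def by (simp only: circle_method_identity[OF H Q(3)])
    also have "\<dots> \<le> (\<Sum>j<Q l. norm (theta_sum H (Q l) j) ^ l * norm (S (Q l) j))"
      by (intro sum_norm_le) (simp only: norm_mult norm_power order_refl)
    finally show ?thesis .
  qed
  have fourth: "(\<Sum>j<Q l. norm (theta_sum H (Q l) j) ^ 4) = real (Q l) * E" for l
    unfolding E_def by (rule theta_fourth_moment[OF Q(2)])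
  show "norm (\<Sum>n\<in>{1..N}. b n * of_nat (num_sum_squares l n)) \<le> T * (2 * real H + 1) ^ (l - 4) * E"
    if l: "l \<ge> 4"
  proof -
    have "(\<Sum>j<Q l. norm (theta_sum H (Q l) j) ^ l * norm (S (Q l) j))
       \<le> (\<Sum>j<Q l. norm (theta_sum H (Q l) j) ^ 4 * (T * (2 * real H + 1) ^ (l - 4)))"
    proof (rule sum_mono)
      fix j
      let ?t = "norm (theta_sum H (Q l) j)"
      have "?t ^ l * norm (S (Q l) j) = ?t ^ 4 * (norm (S (Q l) j) * ?t ^ (l - 4))"
        using l by (simp add: power_add[symmetric] mult.left_commute[of "norm (S (Q l) j)"])
      also have "\<dots> \<le> ?t ^ 4 * (T * (2 * real H + 1) ^ (l - 4))"
        by (intro mult_left_mono mult_mono ST power_mono theta_sum_trivial) (simp_all add: T0)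
      finally show "?t ^ l * norm (S (Q l) j) \<le> ?t ^ 4 * (T * (2 * real H + 1) ^ (l - 4))" .
    qed
    also have "\<dots> = real (Q l) * (T * (2 * real H + 1) ^ (l - 4) * E)"
      unfolding sum_distrib_right[symmetric] fourth by (simp only: mult_ac)
    finally have "real (Q l) * norm (\<Sum>n\<in>{1..N}. b n * of_nat (num_sum_squares l n))
        \<le> real (Q l) * (T * (2 * real H + 1) ^ (l - 4) * E)"
      using main[of l] by linarith
    thus ?thesis by (rule mult_left_le_imp_le) (simp add: Q)
  qed
  show "norm (\<Sum>n\<in>{1..N}. b n * of_nat (num_sum_squares 3 n)) \<le> sqrt (T * E * sqrt (E * V))"
  proof -
    define t where "t = (\<lambda>j. norm (theta_sum H (Q 3) j))"
    define s where "s = (\<lambda>j. norm (S (Q 3) j))"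
    define q where "q = real (Q 3)"
    have q: "q > 0" using Q(1)[of 3] by (simp add: q_def)
    have s0: "s j \<ge> 0" for j by (simp add: s_def)
    have t0: "t j \<ge> 0" for j by (simp add: t_def)
    have t4: "(\<Sum>j<Q 3. t j ^ 4) = q * E" unfolding t_def q_def by (rule fourth)
    have s2: "(\<Sum>j<Q 3. (s j)\<^sup>2) = q * V"
      unfolding s_def q_def V_def S_def
    proof (rule exp_sum_parseval[OF _ _ Q(1)])
      fix m n assume mn: "m \<in> {1..N}" "n \<in> {1..N}"
      define h where "h = (int H)\<^sup>2"
      have "h \<ge> 0" by (simp add: h_def)
      moreover have "int (Q 3) = 1 + 5 * h + N" using mn by (simp add: Q_def h_def)
      ultimately show "\<bar>m - n\<bar> < int (Q 3)" using mn by auto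
    qed simp
    have A: "(\<Sum>j<Q 3. t j ^ 4 * s j) \<le> q * (T * E)"
    proof -
      have "(\<Sum>j<Q 3. t j ^ 4 * s j) \<le> (\<Sum>j<Q 3. t j ^ 4 * T)"
        by (intro sum_mono mult_left_mono) (simp_all add: s_def ST)
      also have "\<dots> = q * (T * E)"
        unfolding sum_distrib_right[symmetric] t4 by (simp only: mult_ac)
      finally show ?thesis .
    qed
    have Bd: "(\<Sum>j<Q 3. (t j)\<^sup>2 * s j) \<le> q * sqrt (E * V)"
    proof -
      have "(\<Sum>j<Q 3. (t j)\<^sup>2 * s j)\<^sup>2 \<le> (\<Sum>j<Q 3. ((t j)\<^sup>2)\<^sup>2) * (\<Sum>j<Q 3. (s j)\<^sup>2)"
        by (rule Cauchy_Schwarz_ineq_sum)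
      also have "(\<Sum>j<Q 3. ((t j)\<^sup>2)\<^sup>2) = q * E" unfolding t4[symmetric] by simp
      also have "q * E * (\<Sum>j<Q 3. (s j)\<^sup>2) = q\<^sup>2 * (E * V)"
        unfolding s2 by (simp add: power2_eq_square)
      finally have "(\<Sum>j<Q 3. (t j)\<^sup>2 * s j) \<le> sqrt (q\<^sup>2 * (E * V))" by (rule real_le_rsqrt)
      thus ?thesis using q by (simp add: real_sqrt_mult)
    qed
    have "(\<Sum>j<Q 3. t j ^ 3 * s j)\<^sup>2 = (\<Sum>j<Q 3. ((t j)\<^sup>2 * sqrt (s j)) * (t j * sqrt (s j)))\<^sup>2"
    proof -
      have "t j ^ 3 * s j = ((t j)\<^sup>2 * sqrt (s j)) * (t j * sqrt (s j))" for j
      proof -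
        have "s j = sqrt (s j) * sqrt (s j)" using s0[of j] by simp
        thus ?thesis by (simp add: power2_eq_square power3_eq_cube)
      qed
      thus ?thesis by (simp only:)
    qed
    also have "\<dots> \<le> (\<Sum>j<Q 3. ((t j)\<^sup>2 * sqrt (s j))\<^sup>2) * (\<Sum>j<Q 3. (t j * sqrt (s j))\<^sup>2)"
      by (rule Cauchy_Schwarz_ineq_sum)
    also have "(\<Sum>j<Q 3. ((t j)\<^sup>2 * sqrt (s j))\<^sup>2) = (\<Sum>j<Q 3. t j ^ 4 * s j)"
      using s0 by (simp add: power_mult_distrib)
    also have "(\<Sum>j<Q 3. (t j * sqrt (s j))\<^sup>2) = (\<Sum>j<Q 3. (t j)\<^sup>2 * s j)"
      using s0 by (simp add: power_mult_distrib)
    also have "(\<Sum>j<Q 3. t j ^ 4 * s j) * (\<Sum>j<Q 3. (t j)\<^sup>2 * s j) \<le> (q * (T * E)) * (q * sqrt (E * V))"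
      using q T0 E0 s0 t0 by (intro mult_mono A Bd sum_nonneg) simp_all
    also have "\<dots> = q\<^sup>2 * (T * E * sqrt (E * V))" by (simp only: power2_eq_square mult_ac)
    finally have "(\<Sum>j<Q 3. t j ^ 3 * s j) \<le> sqrt (q\<^sup>2 * (T * E * sqrt (E * V)))" by (rule real_le_rsqrt)
    also have "\<dots> = q * sqrt (T * E * sqrt (E * V))" using q by (simp add: real_sqrt_mult)
    finally have "q * norm (\<Sum>n\<in>{1..N}. b n * of_nat (num_sum_squares 3 n)) \<le> q * sqrt (T * E * sqrt (E * V))"
      using main[of 3] unfolding t_def s_def q_def by linarith
    thus ?thesis using q by (rule mult_left_le_imp_le)
  qed
qed

section \<open>The bound for the twisted sum\<close>

lemma floor_sqrt_facts:
  assumes X: "X \<ge> 1"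
  defines "H \<equiv> nat \<lfloor>sqrt X\<rfloor>"
  shows "H > 0" "real H \<le> sqrt X" "\<lfloor>X\<rfloor> < int ((H + 1)\<^sup>2)"
proof -
  have s1: "sqrt X \<ge> 1" using X by simp
  show "H > 0" unfolding H_def using s1 by (simp add: zero_less_nat_eq le_floor_iff)
  show le: "real H \<le> sqrt X" unfolding H_def using s1 by simp
  have "sqrt X < real (H + 1)" unfolding H_def using s1 by linarith
  hence "(sqrt X)\<^sup>2 < (real (H + 1))\<^sup>2" using s1 by (intro power_strict_mono) auto
  hence "X < real_of_int (int ((H + 1)\<^sup>2))" using X by simp
  thus "\<lfloor>X\<rfloor> < int ((H + 1)\<^sup>2)" by (simp only: floor_less_iff)
qed

lemma square_energy_power_bound:
  assumes \<delta>: "\<delta> > 0"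
  shows "\<exists>C\<ge>0. \<forall>X\<ge>1. real (square_energy (nat \<lfloor>sqrt X\<rfloor>)) \<le> C * X powr (1 + \<delta>)"
proof -
  define K where "K = 2 + 2 / \<delta>"
  have K0: "K \<ge> 0" using \<delta> by (simp add: K_def)
  have "real (square_energy (nat \<lfloor>sqrt X\<rfloor>)) \<le> (18 * K)\<^sup>2 * X powr (1 + \<delta>)" if X: "X \<ge> 1" for X
  proof -
    define H where "H = nat \<lfloor>sqrt X\<rfloor>"
    have H: "H > 0" "real H \<le> sqrt X" using floor_sqrt_facts[OF X] by (simp_all add: H_def)
    have "ln (2 * real H) \<le> ln (2 * sqrt X)"
      using H X by (subst ln_le_cancel_iff) simp_all
    also have "\<dots> = ln 2 + ln X / 2" using X by (simp add: ln_mult ln_sqrt)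
    also have "\<dots> \<le> 1 + ln X"
    proof -
      have "ln X \<ge> 0" using X by simp
      thus ?thesis using ln_2_less_1 by linarith
    qed
    finally have "1 + ln (2 * real H) \<le> 2 + ln X" by simp
    also have "\<dots> \<le> 2 * X powr (\<delta> / 2) + X powr (\<delta> / 2) / (\<delta> / 2)"
      using X \<delta> by (intro add_mono ln_powr_bound) (simp_all add: ge_one_powr_ge_zero)
    also have "\<dots> = K * X powr (\<delta> / 2)" using \<delta> by (simp add: K_def field_simps)
    finally have l: "1 + ln (2 * real H) \<le> K * X powr (\<delta> / 2)" .
    have l0: "0 \<le> 1 + ln (2 * real H)" using H by simp
    have "real (square_energy H) \<le> (18 * real H * (1 + ln (2 * real H)))\<^sup>2"
      by (rule square_energy_bound[OF H(1)])
    also have "\<dots> \<le> (18 * sqrt X * (K * X powr (\<delta> / 2)))\<^sup>2"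
      using H l l0 X by (intro power_mono mult_mono) simp_all
    also have "\<dots> = (18 * K)\<^sup>2 * ((sqrt X)\<^sup>2 * (X powr (\<delta> / 2))\<^sup>2)"
      by (simp only: power_mult_distrib mult_ac)
    also have "(sqrt X)\<^sup>2 * (X powr (\<delta> / 2))\<^sup>2 = X powr (1 + \<delta>)"
    proof -
      have "(sqrt X)\<^sup>2 = X powr 1" using X by simp
      moreover have "(X powr (\<delta> / 2))\<^sup>2 = X powr \<delta>"
        unfolding power2_eq_square powr_add[symmetric] by simp
      ultimately show ?thesis by (simp only: powr_add)
    qed
    finally show ?thesis by (simp only: H_def)
  qed
  thus ?thesis by (intro exI[of _ "(18 * K)\<^sup>2"] conjI allI impI) simp_all
qed

text \<open>
  A saving \<open>(p/X)\<^sup>s\<close> is stronger than \<open>(p/X)\<^sup>e\<close> whenever \<open>p \<le> X\<close> and \<open>e \<le> s\<close>.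
\<close>

lemma trade_conductor_power:
  fixes p X A s e :: real
  assumes "0 < p" "p \<le> X" "e \<le> s"
  shows "p powr s * X powr (A - s) \<le> p powr e * X powr (A - e)"
proof -
  have "p powr s * X powr (A - s) = p powr e * (p powr (s - e) * X powr (A - s))"
    using assms by (simp add: mult.assoc[symmetric] flip: powr_add)
  also have "\<dots> \<le> p powr e * (X powr (s - e) * X powr (A - s))"
    using assms by (intro mult_left_mono mult_right_mono powr_mono2) simp_all
  also have "X powr (s - e) * X powr (A - s) = X powr (A - e)"
    by (simp flip: powr_add)
  finally show ?thesis .
qed

text \<open>
  The losses \<open>X\<^sup>\<delta>\<close> in the Wilton bound and in the energy add up to \<open>X\<^sup>2\<^sup>\<delta>\<close> for \<open>l \<ge> 4\<close> and to less for \<open>l = 3\<close>; hence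
  \<open>\<delta> = \<epsilon> / 2\<close>.
\<close>

lemma sum_of_squares_twist_bound:
  assumes fam: "bounded_fourier_family lam W B" and W: "regular_weight W a m L"
    and l: "l \<ge> 3" and eps: "\<epsilon> > 0"
  shows "\<exists>C. \<forall>p chi X. dirichlet_character p chi \<longrightarrow> real p < X \<longrightarrow>
           norm (\<Sum>n = 1..\<lfloor>X\<rfloor>. lam n * of_nat (num_sum_squares l n) * chi n)
             \<le> C * real p powr ((real l - 2) / (2 * real l + 1))
                 * X powr (real l / 2 - (real l - 2) / (2 * real l + 1) + \<epsilon>)"
proof -
  define \<delta> where "\<delta> = \<epsilon> / 2"
  have \<delta>: "\<delta> > 0" using eps by (simp add: \<delta>_def)
  define e where "e = (real l - 2) / (2 * real l + 1)"
  obtain C1 where C1: "C1 \<ge> 0" "\<forall>X\<ge>1. \<forall>\<alpha>.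
      norm (\<Sum>n\<in>{1..\<lfloor>X\<rfloor>}. lam n * unit_exp (of_int n * \<alpha>)) \<le> C1 * X powr (1/2 + \<delta>)"
    using wilton_bound[OF fam W \<delta>] by (elim exE conjE) (rule that)
  obtain C2 where C2: "C2 \<ge> 0" "\<forall>X\<ge>1.
      real (square_energy (nat \<lfloor>sqrt X\<rfloor>)) \<le> C2 * X powr (1 + \<delta>)"
    using square_energy_power_bound[OF \<delta>] by (elim exE conjE) (rule that)
  obtain C3 where C3: "C3 \<ge> 0" "\<forall>X\<ge>1.
      (\<Sum>n\<in>{1..\<lfloor>X\<rfloor>}. (norm (lam n))\<^sup>2) \<le> C3 * X"
    using second_moment_bound[OF fam W] by (elim exE conjE) (rule that)
  define C where "C = (if l = 3 then sqrt (C1 * C2 * sqrt (C2 * C3)) else C1 * 3 ^ (l - 4) * C2)"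
  have C0: "C \<ge> 0" using C1(1) C2(1) C3(1) by (simp add: C_def)
  have bound: "norm (\<Sum>n = 1..\<lfloor>X\<rfloor>. lam n * of_nat (num_sum_squares l n) * chi n)
             \<le> C * real p powr e * X powr (real l / 2 - e + \<epsilon>)"
    if chi: "dirichlet_character p chi" and pX: "real p < X" for p chi X
  proof -
    have p: "p > 0" using chi by (simp add: dirichlet_character_def)
    have per: "chi (n + int p) = chi n" for n using chi by (simp add: dirichlet_character_def)
    have X: "X \<ge> 1" using p pX by linarith
    define H where "H = nat \<lfloor>sqrt X\<rfloor>"
    note Hf = floor_sqrt_facts[OF X, folded H_def]
    define b where "b = (\<lambda>n. lam n * chi n)"
    define T where "T = sqrt (real p) * (C1 * X powr (1/2 + \<delta>))"
    define E where "E = real (square_energy H)"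
    define V where "V = (\<Sum>n\<in>{1..\<lfloor>X\<rfloor>}. (norm (b n))\<^sup>2)"
    have T0: "T \<ge> 0" using C1(1) by (simp add: T_def)
    have Tb: "norm (\<Sum>n\<in>{1..\<lfloor>X\<rfloor>}. b n * unit_exp (of_int n * \<alpha>)) \<le> T" for \<alpha>
      unfolding b_def T_def
      by (rule twisted_sum_bound[where chi = chi, OF p per dirichlet_character_norm_le_1[OF chi]]) (rule C1(2)[rule_format, OF X])
    have Eb: "E \<le> C2 * X powr (1 + \<delta>)" "E \<ge> 0" using C2(2)[rule_format, OF X] by (simp_all add: E_def H_def)
    have Vb: "V \<le> C3 * X"
    proof -
      have "V \<le> (\<Sum>n\<in>{1..\<lfloor>X\<rfloor>}. (norm (lam n))\<^sup>2)"
        unfolding V_def b_def norm_mult using dirichlet_character_norm_le_1[OF chi]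
        by (intro sum_mono power_mono) (simp_all add: mult_left_le)
      thus ?thesis using C3(2)[rule_format, OF X] by linarith
    qed
    have V0: "V \<ge> 0" by (simp add: V_def sum_nonneg)
    have X0: "X > 0" using X by simp
    have Xp: "X powr u \<le> X powr v" if "u \<le> v" for u v
      using X that by (intro powr_mono) simp_all
    have sum_eq: "(\<Sum>n = 1..\<lfloor>X\<rfloor>. lam n * of_nat (num_sum_squares l n) * chi n)
        = (\<Sum>n\<in>{1..\<lfloor>X\<rfloor>}. b n * of_nat (num_sum_squares l n))"
      unfolding b_def by (intro sum.cong refl) (simp only: mult_ac)
    have "norm (\<Sum>n\<in>{1..\<lfloor>X\<rfloor>}. b n * of_nat (num_sum_squares l n)) \<le> C * (real p powr e * X powr (real l / 2 + \<epsilon> - e))"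
    proof (cases "l = 3")
      case True
      have "norm (\<Sum>n\<in>{1..\<lfloor>X\<rfloor>}. b n * of_nat (num_sum_squares l n)) \<le> sqrt (T * E * sqrt (E * V))"
        unfolding True E_def V_def by (rule circle_method_bounds(2)[OF Hf(3) Tb])
      also have "\<dots> \<le> sqrt (T * (C2 * X powr (1 + \<delta>)) * sqrt ((C2 * X powr (1 + \<delta>)) * (C3 * X)))"
        using T0 Eb V0 Vb C2(1) C3(1) X0
        by (intro real_sqrt_le_mono mult_mono order_refl) simp_all
      also have "\<dots> = sqrt ((C1 * C2 * sqrt (C2 * C3)) * (sqrt (real p) *
            (X powr (1/2 + \<delta>) * X powr (1 + \<delta>) * sqrt (X powr (1 + \<delta>) * X))))"
        unfolding T_def by (simp add: real_sqrt_mult)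
      also have "\<dots> = C * (sqrt (sqrt (real p)) * sqrt (X powr (1/2 + \<delta>) * X powr (1 + \<delta>) * sqrt (X powr (1 + \<delta>) * X)))"
        unfolding C_def by (simp only: real_sqrt_mult True if_True refl mult.assoc)
      also have "sqrt (sqrt (real p)) = real p powr (1/4)"
        using p by (simp add: powr_half_sqrt[symmetric] powr_powr)
      also have "sqrt (X powr (1/2 + \<delta>) * X powr (1 + \<delta>) * sqrt (X powr (1 + \<delta>) * X)) = X powr (5/4 + 5/4 * \<delta>)"
      proof -
        have "X powr (1 + \<delta>) * X = X powr (2 + \<delta>)"
        proof -
          have "X powr (1 + \<delta>) * X powr 1 = X powr (2 + \<delta>)" unfolding powr_add[symmetric] by (simp add: add.commute)
          thus ?thesis using X0 by simp
        qed
        hence "sqrt (X powr (1 + \<delta>) * X) = X powr (1 + \<delta> / 2)"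
          by (simp add: powr_half_sqrt[symmetric] powr_powr add_divide_distrib)
        hence "X powr (1/2 + \<delta>) * X powr (1 + \<delta>) * sqrt (X powr (1 + \<delta>) * X)
           = X powr ((1/2 + \<delta>) + (1 + \<delta>) + (1 + \<delta> / 2))" by (simp only: powr_add)
        also have "(1/2 + \<delta>) + (1 + \<delta>) + (1 + \<delta> / 2) = 5/2 + 5/2 * \<delta>" by simp
        also have "sqrt (X powr (5/2 + 5/2 * \<delta>)) = X powr (5/4 + 5/4 * \<delta>)"
          by (simp add: powr_half_sqrt[symmetric] powr_powr add_divide_distrib)
        finally show ?thesis by simp
      qed
      also have "C * (real p powr (1/4) * X powr (5/4 + 5/4 * \<delta>))
          \<le> C * (real p powr (1/4) * X powr ((real l / 2 + \<epsilon>) - 1/4))"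
        using C0 eps True by (intro mult_left_mono Xp) (simp_all add: \<delta>_def)
      also have "\<dots> \<le> C * (real p powr e * X powr (real l / 2 + \<epsilon> - e))"
        using p pX True C0 by (intro mult_left_mono trade_conductor_power) (simp_all add: e_def)
      finally show ?thesis .
    next
      case False
      hence l4: "l \<ge> 4" using l by simp
      have "norm (\<Sum>n\<in>{1..\<lfloor>X\<rfloor>}. b n * of_nat (num_sum_squares l n)) \<le> T * (2 * real H + 1) ^ (l - 4) * E"
        unfolding E_def by (rule circle_method_bounds(1)[OF Hf(3) Tb l4])
      also have "\<dots> \<le> T * (3 * sqrt X) ^ (l - 4) * (C2 * X powr (1 + \<delta>))"
      proof (intro mult_mono power_mono order_refl Eb)
        have "sqrt X \<ge> 1" using X by simp
        thus "2 * real H + 1 \<le> 3 * sqrt X" using Hf(2) by linarith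
      qed (use T0 X in simp_all)
      also have "\<dots> = C * (sqrt (real p) * (X powr (1/2 + \<delta>) * sqrt X ^ (l - 4) * X powr (1 + \<delta>)))"
        unfolding T_def C_def using False by (simp add: power_mult_distrib)
      also have "sqrt X ^ (l - 4) = X powr (real l / 2 - 2)"
      proof -
        have "sqrt X ^ (l - 4) = (X powr (1/2)) powr real (l - 4)"
          using X0 by (simp add: powr_half_sqrt powr_realpow)
        also have "\<dots> = X powr (1/2 * real (l - 4))" by (simp only: powr_powr)
        also have "1/2 * real (l - 4) = real l / 2 - 2" using l4 by (simp add: of_nat_diff)
        finally show ?thesis .
      qed
      also have "X powr (1/2 + \<delta>) * X powr (real l / 2 - 2) * X powr (1 + \<delta>) = X powr ((real l / 2 + \<epsilon>) - 1/2)"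
        unfolding powr_add[symmetric] by (rule arg_cong[where f = "\<lambda>u. X powr u"]) (simp add: \<delta>_def)
      also have "sqrt (real p) = real p powr (1/2)" by (simp add: powr_half_sqrt)
      also have "C * (real p powr (1/2) * X powr ((real l / 2 + \<epsilon>) - 1/2))
          \<le> C * (real p powr e * X powr (real l / 2 + \<epsilon> - e))"
      proof (intro mult_left_mono trade_conductor_power)
        show "e \<le> 1/2" by (simp add: e_def field_simps)
      qed (use p pX C0 in simp_all)
      finally show ?thesis .
    qed
    moreover have "real l / 2 + \<epsilon> - e = real l / 2 - e + \<epsilon>" by simp
    ultimately show ?thesis unfolding sum_eq by (simp only: mult.assoc)
  qed
  show ?thesis unfolding e_def[symmetric]
    by (intro exI[of _ C] allI impI bound)
qed

theorem theorem1p2: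
  fixes f :: "complex \<Rightarrow> complex" and lam :: "int \<Rightarrow> complex"
    and \<kappa> :: nat and \<mu> :: real and l :: nat and \<epsilon> :: real
  assumes form: "(even \<kappa> \<and> f \<in> primitive_holomorphic_forms \<kappa> \<and> holomorphic_fourier_coeffs \<kappa> f lam) \<or>
                 (\<mu> > 0 \<and> f \<in> primitive_maass_forms \<mu> \<and> maass_fourier_coeffs \<mu> f lam)"
    and l: "l \<ge> 3"
    and eps: "\<epsilon> > 0"
  shows "\<exists>C::real. \<forall>(p::nat) (chi :: int \<Rightarrow> complex) (X::real).
           prime p \<longrightarrow> primitive_dirichlet_character p chi \<longrightarrow> real p < X \<longrightarrow>
           norm (\<Sum>n = 1..\<lfloor>X\<rfloor>. lam n * of_nat (num_sum_squares l n) * chi n)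
             \<le> C * real p powr ((real l - 2) / (2 * real l + 1))
                 * X powr (real l / 2 - (real l - 2) / (2 * real l + 1) + \<epsilon>)"
proof -
  have "\<exists>lam' W B. (\<forall>n\<ge>1. lam' n = lam n) \<and> cusp_weight W \<and> bounded_fourier_family lam' W B"
    using form
  proof (elim disjE conjE)
    assume f: "f \<in> primitive_holomorphic_forms \<kappa>" and c: "holomorphic_fourier_coeffs \<kappa> f lam"
    have "holomorphic_cusp_form \<kappa> f" using f by (simp add: primitive_holomorphic_forms_def)
    from holomorphic_form_family[OF this c] cusp_weight_holomorphic[of \<kappa>] show ?thesis
      by (elim exE) (intro exI conjI; assumption?; simp)
  next
    assume \<mu>: "\<mu> > 0" and f: "f \<in> primitive_maass_forms \<mu>" and c: "maass_fourier_coeffs \<mu> f lam"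
    have "maass_cusp_form \<mu> f" using f by (simp add: primitive_maass_forms_def)
    from maass_form_family[OF \<mu> this c] cusp_weight_bessel[OF \<mu>] show ?thesis
      by (elim exE) (intro exI conjI; assumption?; simp)
  qed
  then obtain lam' W B where lam': "\<And>n. n \<ge> 1 \<Longrightarrow> lam' n = lam n" and W: "cusp_weight W"
      and fam: "bounded_fourier_family lam' W B" by (elim exE conjE) (rule that; simp)
  obtain a m L where reg: "regular_weight W a m L" using cusp_weight_regular[OF W] .
  obtain C where C: "\<forall>p chi X. dirichlet_character p chi \<longrightarrow> real p < X \<longrightarrow>
           norm (\<Sum>n = 1..\<lfloor>X\<rfloor>. lam' n * of_nat (num_sum_squares l n) * chi n)
             \<le> C * real p powr ((real l - 2) / (2 * real l + 1))
                 * X powr (real l / 2 - (real l - 2) / (2 * real l + 1) + \<epsilon>)"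
    using sum_of_squares_twist_bound[OF fam reg l eps] by (elim exE) (rule that)
  have eq: "(\<Sum>n = 1..\<lfloor>X\<rfloor>. lam n * of_nat (num_sum_squares l n) * chi n)
      = (\<Sum>n = 1..\<lfloor>X\<rfloor>. lam' n * of_nat (num_sum_squares l n) * chi n)" for chi and X :: real
    by (intro sum.cong refl) (simp add: lam')
  show ?thesis unfolding eq
    by (intro exI[of _ C] allI impI C[rule_format]) (simp_all add: primitive_dirichlet_character_def)
qed

end
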